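(* Let $T>0$, $p\ge2$, and let $(\mathcal D_m)_{m\in\mathbb N}$ be a sequence of space-time gradient discretisations that is consistent and compact. For each $m$ let $\beta_m=(\beta_m^{(n)})_{n=0,\dots,N_m}\subset X_{\mathcal D_m,0}$ and $\zeta_m=(\zeta_m^{(n)})_{n=0,\dots,N_m}\subset X_{\mathcal D_m,0}$ be such that: the sequences $\big(\int_0^T|\delta_{\mathcal D_m}\beta_m(t)|_{\star,\mathcal D_m}dt\big)_m$ and $\big(\|\nabla_{\mathcal D_m}\zeta_m\|_{L^2(0,T;L^p(\Omega)^d)}\big)_m$ are bounded; and $\Pi_{\mathcal D_m}\beta_m\to\overline\beta$, $\Pi_{\mathcal D_m}\zeta_m\to\overline\zeta$ weakly in $L^2(\Omega\times(0,T))$. Then for every $\varphi\in C(\overline\Omega\times[0,T])$, $$\lim_{m\to\infty}\int_0^T\!\!\int_\Omega\Pi_{\mathcal D_m}\beta_m\,\Pi_{\mathcal D_m}\zeta_m\,\varphi\,dx\,dt=\int_0^T\!\!\int_\Omega\overline\beta\,\overline\zeta\,\varphi\,dx\,dt.$$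
   Context: Fix an open bounded set $\Omega\subset\mathbb R^d$ ($d\ge1$), $T>0$, $p\in(1,\infty)$. Space-time gradient discretisation: $\mathcal D=(X_{\mathcal D,0},\Pi_{\mathcal D},\nabla_{\mathcal D},\mathcal I_{\mathcal D},(t^{(n)})_{n=0}^N)$ with $X_{\mathcal D,0}=\mathbb R^I$ ($I$ finite), a family $(\Omega_i)_{i\in I}$ of disjoint subsets with union $\Omega$ and $\Pi_{\mathcal D}u=u_i$ on $\Omega_i$; $\nabla_{\mathcal D}:X_{\mathcal D,0}\to L^p(\Omega)^d$ linear with $\|\nabla_{\mathcal D}\cdot\|_{L^p}$ a norm; $\mathcal I_{\mathcal D}:L^2(\Omega)\to X_{\mathcal D,0}$ linear; $0=t^{(0)}<\dots<t^{(N)}=T$, $\delta t^{(n+1/2)}=t^{(n+1)}-t^{(n)}$, $\delta t_{\mathcal D}=\max_n\delta t^{(n+1/2)}$. Dual semi-norm: $|w|_{\star,\mathcal D}=\sup\{\int_\Omega\Pi_{\mathcal D}w\,\Pi_{\mathcal D}z\,dx: z\in X_{\mathcal D,0},\ \|\nabla_{\mathcal D}z\|_{L^p(\Omega)^d}=1\}$. For $v=(v^{(n)})_n\subset X_{\mathcal D,0}$: $\Pi_{\mathcal D}v(\cdot,0)=\Pi_{\mathcal D}v^{(0)}$ and for $t\in(t^{(n)},t^{(n+1)}]$, $\Pi_{\mathcal D}v(\cdot,t)=\Pi_{\mathcal D}v^{(n+1)}$, $\nabla_{\mathcal D}v(\cdot,t)=\nabla_{\mathcal D}v^{(n+1)}$,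 $\delta_{\mathcal D}v(t)=(v^{(n+1)}-v^{(n)})/\delta t^{(n+1/2)}$. Consistency of $(\mathcal D_m)$: $\widehat S_{\mathcal D_m}(\varphi)\to0$ for all $\varphi\in L^2(\Omega)\cap W^{1,p}_0(\Omega)$, where $\widehat S_{\mathcal D}(\varphi)=\min_{w\in X_{\mathcal D,0}}(\|\Pi_{\mathcal D}w-\varphi\|_{L^{\max(p,2)}(\Omega)}+\|\nabla_{\mathcal D}w-\nabla\varphi\|_{L^p(\Omega)^d})$; $\Pi_{\mathcal D_m}\mathcal I_{\mathcal D_m}\varphi\to\varphi$ in $L^2$ for all $\varphi\in L^2(\Omega)$; and $\delta t_{\mathcal D_m}\to0$. Compactness: $\lim_{\xi\to0}\sup_mT_{\mathcal D_m}(\xi)=0$, where $T_{\mathcal D}(\xi)=\max_{v\ne0}\|\Pi_{\mathcal D}v(\cdot+\xi)-\Pi_{\mathcal D}v\|_{L^p(\mathbb R^d)}/\|\nabla_{\mathcal D}v\|_{L^p(\Omega)^d}$ ($\Pi_{\mathcal D}v$ extended by $0$ outside $\Omega$). *)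

theory Defs
  imports "HOL-Analysis.Analysis"
begin

definition memLp :: "'b measure \<Rightarrow> real \<Rightarrow> ('b \<Rightarrow> 'c::{real_normed_vector,second_countable_topology}) \<Rightarrow> bool" where
  "memLp M p f \<longleftrightarrow> f \<in> borel_measurable M \<and> integrable M (\<lambda>x. norm (f x) powr p)"

definition lpnorm :: "'b measure \<Rightarrow> real \<Rightarrow> ('b \<Rightarrow> 'c::real_normed_vector) \<Rightarrow> real" where
  "lpnorm M p f = (\<integral>x. norm (f x) powr p \<partial>M) powr (1 / p)"

definition pd_dir :: "'a::euclidean_space \<Rightarrow> ('a \<Rightarrow> real) \<Rightarrow> 'a \<Rightarrow> real" where
  "pd_dir b f = (\<lambda>x. frechet_derivative f (at x) b)"

fun iter_pd :: "'a::euclidean_space list \<Rightarrow> ('a \<Rightarrow> real) \<Rightarrow> 'a \<Rightarrow> real" where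
  "iter_pd [] f = f"
| "iter_pd (b # bs) f = pd_dir b (iter_pd bs f)"

definition Cinf :: "('a::euclidean_space \<Rightarrow> real) \<Rightarrow> bool" where
  "Cinf f \<longleftrightarrow> (\<forall>bs. set bs \<subseteq> Basis \<longrightarrow> (\<forall>x. iter_pd bs f differentiable (at x)))"

definition Cc_inf :: "'a::euclidean_space set \<Rightarrow> ('a \<Rightarrow> real) \<Rightarrow> bool" where
  "Cc_inf \<Omega> f \<longleftrightarrow> Cinf f \<and> compact (closure {x. f x \<noteq> 0}) \<and> closure {x. f x \<noteq> 0} \<subseteq> \<Omega>"

definition grad_fun :: "('a::euclidean_space \<Rightarrow> real) \<Rightarrow> 'a \<Rightarrow> 'a" where
  "grad_fun f x = (\<Sum>b\<in>Basis. frechet_derivative f (at x) b *\<^sub>R b)"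

text \<open>phi belongs to W^{1,p}_0(Omega) (closure of C_c^infinity(Omega) in the W^{1,p} norm),
  and G is its (weak) gradient.\<close>
definition W1p0 :: "'a::euclidean_space set \<Rightarrow> real \<Rightarrow> ('a \<Rightarrow> real) \<Rightarrow> ('a \<Rightarrow> 'a) \<Rightarrow> bool" where
  "W1p0 \<Omega> p \<phi> G \<longleftrightarrow> memLp (lebesgue_on \<Omega>) p \<phi> \<and> memLp (lebesgue_on \<Omega>) p G \<and>
     (\<exists>\<psi>. (\<forall>k. Cc_inf \<Omega> (\<psi> k)) \<and>
        (\<lambda>k. lpnorm (lebesgue_on \<Omega>) p (\<lambda>x. \<psi> k x - \<phi> x)) \<longlonglongrightarrow> 0 \<and>
        (\<lambda>k. lpnorm (lebesgue_on \<Omega>) p (\<lambda>x. grad_fun (\<psi> k) x - G x)) \<longlonglongrightarrow> 0)"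

text \<open>Unknowns are indexed by a finite set I of naturals; X_{D,0} = R^I is represented by
  the functions nat => real vanishing outside I.\<close>
record 'a gdisc =
  gd_I :: "nat set"
  gd_cell :: "nat \<Rightarrow> 'a set"
  gd_grad :: "(nat \<Rightarrow> real) \<Rightarrow> 'a \<Rightarrow> 'a"
  gd_interp :: "('a \<Rightarrow> real) \<Rightarrow> nat \<Rightarrow> real"
  gd_N :: nat
  gd_t :: "nat \<Rightarrow> real"

definition XD :: "'a gdisc \<Rightarrow> (nat \<Rightarrow> real) set" where
  "XD D = {u. \<forall>i. i \<notin> gd_I D \<longrightarrow> u i = 0}"

definition PiD :: "'a gdisc \<Rightarrow> (nat \<Rightarrow> real) \<Rightarrow> 'a \<Rightarrow> real" where
  "PiD D u x = (\<Sum>i\<in>gd_I D. u i * indicator (gd_cell D i) x)"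

definition is_stgd :: "'a::euclidean_space set \<Rightarrow> real \<Rightarrow> real \<Rightarrow> 'a gdisc \<Rightarrow> bool" where
  "is_stgd \<Omega> p T D \<longleftrightarrow>
     finite (gd_I D) \<and>
     (\<forall>i\<in>gd_I D. gd_cell D i \<in> sets lebesgue) \<and>
     (\<forall>i\<in>gd_I D. \<forall>j\<in>gd_I D. i \<noteq> j \<longrightarrow> gd_cell D i \<inter> gd_cell D j = {}) \<and>
     (\<Union>i\<in>gd_I D. gd_cell D i) = \<Omega> \<and>
     (\<forall>u\<in>XD D. memLp (lebesgue_on \<Omega>) p (gd_grad D u)) \<and>
     (\<forall>u\<in>XD D. \<forall>v\<in>XD D. \<forall>a b. AE x in lebesgue_on \<Omega>.
         gd_grad D (\<lambda>i. a * u i + b * v i) x = a *\<^sub>R gd_grad D u x + b *\<^sub>R gd_grad D v x) \<and>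
     (\<forall>u\<in>XD D. lpnorm (lebesgue_on \<Omega>) p (gd_grad D u) = 0 \<longrightarrow> (\<forall>i. u i = 0)) \<and>
     (\<forall>f. gd_interp D f \<in> XD D) \<and>
     (\<forall>f g. memLp (lebesgue_on \<Omega>) 2 f \<longrightarrow> memLp (lebesgue_on \<Omega>) 2 g \<longrightarrow>
         (AE x in lebesgue_on \<Omega>. f x = g x) \<longrightarrow> gd_interp D f = gd_interp D g) \<and>
     (\<forall>f g a b. memLp (lebesgue_on \<Omega>) 2 f \<longrightarrow> memLp (lebesgue_on \<Omega>) 2 g \<longrightarrow>
         gd_interp D (\<lambda>x. a * f x + b * g x) = (\<lambda>i. a * gd_interp D f i + b * gd_interp D g i)) \<and>
     gd_t D 0 = 0 \<and> (\<forall>n<gd_N D. gd_t D n < gd_t D (Suc n)) \<and> gd_t D (gd_N D) = T"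

definition dtD :: "'a gdisc \<Rightarrow> real" where
  "dtD D = Max {gd_t D (Suc n) - gd_t D n | n. n < gd_N D}"

text \<open>Time index: for t in (t^(n), t^(n+1)] this is n+1; for t = 0 it is 0.\<close>
definition kidx :: "'a gdisc \<Rightarrow> real \<Rightarrow> nat" where
  "kidx D t = (LEAST n. t \<le> gd_t D n)"

definition PiST :: "'a gdisc \<Rightarrow> (nat \<Rightarrow> nat \<Rightarrow> real) \<Rightarrow> 'a \<times> real \<Rightarrow> real" where
  "PiST D v z = PiD D (v (kidx D (snd z))) (fst z)"

definition gradST :: "'a gdisc \<Rightarrow> (nat \<Rightarrow> nat \<Rightarrow> real) \<Rightarrow> real \<Rightarrow> 'a \<Rightarrow> 'a" where
  "gradST D v t = gd_grad D (v (kidx D t))"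

definition deltaD :: "'a gdisc \<Rightarrow> (nat \<Rightarrow> nat \<Rightarrow> real) \<Rightarrow> real \<Rightarrow> nat \<Rightarrow> real" where
  "deltaD D v t = (\<lambda>i. (v (kidx D t) i - v (kidx D t - 1) i) /
                        (gd_t D (kidx D t) - gd_t D (kidx D t - 1)))"

definition dualnorm :: "'a::euclidean_space set \<Rightarrow> real \<Rightarrow> 'a gdisc \<Rightarrow> (nat \<Rightarrow> real) \<Rightarrow> real" where
  "dualnorm \<Omega> p D w = Sup {(\<integral>x. PiD D w x * PiD D z x \<partial>lebesgue_on \<Omega>) | z.
       z \<in> XD D \<and> lpnorm (lebesgue_on \<Omega>) p (gd_grad D z) = 1}"

definition S_hat :: "'a::euclidean_space set \<Rightarrow> real \<Rightarrow> 'a gdisc \<Rightarrow> ('a \<Rightarrow> real) \<Rightarrow> ('a \<Rightarrow> 'a) \<Rightarrow> real" where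
  "S_hat \<Omega> p D \<phi> G = Inf {lpnorm (lebesgue_on \<Omega>) (max p 2) (\<lambda>x. PiD D w x - \<phi> x)
        + lpnorm (lebesgue_on \<Omega>) p (\<lambda>x. gd_grad D w x - G x) | w. w \<in> XD D}"

definition T_comp :: "'a::euclidean_space set \<Rightarrow> real \<Rightarrow> 'a gdisc \<Rightarrow> 'a \<Rightarrow> real" where
  "T_comp \<Omega> p D \<xi> = Sup {lpnorm lebesgue p (\<lambda>x. PiD D v (x + \<xi>) - PiD D v x)
        / lpnorm (lebesgue_on \<Omega>) p (gd_grad D v) | v. v \<in> XD D \<and> v \<noteq> (\<lambda>i. 0)}"

definition consistent :: "'a::euclidean_space set \<Rightarrow> real \<Rightarrow> (nat \<Rightarrow> 'a gdisc) \<Rightarrow> bool" where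
  "consistent \<Omega> p Ds \<longleftrightarrow>
     (\<forall>\<phi> G. memLp (lebesgue_on \<Omega>) 2 \<phi> \<longrightarrow> W1p0 \<Omega> p \<phi> G \<longrightarrow>
         (\<lambda>m. S_hat \<Omega> p (Ds m) \<phi> G) \<longlonglongrightarrow> 0) \<and>
     (\<forall>\<phi>. memLp (lebesgue_on \<Omega>) 2 \<phi> \<longrightarrow>
         (\<lambda>m. lpnorm (lebesgue_on \<Omega>) 2 (\<lambda>x. PiD (Ds m) (gd_interp (Ds m) \<phi>) x - \<phi> x)) \<longlonglongrightarrow> 0) \<and>
     (\<lambda>m. dtD (Ds m)) \<longlonglongrightarrow> 0"

definition compact_gd :: "'a::euclidean_space set \<Rightarrow> real \<Rightarrow> (nat \<Rightarrow> 'a gdisc) \<Rightarrow> bool" where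
  "compact_gd \<Omega> p Ds \<longleftrightarrow> ((\<lambda>\<xi>. SUP m. ereal (T_comp \<Omega> p (Ds m) \<xi>)) \<longlongrightarrow> 0) (at 0)"

end

theory Submission
  imports Defs
begin

text \<open>
  Write \<open>\<beta>\<^sub>n\<close>, \<open>\<zeta>\<^sub>m\<close> for the reconstructions and \<open>B n m = \<integral> \<beta>\<^sub>n \<zeta>\<^sub>m \<phi>\<close>. Weak convergence gives
  the iterated limit of \<open>B\<close>, so it suffices that \<open>B n m\<close> is Cauchy in \<open>n\<close> uniformly in \<open>m\<close>.
  The translation estimate coming from compactness allows one to replace \<open>\<zeta>\<^sub>m\<close> by its spatial
  mollification, uniformly in \<open>m\<close>; the resulting kernel \<open>\<rho>(y - x) \<phi>(x, t)\<close> is approximated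
  uniformly by sums of products \<open>a(x) c(t) d(y)\<close> (Stone--Weierstrass). For such a product one
  needs only that \<open>t \<mapsto> \<integral> \<beta>\<^sub>n(x, t) a(x) dx\<close> is Cauchy in \<open>L\<^sup>2(0, T)\<close>. After cutting off \<open>a\<close>
  near the boundary, consistency replaces it by \<open>\<Pi>w\<^sub>n\<close> with bounded discrete gradients, and then
  these functions of time have bounded variation by the bound on the dual semi-norms; together
  with the weak convergence of \<open>\<beta>\<^sub>n\<close> this gives strong convergence in time. The bounds in
  \<open>L\<^sup>2\<close> used throughout follow from weak convergence by the uniform boundedness principle.
\<close>


section \<open>Smooth functions\<close>

text \<open>Only the variation of \<open>\<beta>\<close> in time and that of \<open>\<zeta>\<close>
  in space are controlled, the former by a norm dual to the discrete gradients of its own mesh. Two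
  independent indices \<open>n\<close> and \<open>m\<close> separate the controls, but then two
  unrelated meshes meet, and a discrete function of \<open>Ds m\<close> cannot be tested in the dual
  semi-norm of \<open>Ds n\<close>. Hence the detour through a mesh-free kernel: in a separated term
  \<open>\<zeta>\<^sub>m\<close> survives only as a function of time bounded in L^2, and the smooth
  factor \<open>a(x)\<close> is all that is interpolated in \<open>Ds n\<close>. Uniformity in
  \<open>m\<close> results because \<open>\<zeta>\<^sub>m\<close> enters only through an L^2 bound
  and a modulus of translation. The inequality p >= 2 acts twice: it makes
  \<open>max p 2 = p\<close>, and it turns L^p smallness into L^2 smallness on bounded sets. The
  suprema in \<open>dualnorm\<close> and \<open>T_comp\<close> bound their elements only once the
  underlying sets are known to be bounded above; the equivalence of norms on the finite-dimensional
  \<open>XD\<close> supplies this.\<close>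

definition flat :: "nat \<Rightarrow> real \<Rightarrow> real" where
  "flat n s = (if s > 0 then (1 / s) ^ n * exp (- (1 / s)) else 0)"

lemma flat_nonneg: "0 \<le> flat n s"
  by (simp add: flat_def)

lemma flat_0_less_1: "flat 0 s < 1"
  by (simp add: flat_def)

lemma flat_pos_iff: "0 < flat n s \<longleftrightarrow> s > 0"
  by (simp add: flat_def)

lemma flat_tendsto_0_right: "(flat n \<longlongrightarrow> 0) (at_right 0)"
proof -
  have "((\<lambda>s::real. (inverse s) ^ n / exp (inverse s)) \<longlongrightarrow> 0) (at_right 0)"
    by (rule filterlim_compose[OF tendsto_power_div_exp_0 filterlim_inverse_at_top_right])
  moreover have "eventually (\<lambda>s. (inverse s) ^ n / exp (inverse s) = flat n s) (at_right 0)"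
    by (rule eventually_at_right_less[THEN eventually_mono])
       (auto simp: flat_def exp_minus divide_simps)
  ultimately show ?thesis
    by (rule Lim_transform_eventually)
qed

text \<open>The exponent \<open>n\<close> exists for this formula: differentiating s^{-n} exp(-1/s)
  only shifts it, so one family covers all derivatives of the bump function. At s = 0 the difference
  quotient vanishes on the left and equals \<open>flat (Suc n)\<close> on the right.\<close>

lemma flat_has_derivative:
  "(flat n has_real_derivative flat (n + 2) s - real n * flat (n + 1) s) (at s)"
proof -
  consider "s > 0" | "s < 0" | "s = 0" by linarith
  then show ?thesis
  proof cases
    case 1
    have power_Suc_pred: "s ^ k = s * s ^ (k - Suc 0) \<or> k = 0" for k
      by (cases k) auto
    have "((\<lambda>s. (1 / s) ^ n * exp (- (1 / s))) has_real_derivative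
        flat (n + 2) s - real n * flat (n + 1) s) (at s)"
      using 1
      by (cases n)
         (use power_Suc_pred[of "n - Suc 0"] in \<open>auto intro!: derivative_eq_intros simp: flat_def field_simps power2_eq_square\<close>)
    then show ?thesis
      by (rule has_field_derivative_transform_within_open[of _ _ _ "{0<..}"])
         (use 1 in \<open>auto simp: flat_def\<close>)
  next
    case 2
    have "((\<lambda>s. 0) has_real_derivative 0) (at s)" by simp
    then have "(flat n has_real_derivative 0) (at s)"
      by (rule has_field_derivative_transform_within_open[of _ _ _ "{..<0}"])
         (use 2 in \<open>auto simp: flat_def\<close>)
    then show ?thesis using 2 by (simp add: flat_def)
  next
    case 3
    have "((\<lambda>h. (flat n (0 + h) - flat n 0) / h) \<longlongrightarrow> 0) (at 0)"
      unfolding filterlim_at_split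
    proof
      show "((\<lambda>h. (flat n (0 + h) - flat n 0) / h) \<longlongrightarrow> 0) (at_left 0)"
        by (rule Lim_transform_eventually[OF tendsto_const])
           (auto simp: flat_def eventually_at_left_field intro!: exI[of _ "-1"])
      show "((\<lambda>h. (flat n (0 + h) - flat n 0) / h) \<longlongrightarrow> 0) (at_right 0)"
        by (rule Lim_transform_eventually[OF flat_tendsto_0_right[of "Suc n"]],
            rule eventually_at_right_less[THEN eventually_mono])
           (auto simp: flat_def)
    qed
    then show ?thesis using 3 by (simp add: DERIV_def flat_def)
  qed
qed

text \<open>A class of functions that is visibly closed under partial derivatives.\<close>

inductive smooth_expr :: "('a::euclidean_space \<Rightarrow> real) \<Rightarrow> bool" where
  const: "smooth_expr (\<lambda>x. c)"
| inner: "smooth_expr (\<lambda>x. x \<bullet> v)"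
| square: "smooth_expr (\<lambda>x. x \<bullet> x)"
| add: "smooth_expr f \<Longrightarrow> smooth_expr g \<Longrightarrow> smooth_expr (\<lambda>x. f x + g x)"
| mult: "smooth_expr f \<Longrightarrow> smooth_expr g \<Longrightarrow> smooth_expr (\<lambda>x. f x * g x)"
| flat: "smooth_expr f \<Longrightarrow> smooth_expr (\<lambda>x. flat n (f x))"

lemma smooth_expr_cmult: "smooth_expr f \<Longrightarrow> smooth_expr (\<lambda>x. c * f x)"
  by (intro smooth_expr.intros)

lemma smooth_expr_diff: "smooth_expr f \<Longrightarrow> smooth_expr g \<Longrightarrow> smooth_expr (\<lambda>x. f x - g x)"
  using smooth_expr.add[OF _ smooth_expr_cmult[of g "-1"]] by simp

lemma smooth_expr_power: "smooth_expr f \<Longrightarrow> smooth_expr (\<lambda>x. f x ^ n)"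
  by (induction n) (auto intro: smooth_expr.intros)

lemma smooth_expr_prod:
  "(\<And>i. i < (n::nat) \<Longrightarrow> smooth_expr (f i)) \<Longrightarrow> smooth_expr (\<lambda>x. \<Prod>i<n. f i x)"
proof (induction n)
  case (Suc n)
  have "smooth_expr (\<lambda>x. (\<Prod>i<n. f i x) * f n x)"
    by (intro smooth_expr.mult Suc) auto
  then show ?case by simp
qed (auto intro: smooth_expr.intros)

text \<open>The induction carries the full derivative, which the product and chain rules consume,
  while membership in the class is claimed for each directional component; this is what iterating
  \<open>pd_dir\<close> needs.\<close>

lemma smooth_expr_derivative:
  assumes "smooth_expr f"
  shows "\<exists>f'. (\<forall>x. (f has_derivative f' x) (at x)) \<and> (\<forall>b. smooth_expr (\<lambda>x. f' x b))"
  using assms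
proof induction
  case (const c)
  show ?case by (rule exI[of _ "\<lambda>x h. 0"]) (auto intro: smooth_expr.intros)
next
  case (inner v)
  show ?case
    by (rule exI[of _ "\<lambda>x h. h \<bullet> v"]) (auto intro!: smooth_expr.intros derivative_eq_intros)
next
  case square
  have "smooth_expr (\<lambda>x. 2 * (x \<bullet> b))" for b :: 'a
    by (intro smooth_expr_cmult smooth_expr.intros)
  then show ?case
    by (intro exI[of _ "\<lambda>x h. 2 * (x \<bullet> h)"])
       (auto intro!: derivative_eq_intros simp: inner_commute)
next
  case (add f g)
  then obtain f' g' where *: "\<And>x. (f has_derivative f' x) (at x)" "\<And>b. smooth_expr (\<lambda>x. f' x b)"
     "\<And>x. (g has_derivative g' x) (at x)" "\<And>b. smooth_expr (\<lambda>x. g' x b)"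
    by blast
  show ?case
    by (rule exI[of _ "\<lambda>x h. f' x h + g' x h"])
       (auto intro!: * smooth_expr.intros has_derivative_add)
next
  case (mult f g)
  then obtain f' g' where *: "\<And>x. (f has_derivative f' x) (at x)" "\<And>b. smooth_expr (\<lambda>x. f' x b)"
     "\<And>x. (g has_derivative g' x) (at x)" "\<And>b. smooth_expr (\<lambda>x. g' x b)"
    by blast
  show ?case
    by (rule exI[of _ "\<lambda>x h. f x * g' x h + f' x h * g x"])
       (auto intro!: * mult.hyps smooth_expr.intros has_derivative_mult)
next
  case (flat f n)
  then obtain f' where *: "\<And>x. (f has_derivative f' x) (at x)" "\<And>b. smooth_expr (\<lambda>x. f' x b)"
    by blast
  have "((\<lambda>x. flat n (f x)) has_derivative
      (\<lambda>h. (flat (n + 2) (f x) - real n * flat (n + 1) (f x)) * f' x h)) (at x)" for x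
    using has_derivative_compose[OF *(1) flat_has_derivative[of n "f x", unfolded has_field_derivative_def]]
    by simp
  moreover have "smooth_expr (\<lambda>x. (flat (n + 2) (f x) - real n * flat (n + 1) (f x)) * f' x b)" for b
    by (intro smooth_expr_diff smooth_expr.mult smooth_expr_cmult smooth_expr.flat flat *)
  ultimately show ?case
    by (intro exI[of _ "\<lambda>x h. (flat (n + 2) (f x) - real n * flat (n + 1) (f x)) * f' x h"]) blast
qed

lemma smooth_expr_pd_dir:
  assumes "smooth_expr f" shows "smooth_expr (pd_dir b f)"
proof -
  obtain f' where *: "\<And>x. (f has_derivative f' x) (at x)" "\<And>b. smooth_expr (\<lambda>x. f' x b)"
    using smooth_expr_derivative[OF assms] by blast
  have "pd_dir b f = (\<lambda>x. f' x b)"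
    unfolding pd_dir_def using frechet_derivative_at[OF *(1)] by metis
  then show ?thesis using *(2) by simp
qed

lemma smooth_expr_differentiable: "smooth_expr f \<Longrightarrow> f differentiable (at x)"
  using smooth_expr_derivative unfolding differentiable_def by blast

lemma smooth_expr_continuous_on: "smooth_expr f \<Longrightarrow> continuous_on S f"
  by (meson continuous_at_imp_continuous_on differentiable_imp_continuous_within smooth_expr_differentiable)

lemma smooth_expr_Cinf:
  assumes "smooth_expr f" shows "Cinf f"
proof -
  have "smooth_expr (iter_pd bs f)" for bs
    by (induction bs) (auto intro: assms smooth_expr_pd_dir)
  then show ?thesis by (simp add: Cinf_def smooth_expr_differentiable)
qed

lemma smooth_expr_continuous_grad:
  assumes "smooth_expr f" shows "continuous_on S (grad_fun f)"
  using smooth_expr_continuous_on[OF smooth_expr_pd_dir[OF assms]]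
  unfolding grad_fun_def[abs_def] pd_dir_def
  by (intro continuous_intros)

text \<open>Countably many balls with closures in \<open>\<Omega>\<close> cover it (Lindelof), and
  \<open>h i\<close> is a bump with values in [0,1) that is positive exactly on the i-th ball. In
  \<open>\<kappa> n\<close> the number of factors and the exponent grow together: finitely many
  closed balls keep the support compact, and a single factor (1 - h i x)^n with
  \<open>h i x > 0\<close> already forces the product to 0. Pointwise convergence is what dominated
  convergence will ask for.\<close>

lemma open_smooth_cutoff:
  fixes \<Omega> :: "'a::euclidean_space set"
  assumes "open \<Omega>"
  obtains \<kappa> :: "nat \<Rightarrow> 'a \<Rightarrow> real" where
    "\<And>n. smooth_expr (\<kappa> n)" "\<And>n x. 0 \<le> \<kappa> n x" "\<And>n x. \<kappa> n x \<le> 1"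
    "\<And>n. compact (closure {x. \<kappa> n x \<noteq> 0})" "\<And>n. closure {x. \<kappa> n x \<noteq> 0} \<subseteq> \<Omega>"
    "\<And>x. x \<in> \<Omega> \<Longrightarrow> (\<lambda>n. \<kappa> n x) \<longlonglongrightarrow> 1"
proof (cases "\<Omega> = {}")
  case True
  show ?thesis by (rule that[of "\<lambda>n x. 0"]) (use True in \<open>auto intro: smooth_expr.intros\<close>)
next
  case False
  define F where "F = {ball c r |c r. 0 < r \<and> cball c r \<subseteq> \<Omega>}"
  obtain F' where F': "F' \<subseteq> F" "countable F'" "\<Union>F' = \<Union>F"
    using Lindelof[of F] unfolding F_def by auto
  have "\<Union>F = \<Omega>"
  proof
    show "\<Union>F \<subseteq> \<Omega>" unfolding F_def using ball_subset_cball by blast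
    show "\<Omega> \<subseteq> \<Union>F"
    proof
      fix x assume "x \<in> \<Omega>"
      then obtain r where "r > 0" "cball x r \<subseteq> \<Omega>"
        using assms open_contains_cball by blast
      then show "x \<in> \<Union>F" unfolding F_def by force
    qed
  qed
  then have U: "\<Union>F' = \<Omega>" and ne: "F' \<noteq> {}" using F' False by auto
  have "\<forall>i. \<exists>c r. from_nat_into F' i = ball c r \<and> 0 < r \<and> cball c r \<subseteq> \<Omega>"
    using from_nat_into[OF ne] F'(1) unfolding F_def by blast
  then obtain c r where cr: "\<And>i. from_nat_into F' i = ball (c i) (r i)" "\<And>i. 0 < r i"
    "\<And>i. cball (c i) (r i) \<subseteq> \<Omega>" by metis
  \<comment> \<open>This is r^2 - |x - c|^2 expanded into a constant and the generators
    \<open>inner\<close> and \<open>square\<close>, so that the result visibly lies in the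
    class.\<close>
  define h where "h i x = flat 0 (((r i)\<^sup>2 - c i \<bullet> c i) + (2 * (x \<bullet> c i) - x \<bullet> x))" for i x
  have h_alt: "h i x = flat 0 ((r i)\<^sup>2 - (dist (c i) x)\<^sup>2)" for i x
    by (simp add: h_def dist_norm power2_norm_eq_inner inner_diff_left inner_diff_right inner_commute
        algebra_simps)
  have h_sm: "smooth_expr (h i)" for i
    unfolding h_def[abs_def] by (intro smooth_expr_diff smooth_expr_cmult smooth_expr.intros)
  have h_range: "0 \<le> h i x" "h i x < 1" for i x
    by (simp_all add: h_def flat_nonneg flat_0_less_1)
  have h_pos: "0 < h i x \<longleftrightarrow> x \<in> ball (c i) (r i)" for i x
  proof -
    have "0 < h i x \<longleftrightarrow> \<not> (r i)\<^sup>2 \<le> (dist (c i) x)\<^sup>2"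
      by (simp add: h_alt flat_pos_iff not_le)
    also have "\<dots> \<longleftrightarrow> \<not> r i \<le> dist (c i) x"
      using cr(2)[of i] by (subst power_mono_iff) auto
    finally show ?thesis by auto
  qed
  define \<kappa> where "\<kappa> n x = 1 - (\<Prod>i<n. (1 - h i x) ^ n)" for n x
  have pr: "0 \<le> (\<Prod>i<n. (1 - h i x) ^ n)" "(\<Prod>i<n. (1 - h i x) ^ n) \<le> 1" for n x
    using h_range[of _ x] less_imp_le[OF h_range(2)[of _ x]]
    by (auto intro!: prod_nonneg prod_le_1 power_le_one)
  have supp: "closure {x. \<kappa> n x \<noteq> 0} \<subseteq> (\<Union>i<n. cball (c i) (r i))" for n
  proof (rule closure_minimal)
    show "{x. \<kappa> n x \<noteq> 0} \<subseteq> (\<Union>i<n. cball (c i) (r i))"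
    proof (rule ccontr)
      assume "\<not> ?thesis"
      then obtain x where x: "\<kappa> n x \<noteq> 0" "\<And>i. i < n \<Longrightarrow> x \<notin> cball (c i) (r i)" by blast
      then have "h i x = 0" if "i < n" for i
        using h_pos[of i x] h_range[of i x] that ball_subset_cball by force
      then show False using x(1) by (simp add: \<kappa>_def)
    qed
  qed auto
  show ?thesis
  proof (rule that)
    show "smooth_expr (\<kappa> n)" for n
      unfolding \<kappa>_def[abs_def]
      by (intro smooth_expr_diff smooth_expr_prod smooth_expr_power smooth_expr.const h_sm)
    show "0 \<le> \<kappa> n x" "\<kappa> n x \<le> 1" for n x using pr[of x n] by (auto simp: \<kappa>_def)
    have comp: "compact (\<Union>i<n. cball (c i) (r i))" for n by (intro compact_UN) auto
    show "compact (closure {x. \<kappa> n x \<noteq> 0})" for n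
      using compact_Int_closed[OF comp closed_closure[of "{x. \<kappa> n x \<noteq> 0}"], of n] supp[of n]
      by (simp add: Int_absorb1)
    show "closure {x. \<kappa> n x \<noteq> 0} \<subseteq> \<Omega>" for n
      using supp cr(3) by blast
    show "(\<lambda>n. \<kappa> n x) \<longlonglongrightarrow> 1" if x: "x \<in> \<Omega>" for x
    proof -
      obtain B where B: "B \<in> F'" "x \<in> B" using x U by blast
      obtain i where "from_nat_into F' i = B" using from_nat_into_surj[OF F'(2) B(1)] by blast
      then have i: "x \<in> ball (c i) (r i)" using cr(1) B(2) by auto
      then have hi: "0 < h i x" using h_pos by simp
      have "(\<lambda>n. (1 - h i x) ^ n) \<longlonglongrightarrow> 0"
        by (rule LIMSEQ_power_zero) (use hi h_range[of i x] in auto)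
      moreover have "eventually (\<lambda>n. norm (\<Prod>i<n. (1 - h i x) ^ n) \<le> (1 - h i x) ^ n) sequentially"
        using eventually_gt_at_top[of i]
      proof eventually_elim
        case (elim n)
        have "(\<Prod>i<n. (1 - h i x) ^ n) = (1 - h i x) ^ n * (\<Prod>i\<in>{..<n}-{i}. (1 - h i x) ^ n)"
          using elim by (subst prod.remove[of _ i]) auto
        also have "\<dots> \<le> (1 - h i x) ^ n * 1"
          using h_range[of _ x] less_imp_le[OF h_range(2)[of _ x]]
          by (intro mult_left_mono prod_le_1) (auto intro!: power_le_one)
        finally show ?case using pr[of x n] by simp
      qed
      ultimately have "(\<lambda>n. \<Prod>i<n. (1 - h i x) ^ n) \<longlonglongrightarrow> 0"
        by (rule Lim_null_comparison[rotated])
      then show ?thesis unfolding \<kappa>_def using tendsto_diff[OF tendsto_const] by fastforce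
    qed
  qed
qed


section \<open>Square-integrable functions\<close>

lemma integrable_bounded_support:
  fixes f :: "'b::euclidean_space \<Rightarrow> real"
  assumes "f \<in> borel_measurable borel" "bounded S" "\<And>x. x \<in> S \<Longrightarrow> \<bar>f x\<bar> \<le> M" "\<And>x. x \<notin> S \<Longrightarrow> f x = 0"
  shows "integrable lborel f"
proof -
  obtain R where R: "S \<subseteq> cball 0 R" using assms(2) unfolding bounded_iff by (auto simp: subset_iff)
  show ?thesis
  proof (rule integrableI_bounded_set[of "cball 0 R"])
    have "norm (f x) \<le> max M 0" for x
      using assms(3,4)[of x] by (cases "x \<in> S") auto
    then show "AE x in lborel. x \<in> cball 0 R \<longrightarrow> norm (f x) \<le> max M 0" by simp
    show "emeasure lborel (cball (0::'b) R) < \<infinity>"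
      by (rule emeasure_bounded_finite) simp
    show "AE x in lborel. x \<notin> cball 0 R \<longrightarrow> f x = 0"
      using R assms(4) by (intro AE_I2 impI) blast
    show "f \<in> borel_measurable lborel" using assms(1) by simp
    show "cball 0 R \<in> sets lborel" by simp
  qed
qed

lemma integrable_mult_L2:
  fixes f g :: "'b \<Rightarrow> real"
  assumes [measurable]: "f \<in> borel_measurable M" "g \<in> borel_measurable M"
    and "integrable M (\<lambda>x. (f x)\<^sup>2)" "integrable M (\<lambda>x. (g x)\<^sup>2)"
  shows "integrable M (\<lambda>x. f x * g x)"
proof (rule Bochner_Integration.integrable_bound)
  show "integrable M (\<lambda>x. (f x)\<^sup>2 + (g x)\<^sup>2)" using assms by simp
  show "AE x in M. norm (f x * g x) \<le> norm ((f x)\<^sup>2 + (g x)\<^sup>2)"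
  proof (rule AE_I2)
    fix x
    have "0 \<le> (\<bar>f x\<bar> - \<bar>g x\<bar>)\<^sup>2" "0 \<le> \<bar>f x * g x\<bar>" by auto
    then have "2 * \<bar>f x * g x\<bar> \<le> (f x)\<^sup>2 + (g x)\<^sup>2" "0 \<le> \<bar>f x * g x\<bar>"
      by (auto simp: power2_diff abs_mult)
    then show "norm (f x * g x) \<le> norm ((f x)\<^sup>2 + (g x)\<^sup>2)"
      unfolding real_norm_def by linarith
  qed
qed simp

lemma Cauchy_Schwarz_integral:
  fixes f g :: "'b \<Rightarrow> real"
  assumes [measurable]: "f \<in> borel_measurable M" "g \<in> borel_measurable M"
    and f: "integrable M (\<lambda>x. (f x)\<^sup>2)" and g: "integrable M (\<lambda>x. (g x)\<^sup>2)"
  shows "(\<integral>x. f x * g x \<partial>M)\<^sup>2 \<le> (\<integral>x. (f x)\<^sup>2 \<partial>M) * (\<integral>x. (g x)\<^sup>2 \<partial>M)"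
proof -
  define A B C where "A = (\<integral>x. (f x)\<^sup>2 \<partial>M)" and "B = (\<integral>x. f x * g x \<partial>M)"
    and "C = (\<integral>x. (g x)\<^sup>2 \<partial>M)"
  have fg: "integrable M (\<lambda>x. f x * g x)" by (rule integrable_mult_L2) (use f g in auto)
  have q: "0 \<le> A + 2 * t * B + t\<^sup>2 * C" for t
  proof -
    have "0 \<le> (\<integral>x. (f x + t * g x)\<^sup>2 \<partial>M)" by simp
    also have "(\<lambda>x. (f x + t * g x)\<^sup>2) = (\<lambda>x. (f x)\<^sup>2 + (2 * t) * (f x * g x) + t\<^sup>2 * (g x)\<^sup>2)"
      by (auto simp: power2_eq_square algebra_simps)
    also have "(\<integral>x. (f x)\<^sup>2 + (2 * t) * (f x * g x) + t\<^sup>2 * (g x)\<^sup>2 \<partial>M) = A + 2 * t * B + t\<^sup>2 * C"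
      using f g fg by (simp add: A_def B_def C_def)
    finally show ?thesis .
  qed
  have "C \<ge> 0" "A \<ge> 0" by (auto simp: C_def A_def)
  show ?thesis
  proof (cases "C = 0")
    case True
    have "B = 0"
    proof (rule ccontr)
      assume "B \<noteq> 0"
      \<comment> \<open>With C = 0 the quadratic degenerates to A + 2tB, which takes the value -1 at
        this t.\<close>
      then show False using q[of "- (A + 1) / (2 * B)"] True by (simp add: field_simps)
    qed
    then show ?thesis using True by (simp add: A_def B_def C_def)
  next
    case False
    then have "C > 0" using \<open>C \<ge> 0\<close> by simp
    then have "A + 2 * (- B / C) * B + (- B / C)\<^sup>2 * C = A - B\<^sup>2 / C"
      by (simp add: field_simps power2_eq_square)
    then have "B\<^sup>2 / C \<le> A" using q[of "- B / C"] by simp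
    then show ?thesis using \<open>C > 0\<close> by (simp add: A_def B_def C_def field_simps)
  qed
qed

lemma Cauchy_Schwarz_integral_sqrt:
  fixes f g :: "'b \<Rightarrow> real"
  assumes "f \<in> borel_measurable M" "g \<in> borel_measurable M"
    and "integrable M (\<lambda>x. (f x)\<^sup>2)" and "integrable M (\<lambda>x. (g x)\<^sup>2)"
  shows "\<bar>\<integral>x. f x * g x \<partial>M\<bar> \<le> sqrt (\<integral>x. (f x)\<^sup>2 \<partial>M) * sqrt (\<integral>x. (g x)\<^sup>2 \<partial>M)"
  using real_sqrt_le_mono[OF Cauchy_Schwarz_integral[OF assms]] by (simp add: real_sqrt_mult)

section \<open>Uniform boundedness in L^2\<close>

fun sign_choice :: "(nat \<Rightarrow> nat \<Rightarrow> real) \<Rightarrow> nat \<Rightarrow> real" where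
  "sign_choice a k = (if (\<Sum>j<k. sign_choice a j * a k j) \<ge> 0 then 1 else - 1)"

declare sign_choice.simps [simp del]

lemma abs_sign_choice: "\<bar>sign_choice a k\<bar> = 1"
  by (subst sign_choice.simps) simp

text \<open>The chosen sign agrees with that of the partial sum X, so the new term adds to its
  modulus: |X + s a_kk| = |X| + a_kk.\<close>

lemma sign_choice_ge:
  assumes "a k k \<ge> 0"
  shows "a k k \<le> \<bar>\<Sum>j<Suc k. sign_choice a j * a k j\<bar>"
proof -
  define X where "X = (\<Sum>j<k. sign_choice a j * a k j)"
  have "sign_choice a k = (if X \<ge> 0 then 1 else - 1)"
    unfolding X_def by (rule sign_choice.simps)
  then show ?thesis using assms by (auto simp: X_def[symmetric])
qed

lemma AE_summable_if_summable_integral: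
  fixes f :: "nat \<Rightarrow> 'b \<Rightarrow> real"
  assumes [measurable]: "\<And>i. integrable M (f i)" and nn: "\<And>i x. 0 \<le> f i x"
    and s: "summable (\<lambda>i. \<integral>x. f i x \<partial>M)"
  shows "AE x in M. summable (\<lambda>i. f i x)"
proof -
  have "(\<integral>\<^sup>+x. (\<Sum>i. ennreal (f i x)) \<partial>M) = (\<Sum>i. \<integral>\<^sup>+x. ennreal (f i x) \<partial>M)"
    by (intro nn_integral_suminf) measurable
  also have "\<dots> = (\<Sum>i. ennreal (\<integral>x. f i x \<partial>M))"
    by (intro suminf_cong nn_integral_eq_integral assms AE_I2)
  also have "\<dots> = ennreal (\<Sum>i. \<integral>x. f i x \<partial>M)"
    by (intro suminf_ennreal_eq summable_sums s) (simp add: nn)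
  finally have "(\<integral>\<^sup>+x. (\<Sum>i. ennreal (f i x)) \<partial>M) \<noteq> \<infinity>" by simp
  then have "AE x in M. (\<Sum>i. ennreal (f i x)) \<noteq> \<infinity>"
    by (intro nn_integral_PInf_AE) measurable
  then show ?thesis
    by eventually_elim (auto intro: summable_suminf_not_top nn)
qed

text \<open>A gliding hump: if the norms are unbounded, then
  along a subsequence with norms at least \<open>4\<^sup>k\<close> the normalised functions, weighted by
  \<open>\<plusminus> 3\<^sup>-\<^sup>k\<close> with greedily chosen signs, sum up to a test function with unbounded pairings.\<close>

lemma L2_bounded_if_weakly_bounded:
  fixes f :: "nat \<Rightarrow> 'b \<Rightarrow> real"
  assumes fm [measurable]: "\<And>n. f n \<in> borel_measurable M"
    and fi: "\<And>n. integrable M (\<lambda>x. (f n x)\<^sup>2)"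
    and wb: "\<And>g. g \<in> borel_measurable M \<Longrightarrow> integrable M (\<lambda>x. (g x)\<^sup>2) \<Longrightarrow>
               bounded (range (\<lambda>n. \<integral>x. f n x * g x \<partial>M))"
  obtains C where "\<And>n. (\<integral>x. (f n x)\<^sup>2 \<partial>M) \<le> C"
proof (rule ccontr)
  assume "\<not> thesis"
  then have "\<forall>k. \<exists>n. (\<integral>x. (f n x)\<^sup>2 \<partial>M) > 16 ^ k"
    using that by (meson not_le)
  then obtain N where N: "\<And>k. (\<integral>x. (f (N k) x)\<^sup>2 \<partial>M) > 16 ^ (k::nat)" by metis
  define r where "r k = sqrt (\<integral>x. (f (N k) x)\<^sup>2 \<partial>M)" for k
  have r: "r k > 4 ^ k" for k
  proof -
    have "sqrt (16 ^ k) = (4::real) ^ k"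
      by (rule real_sqrt_unique) (auto simp: power2_eq_square simp flip: power_mult_distrib)
    then show ?thesis using real_sqrt_less_mono[OF N[of k]] by (simp add: r_def)
  qed
  have r0: "r k > 0" for k using r[of k] by (meson less_trans zero_less_numeral zero_less_power)
  have r2: "(\<integral>x. (f (N k) x)\<^sup>2 \<partial>M) = (r k)\<^sup>2" for k by (simp add: r_def)
  define u where "u k x = f (N k) x / r k" for k x
  have um [measurable]: "u k \<in> borel_measurable M" for k unfolding u_def by measurable
  have ui: "integrable M (\<lambda>x. (u k x)\<^sup>2)" for k by (simp add: u_def power_divide fi)
  have u1: "(\<integral>x. (u k x)\<^sup>2 \<partial>M) = 1" for k
    using r0[of k] by (simp add: u_def power_divide r2)
  \<comment> \<open>Signs apart, this is what the j-th term of the test function contributes to the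
    pairing with \<open>f (N k)\<close>; the greedy signs make the terms j <= k together at least as
    large as the diagonal entry.\<close>
  define a where "a k j = (1/3) ^ j * (\<integral>x. f (N k) x * u j x \<partial>M)" for k j
  define s where "s = sign_choice a"
  have s1: "\<bar>s j\<bar> = 1" for j by (simp add: s_def abs_sign_choice)
  \<comment> \<open>The integrals 3^{-j} of the majorants are summable, so \<open>W\<close> is
    finite almost everywhere. This yields both pointwise convergence of the test series and a bound
    on its square, with no appeal to completeness of L^2.\<close>
  define w where "w j x = (1/3) ^ j * (u j x)\<^sup>2" for j x
  have wi: "integrable M (w j)" for j unfolding w_def using ui by simp
  have wint: "(\<integral>x. w j x \<partial>M) = (1/3) ^ j" for j by (simp add: w_def u1)
  have wn: "0 \<le> w j x" for j x by (simp add: w_def)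
  have AEw: "AE x in M. summable (\<lambda>j. w j x)"
    by (rule AE_summable_if_summable_integral) (auto simp: wi wn wint intro: summable_geometric)
  define W where "W x = (\<Sum>j. w j x)" for x
  have Wi: "integrable M W"
    unfolding W_def using AEw wn
    by (intro integrable_suminf) (auto simp: wi wint intro: summable_geometric)
  define h where "h j x = s j * (1/3) ^ j * u j x" for j x
  have hm [measurable]: "h j \<in> borel_measurable M" for j unfolding h_def by measurable
  have hs: "summable (\<lambda>j. \<bar>h j x\<bar>)" if "summable (\<lambda>j. w j x)" for x
  proof (rule summable_comparison_test')
    show "summable (\<lambda>j. (1/3) ^ j + w j x)"
      using that by (intro summable_add summable_geometric) auto
    fix j :: nat
    have "0 \<le> (\<bar>u j x\<bar> - 1)\<^sup>2" by simp
    then have "\<bar>u j x\<bar> \<le> 1 + (u j x)\<^sup>2" by (simp add: power2_diff)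
    then have "(1/3) ^ j * \<bar>u j x\<bar> \<le> (1/3) ^ j * (1 + (u j x)\<^sup>2)"
      by (intro mult_left_mono) auto
    then show "norm \<bar>h j x\<bar> \<le> (1/3) ^ j + w j x"
      by (simp add: h_def w_def abs_mult s1 algebra_simps)
  qed
  note hs' = summable_rabs_cancel[OF hs]
  define g where "g x = (\<Sum>j. h j x)" for x
  have gm [measurable]: "g \<in> borel_measurable M" unfolding g_def by measurable
  \<comment> \<open>Each weight 3^{-j} is split into two square roots before Cauchy-Schwarz; 3/2 is
    the sum of the geometric series.\<close>
  have g2: "(g x)\<^sup>2 \<le> 3/2 * W x" if sw: "summable (\<lambda>j. w j x)" for x
  proof -
    have *: "(\<Sum>j<n. h j x)\<^sup>2 \<le> 3/2 * W x" for n
    proof -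
      have "(\<Sum>j<n. h j x) = (\<Sum>j<n. sqrt ((1/3) ^ j) * (s j * sqrt ((1/3) ^ j) * u j x))"
        by (intro sum.cong) (auto simp: h_def)
      also have "\<dots>\<^sup>2 \<le> (\<Sum>j<n. (sqrt ((1/3) ^ j))\<^sup>2) * (\<Sum>j<n. (s j * sqrt ((1/3) ^ j) * u j x)\<^sup>2)"
        by (rule Cauchy_Schwarz_ineq_sum)
      also have "\<dots> = (\<Sum>j<n. (1/3) ^ j) * (\<Sum>j<n. w j x)"
      proof -
        have "(s j)\<^sup>2 = 1" for j using s1[of j] by (simp add: abs_if power2_eq_square split: if_splits)
        then show ?thesis by (simp add: w_def power_mult_distrib)
      qed
      also have "\<dots> \<le> 3/2 * W x"
      proof (rule mult_mono)
        show "(\<Sum>j<n. (1/3) ^ j) \<le> (3/2::real)"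
          using sum_le_suminf[of "\<lambda>j. (1/3::real) ^ j" "{..<n}"] suminf_geometric[of "1/3::real"]
          by (simp add: summable_geometric)
        show "(\<Sum>j<n. w j x) \<le> W x"
          unfolding W_def by (rule sum_le_suminf) (use sw wn in auto)
      qed (auto simp: wn sum_nonneg)
      finally show ?thesis .
    qed
    have "(\<lambda>n. \<Sum>j<n. h j x) \<longlonglongrightarrow> g x"
      unfolding g_def by (rule summable_LIMSEQ[OF hs'[OF sw]])
    then have "(\<lambda>n. (\<Sum>j<n. h j x)\<^sup>2) \<longlonglongrightarrow> (g x)\<^sup>2" by (intro tendsto_intros)
    then show ?thesis by (rule LIMSEQ_le_const2) (use * in auto)
  qed
  have gi: "integrable M (\<lambda>x. (g x)\<^sup>2)"
  proof (rule Bochner_Integration.integrable_bound[of _ "\<lambda>x. 3/2 * W x"])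
    show "AE x in M. norm ((g x)\<^sup>2) \<le> norm (3/2 * W x)"
      using AEw
    proof eventually_elim
      case (elim x)
      have "norm ((g x)\<^sup>2) = (g x)\<^sup>2" by simp
      then show ?case using g2[OF elim] unfolding real_norm_def by linarith
    qed
  qed (use Wi in auto)
  have le: "\<bar>\<integral>x. \<bar>f (N k) x\<bar> * \<bar>u j x\<bar> \<partial>M\<bar> \<le> r k" for k j
    using Cauchy_Schwarz_integral_sqrt[of "\<lambda>x. \<bar>f (N k) x\<bar>" M "\<lambda>x. \<bar>u j x\<bar>"] fi ui r0[of k]
    by (simp add: r2 u1)
  have a_le: "\<bar>a k j\<bar> \<le> (1/3) ^ j * r k" for k j
    using Cauchy_Schwarz_integral_sqrt[of "\<lambda>x. f (N k) x" M "\<lambda>x. u j x"] fi ui r0[of k]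
    by (simp add: r2 u1 a_def abs_mult)
  have a_kk: "a k k = (1/3) ^ k * r k" for k
  proof -
    have "(\<lambda>x. f (N k) x * u k x) = (\<lambda>x. (f (N k) x)\<^sup>2 / r k)"
      by (auto simp: u_def power2_eq_square)
    then have "(\<integral>x. f (N k) x * u k x \<partial>M) = (r k)\<^sup>2 / r k" by (simp add: r2)
    also have "\<dots> = r k" by (simp add: power2_eq_square)
    finally show ?thesis by (simp add: a_def)
  qed
  have fui: "integrable M (\<lambda>x. f (N k) x * u j x)" for k j
    by (rule integrable_mult_L2) (auto simp: fi ui)
  have series: "(\<integral>x. f (N k) x * g x \<partial>M) = (\<Sum>j. s j * a k j)" for k
  proof -
    have eq: "f (N k) x * h j x = (s j * (1/3) ^ j) * (f (N k) x * u j x)" for j x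
      by (simp add: h_def)
    have "(\<integral>x. f (N k) x * g x \<partial>M) = (\<integral>x. (\<Sum>j. f (N k) x * h j x) \<partial>M)"
    proof (rule integral_cong_AE)
      show "AE x in M. f (N k) x * g x = (\<Sum>j. f (N k) x * h j x)"
        using AEw
      proof eventually_elim
        case (elim x)
        show ?case unfolding g_def
          by (rule suminf_mult[OF hs'[OF elim], symmetric])
      qed
    qed measurable
    also have "\<dots> = (\<Sum>j. \<integral>x. f (N k) x * h j x \<partial>M)"
    proof (rule integral_suminf)
      show "integrable M (\<lambda>x. f (N k) x * h j x)" for j
        unfolding eq using fui by simp
      show "AE x in M. summable (\<lambda>j. norm (f (N k) x * h j x))"
        using AEw
      proof eventually_elim
        case (elim x)
        show ?case unfolding real_norm_def abs_mult by (intro summable_mult hs elim)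
      qed
      show "summable (\<lambda>j. \<integral>x. norm (f (N k) x * h j x) \<partial>M)"
      proof (rule summable_comparison_test')
        show "summable (\<lambda>j. (1/3) ^ j * r k)"
          by (intro summable_mult2 summable_geometric) auto
        show "norm (\<integral>x. norm (f (N k) x * h j x) \<partial>M) \<le> (1/3) ^ j * r k" for j
          using le[of k j] s1[of j] by (simp add: eq abs_mult)
      qed
    qed
    also have "\<dots> = (\<Sum>j. s j * a k j)"
      unfolding eq by (simp add: a_def mult.assoc)
    finally show ?thesis .
  qed
  \<comment> \<open>Terms up to k contribute at least the diagonal r_k 3^{-k}, those beyond k at
    most half of it, by the tail of the geometric series. The remaining half is at least (4/3)^k / 2
    because r_k > 4^k.\<close>
  have big: "\<bar>\<integral>x. f (N k) x * g x \<partial>M\<bar> \<ge> (4/3) ^ k / 2" for k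
  proof -
    have le1: "\<bar>s j * a k j\<bar> \<le> r k * (1/3) ^ j" for j
      using a_le[of k j] by (simp add: abs_mult s1 mult.commute)
    have sm: "summable (\<lambda>j. s j * a k j)"
      by (rule summable_comparison_test'[where g = "\<lambda>j. r k * (1/3) ^ j" and N = 0])
         (use le1 in \<open>auto intro!: summable_mult summable_geometric\<close>)
    have "(\<Sum>j. s j * a k j) = (\<Sum>n. s (n + Suc k) * a k (n + Suc k)) + (\<Sum>j<Suc k. s j * a k j)"
      by (rule suminf_split_initial_segment[OF sm])
    moreover have "\<bar>\<Sum>n. s (n + Suc k) * a k (n + Suc k)\<bar> \<le> (\<Sum>n. (r k * (1/3) ^ Suc k) * (1/3) ^ n)"
    proof -
      have "norm (s (n + Suc k) * a k (n + Suc k)) \<le> (r k * (1/3) ^ Suc k) * (1/3) ^ n" for n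
        using le1[of "n + Suc k"] by (simp add: power_add ac_simps)
      then show ?thesis
        using norm_suminf_le[of "\<lambda>n. s (n + Suc k) * a k (n + Suc k)" "\<lambda>n. (r k * (1/3) ^ Suc k) * (1/3) ^ n"]
        by (simp add: summable_geometric)
    qed
    moreover have "(\<Sum>n. (r k * (1/3) ^ Suc k) * (1/3::real) ^ n) = r k * (1/3) ^ k / 2"
      by (subst suminf_mult) (auto simp: suminf_geometric summable_geometric)
    moreover have "\<bar>\<Sum>j<Suc k. s j * a k j\<bar> \<ge> r k * (1/3) ^ k"
      using sign_choice_ge[of a k] a_kk[of k] r0[of k] by (simp add: s_def mult.commute)
    ultimately have "\<bar>\<integral>x. f (N k) x * g x \<partial>M\<bar> \<ge> r k * (1/3) ^ k / 2"
      unfolding series by linarith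
    moreover have "(4/3) ^ k \<le> r k * (1/3) ^ k"
      using r[of k] by (simp add: power_divide divide_right_mono less_imp_le)
    ultimately show ?thesis by linarith
  qed
  obtain B where B: "\<And>n. \<bar>\<integral>x. f n x * g x \<partial>M\<bar> \<le> B"
    using wb[OF gm gi] unfolding bounded_iff by auto
  obtain k where "(4/3::real) ^ k > 2 * B" using real_arch_pow[of "4/3" "2 * B"] by auto
  then show False using big[of k] B[of "N k"] by linarith
qed

section \<open>Strong compactness in time from bounded variation\<close>

text \<open>\<open>g\<close> stays within \<open>w\<close> of its mean over the interval, so |g| <=
  |mean| + w pointwise. Squaring with (x+y)^2 <= 2x^2 + 2y^2 and integrating over the length b - a
  leaves one factor 1/(b - a) on the squared integral.\<close>

lemma interval_L2_bound_oscillation: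
  fixes g :: "real \<Rightarrow> real"
  assumes [measurable]: "g \<in> borel_measurable borel" and "a < b"
    and osc: "\<And>s t. s \<in> {a..b} \<Longrightarrow> t \<in> {a..b} \<Longrightarrow> \<bar>g t - g s\<bar> \<le> w"
  shows "(LBINT t. indicator {a..b} t * (g t)\<^sup>2)
     \<le> 2 * (LBINT t. indicator {a..b} t * g t)\<^sup>2 / (b - a) + 2 * (b - a) * w\<^sup>2"
proof -
  define I where "I = (LBINT t. indicator {a..b} t * g t)"
  have bd: "\<bar>g t\<bar> \<le> \<bar>g a\<bar> + w" if "t \<in> {a..b}" for t
    using osc[of a t] that assms(2) by auto
  have gi: "integrable lborel (\<lambda>t. indicator {a..b} t * g t)"
    by (rule integrable_bounded_support[of _ "{a..b}" "\<bar>g a\<bar> + w"]) (use bd in auto)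
  have w0: "0 \<le> w" using osc[of a a] assms(2) by auto
  have ci: "integrable lborel (\<lambda>t. indicator {a..b} t * c)" for c :: real
    by (rule integrable_bounded_support[of _ "{a..b}" "\<bar>c\<bar>"]) auto
  have cint: "(LBINT t. indicator {a..b} t * c) = (b - a) * c" for c :: real
    using assms(2) by simp
  have pt: "(g t)\<^sup>2 \<le> 2 * I\<^sup>2 / (b - a)\<^sup>2 + 2 * w\<^sup>2" if t: "t \<in> {a..b}" for t
  proof -
    have "(b - a) * g t - I = (LBINT s. indicator {a..b} s * g t - indicator {a..b} s * g s)"
      unfolding I_def by (simp only: Bochner_Integration.integral_diff[OF ci gi] cint)
    also have "\<bar>\<dots>\<bar> \<le> (LBINT s. indicator {a..b} s * w)"
      by (intro integral_abs_bound_integral Bochner_Integration.integrable_diff ci gi)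
         (use osc t in \<open>auto simp: indicator_def\<close>)
    also have "\<dots> = (b - a) * w" by (rule cint)
    finally have "\<bar>(b - a) * g t\<bar> \<le> \<bar>I\<bar> + (b - a) * w" by linarith
    then have "(b - a) * \<bar>g t\<bar> \<le> \<bar>I\<bar> + (b - a) * w"
      using assms(2) by (simp add: abs_mult)
    then have "\<bar>g t\<bar> \<le> \<bar>I\<bar> / (b - a) + w" using assms(2) by (simp add: field_simps)
    then have "(g t)\<^sup>2 \<le> (\<bar>I\<bar> / (b - a) + w)\<^sup>2"
      by (metis abs_ge_zero power2_abs power_mono)
    also have "\<dots> \<le> 2 * (\<bar>I\<bar> / (b - a))\<^sup>2 + 2 * w\<^sup>2"
      using zero_le_power2[of "\<bar>I\<bar> / (b - a) - w"] by (simp add: power2_diff power2_sum)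
    finally show ?thesis by (simp add: power_divide)
  qed
  have "(LBINT t. indicator {a..b} t * (g t)\<^sup>2)
      \<le> (LBINT t. indicator {a..b} t * (2 * I\<^sup>2 / (b - a)\<^sup>2 + 2 * w\<^sup>2))"
  proof (rule integral_mono[OF _ ci])
    show "integrable lborel (\<lambda>t. indicator {a..b} t * (g t)\<^sup>2)"
      by (rule integrable_bounded_support[of _ "{a..b}" "2 * I\<^sup>2 / (b - a)\<^sup>2 + 2 * w\<^sup>2"]) (use pt in auto)
  qed (use pt in \<open>auto simp: indicator_def\<close>)
  also have "\<dots> = 2 * I\<^sup>2 / (b - a) + 2 * (b - a) * w\<^sup>2"
  proof -
    have "d * (2 * I\<^sup>2 / d\<^sup>2 + 2 * w\<^sup>2) = 2 * I\<^sup>2 / d + 2 * d * w\<^sup>2" if "d \<noteq> 0" for d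
      using that by (simp add: field_simps power2_eq_square)
    then show ?thesis unfolding cint using assms(2) by simp
  qed
  finally show ?thesis unfolding I_def .
qed

lemma sum_telescope_grid:
  fixes \<mu> :: "real \<Rightarrow> real"
  shows "(\<Sum>k<K. \<mu> (real (Suc k) * h) - \<mu> (real k * h)) = \<mu> (real K * h) - \<mu> 0"
  using sum_lessThan_telescope[of "\<lambda>k. \<mu> (real k * h)" K] by simp

text \<open>A quantitative Helly argument for the whole sequence, without extracting subsequences.
  \<open>\<mu> n\<close> is a monotone majorant of the variation. On a grid of mesh h the difference
  of two members is controlled cell by cell: its mean is small by convergence of finitely many
  integrals, its oscillation is at most an increment \<open>w k\<close>, and the sum of the squares
  of the \<open>w k\<close> is at most the square of their sum, hence at most (2V)^2. The
  oscillation part is therefore O(h), whatever n and n' are.\<close>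

lemma bounded_variation_L2_Cauchy:
  fixes f \<mu> :: "nat \<Rightarrow> real \<Rightarrow> real"
  assumes fm [measurable]: "\<And>n. f n \<in> borel_measurable borel" and T: "T > 0"
    and var: "\<And>n s t. 0 \<le> s \<Longrightarrow> s \<le> t \<Longrightarrow> t \<le> T \<Longrightarrow> \<bar>f n t - f n s\<bar> \<le> \<mu> n t - \<mu> n s"
    and V: "\<And>n. \<mu> n T - \<mu> n 0 \<le> V"
    and conv: "\<And>a b. 0 \<le> a \<Longrightarrow> a \<le> b \<Longrightarrow> b \<le> T \<Longrightarrow>
                 convergent (\<lambda>n. LBINT t. indicator {a..b} t * f n t)"
    and e: "e > 0"
  shows "\<exists>n0. \<forall>n\<ge>n0. \<forall>n'\<ge>n0. (LBINT t. indicator {0..T} t * (f n t - f n' t)\<^sup>2) \<le> e"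
proof -
  have mono: "\<mu> n s \<le> \<mu> n t" if "0 \<le> s" "s \<le> t" "t \<le> T" for n s t
    using var[OF that, of n] by linarith
  have V0: "0 \<le> V" using mono[of 0 T 0] V[of 0] T by linarith
  \<comment> \<open>With h = T / K this makes the oscillation part 2 h (2V)^2 = 8 T V^2 / K at most
    e / 2.\<close>
  obtain K :: nat where K: "real K > 16 * T * V\<^sup>2 / e" using reals_Archimedean2 by blast
  have "0 \<le> 16 * T * V\<^sup>2 / e" using T e by simp
  then have K0: "K > 0" using K by (cases K) auto
  define h where "h = T / real K"
  have h: "h > 0" "real K * h = T" using T K0 by (auto simp: h_def)
  have hV: "2 * h * (2 * V)\<^sup>2 \<le> e / 2"
    using K K0 T e unfolding h_def by (simp add: field_simps power2_eq_square)
  define J where "J k = {real k * h..real (Suc k) * h}" for k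
  have Jle: "real (Suc k) * h \<le> T" if "k < K" for k
    using that h by (metis Suc_leI mult_right_mono of_nat_le_iff less_imp_le)
  have Jsub: "0 \<le> real k * h" "real k * h \<le> real (Suc k) * h" for k
    using h by (auto simp: mult_right_mono)
  define I where "I k n = (LBINT t. indicator (J k) t * f n t)" for k n
  \<comment> \<open>Chosen so that the K cells contribute K (2 \<eta>^2 / h) = e / 2 in
    total.\<close>
  define \<eta> where "\<eta> = sqrt (e * h / (4 * real K))"
  have \<eta>: "\<eta> > 0" "\<eta>\<^sup>2 = e * h / (4 * real K)"
    using e h K0 by (auto simp: \<eta>_def)
  have "\<exists>n0. \<forall>k<K. \<forall>n\<ge>n0. \<forall>n'\<ge>n0. \<bar>I k n - I k n'\<bar> < \<eta>"
  proof -
    have "\<exists>n0. \<forall>n\<ge>n0. \<forall>n'\<ge>n0. \<bar>I k n - I k n'\<bar> < \<eta>" if "k < K" for k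
    proof -
      have "Cauchy (I k)"
        unfolding I_def J_def
        by (intro convergent_Cauchy conv Jsub Jle that)
      then show ?thesis using \<eta>(1) unfolding Cauchy_def dist_real_def by blast
    qed
    then obtain N where N: "\<And>k n n'. k < K \<Longrightarrow> n \<ge> N k \<Longrightarrow> n' \<ge> N k \<Longrightarrow> \<bar>I k n - I k n'\<bar> < \<eta>"
      by metis
    have "N k \<le> Max (N ` {..<K})" if "k < K" for k using that by (intro Max_ge) auto
    then show ?thesis using N by (intro exI[of _ "Max (N ` {..<K})"]) (meson order_trans)
  qed
  then obtain n0 where n0: "\<And>k n n'. k < K \<Longrightarrow> n \<ge> n0 \<Longrightarrow> n' \<ge> n0 \<Longrightarrow> \<bar>I k n - I k n'\<bar> < \<eta>"
    by blast
  show ?thesis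
  proof (intro exI[of _ n0] allI impI)
    fix n n' assume n: "n0 \<le> n" "n0 \<le> n'"
    define g where "g t = f n t - f n' t" for t
    have gm [measurable]: "g \<in> borel_measurable borel" unfolding g_def by measurable
    \<comment> \<open>Increments of both majorants: the difference of the two functions oscillates
      by at most their sum.\<close>
    define w where "w k = (\<mu> n (real (Suc k) * h) - \<mu> n (real k * h)) + (\<mu> n' (real (Suc k) * h) - \<mu> n' (real k * h))" for k
    have fb: "\<bar>f n t\<bar> \<le> \<bar>f n 0\<bar> + V" if "0 \<le> t" "t \<le> T" for n t
      using var[of 0 t n] V[of n] mono[of t T n] that by linarith
    have fi: "integrable lborel (\<lambda>t. indicator (J k) t * f n t)" if "k < K" for k n
    proof (rule integrable_bounded_support[of _ "J k" "\<bar>f n 0\<bar> + V"])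
      show "\<bar>indicator (J k) t * f n t\<bar> \<le> \<bar>f n 0\<bar> + V" if "t \<in> J k" for t
        using fb[of t n] that Jle[OF \<open>k < K\<close>] Jsub[of k] unfolding J_def by auto
    qed (auto simp: J_def)
    have gi: "integrable lborel (\<lambda>t. indicator (J k) t * (g t)\<^sup>2)" if "k < K" for k
    proof (rule integrable_bounded_support[of _ "J k" "(\<bar>f n 0\<bar> + V + (\<bar>f n' 0\<bar> + V))\<^sup>2"])
      show "\<bar>indicator (J k) t * (g t)\<^sup>2\<bar> \<le> (\<bar>f n 0\<bar> + V + (\<bar>f n' 0\<bar> + V))\<^sup>2" if "t \<in> J k" for t
      proof -
        have t: "0 \<le> t" "t \<le> T" using that Jle[OF \<open>k < K\<close>] Jsub[of k] unfolding J_def by auto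
        then have "\<bar>g t\<bar> \<le> \<bar>\<bar>f n 0\<bar> + V + (\<bar>f n' 0\<bar> + V)\<bar>"
          using fb[OF t, of n] fb[OF t, of n'] unfolding g_def by linarith
        then show ?thesis using that by (simp add: abs_le_square_iff)
      qed
    qed (auto simp: J_def)
    have one: "(LBINT t. indicator (J k) t * (g t)\<^sup>2) \<le> 2 * \<eta>\<^sup>2 / h + 2 * h * (w k)\<^sup>2"
      if "k < K" for k
    proof -
      have eqh: "real (Suc k) * h - real k * h = h" by (simp add: algebra_simps)
      have "(LBINT t. indicator (J k) t * (g t)\<^sup>2)
          \<le> 2 * (LBINT t. indicator (J k) t * g t)\<^sup>2 / h + 2 * h * (w k)\<^sup>2"
        unfolding J_def
      proof (rule interval_L2_bound_oscillation[of g "real k * h" "real (Suc k) * h" "w k", unfolded eqh])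
        show "real k * h < real (Suc k) * h" using h by (intro mult_strict_right_mono) auto
        have *: "\<bar>g t - g s\<bar> \<le> w k"
          if "s \<in> {real k * h..real (Suc k) * h}" "t \<in> {real k * h..real (Suc k) * h}" "s \<le> t" for s t
        proof -
          have "0 \<le> s" "t \<le> T" using that Jle[OF \<open>k < K\<close>] Jsub[of k] by auto
          then show ?thesis
            using var[of s t n] var[of s t n'] that mono[of "real k * h" s n] mono[of t "real (Suc k) * h" n]
              mono[of "real k * h" s n'] mono[of t "real (Suc k) * h" n'] Jle[OF \<open>k < K\<close>] Jsub[of k]
            unfolding g_def w_def atLeastAtMost_iff by linarith
        qed
        show "\<bar>g t - g s\<bar> \<le> w k"
          if "s \<in> {real k * h..real (Suc k) * h}" "t \<in> {real k * h..real (Suc k) * h}" for s t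
          using *[of s t] *[of t s] that by (cases "s \<le> t") (auto simp: abs_minus_commute)
      qed simp
      also have "(LBINT t. indicator (J k) t * g t) = I k n - I k n'"
        unfolding g_def I_def right_diff_distrib
        by (rule Bochner_Integration.integral_diff[OF fi[OF that] fi[OF that]])
      also have "(I k n - I k n')\<^sup>2 \<le> \<eta>\<^sup>2"
        using n0[OF that n] by (simp add: abs_le_square_iff[symmetric] \<eta>(1) less_imp_le)
      finally show ?thesis using h(1) by (simp add: divide_right_mono)
    qed
    have w0: "0 \<le> w k" if "k < K" for k
      unfolding w_def using mono[OF Jsub Jle[OF that]] by (simp add: add_nonneg_nonneg)
    have "(\<Sum>k<K. w k) \<le> 2 * V"
      unfolding w_def sum.distrib sum_telescope_grid h(2) using V[of n] V[of n'] by linarith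
    moreover have "(\<Sum>k<K. (w k)\<^sup>2) \<le> (\<Sum>k<K. w k)\<^sup>2"
    proof -
      have "(\<Sum>k<K. (w k)\<^sup>2) \<le> (\<Sum>k<K. w k * (\<Sum>k<K. w k))"
        unfolding power2_eq_square
        by (intro sum_mono mult_left_mono member_le_sum) (auto simp: w0)
      then show ?thesis by (simp add: sum_distrib_right power2_eq_square)
    qed
    moreover have "0 \<le> (\<Sum>k<K. w k)" by (intro sum_nonneg) (simp add: w0)
    ultimately have w2: "(\<Sum>k<K. (w k)\<^sup>2) \<le> (2 * V)\<^sup>2"
      by (meson order_trans power_mono)
    have "(LBINT t. indicator {0..T} t * (g t)\<^sup>2) \<le> (LBINT t. (\<Sum>k<K. indicator (J k) t * (g t)\<^sup>2))"
    proof (rule integral_mono')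
      show "integrable lborel (\<lambda>t. \<Sum>k<K. indicator (J k) t * (g t)\<^sup>2)"
        by (intro Bochner_Integration.integrable_sum gi) simp
      fix t
      show "indicator {0..T} t * (g t)\<^sup>2 \<le> (\<Sum>k<K. indicator (J k) t * (g t)\<^sup>2)"
      proof (cases "t \<in> {0..T}")
        case True
        \<comment> \<open>The endpoint T is treated apart, since the floor of t / h would give the
          nonexistent cell K there.\<close>
        have "\<exists>k<K. t \<in> J k"
        proof (cases "t = T")
          case True
          then have "t \<in> J (K - 1)" using K0 h T by (auto simp: J_def of_nat_diff algebra_simps)
          then show ?thesis using K0 by (intro exI[of _ "K - 1"]) auto
        next
          case False
          define k where "k = nat \<lfloor>t / h\<rfloor>"
          have "0 \<le> t / h" using True h by auto
          then have k: "real k \<le> t / h" "t / h < real k + 1" unfolding k_def by linarith+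
          have "t / h < real K" using True False h by (simp add: field_simps)
          then have "k < K" using k by linarith
          moreover have "t \<in> J k" using k h by (simp add: J_def field_simps)
          ultimately show ?thesis by blast
        qed
        then obtain k where "k < K" "t \<in> J k" by blast
        then have "indicator {0..T} t * (g t)\<^sup>2 = indicator (J k) t * (g t)\<^sup>2" using True by simp
        also have "\<dots> \<le> (\<Sum>k<K. indicator (J k) t * (g t)\<^sup>2)"
          using \<open>k < K\<close> by (intro member_le_sum) auto
        finally show ?thesis .
      qed (simp add: sum_nonneg)
    qed (simp add: sum_nonneg)
    also have "\<dots> = (\<Sum>k<K. LBINT t. indicator (J k) t * (g t)\<^sup>2)"
      by (intro Bochner_Integration.integral_sum gi) simp
    also have "\<dots> \<le> (\<Sum>k<K. 2 * \<eta>\<^sup>2 / h + 2 * h * (w k)\<^sup>2)"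
      using one by (intro sum_mono) simp
    also have "\<dots> = real K * (2 * \<eta>\<^sup>2 / h) + 2 * h * (\<Sum>k<K. (w k)\<^sup>2)"
      by (simp add: sum.distrib sum_distrib_left)
    also have "real K * (2 * \<eta>\<^sup>2 / h) = e / 2" using K0 h by (simp add: \<eta>(2))
    also have "2 * h * (\<Sum>k<K. (w k)\<^sup>2) \<le> 2 * h * (2 * V)\<^sup>2"
      using w2 h by (intro mult_left_mono) auto
    also note hV
    finally show "(LBINT t. indicator {0..T} t * (f n t - f n' t)\<^sup>2) \<le> e"
      unfolding g_def by simp
  qed
qed


section \<open>Pairings with uniformly Cauchy first argument\<close>

lemma borel_measurable_fst_snd [measurable]:
  "(fst :: 'b::second_countable_topology \<times> 'c::second_countable_topology \<Rightarrow> 'b) \<in> borel_measurable borel"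
  "(snd :: 'b \<times> 'c \<Rightarrow> 'c) \<in> borel_measurable borel"
  by (auto intro!: borel_measurable_continuous_onI continuous_intros)

lemma lborel_integral_fst:
  fixes f :: "'b::euclidean_space \<times> 'c::euclidean_space \<Rightarrow> real"
  assumes "integrable lborel f"
  shows "(LBINT w. f w) = (LBINT x. (LBINT y. f (x, y)))"
  using lborel_pair.integral_fst'[of f] assms by (simp add: lborel_prod)

lemma lborel_integral_snd:
  fixes f :: "'b::euclidean_space \<times> 'c::euclidean_space \<Rightarrow> real"
  assumes "integrable lborel f"
  shows "(LBINT w. f w) = (LBINT y. (LBINT x. f (x, y)))"
  using lborel_pair.integral_snd[of "\<lambda>x y. f (x, y)"] assms by (simp add: lborel_prod)

lemma lborel_integrable_fst:
  fixes f :: "'b::euclidean_space \<times> 'c::euclidean_space \<Rightarrow> real"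
  assumes "integrable lborel f"
  shows "integrable lborel (\<lambda>x. LBINT y. f (x, y))"
  using lborel_pair.integrable_fst'[of f] assms by (simp add: lborel_prod)

lemma lborel_integrable_snd:
  fixes f :: "'b::euclidean_space \<times> 'c::euclidean_space \<Rightarrow> real"
  assumes "integrable lborel f"
  shows "integrable lborel (\<lambda>y. LBINT x. f (x, y))"
  using lborel_pair.integrable_snd[of "\<lambda>x y. f (x, y)"] assms by (simp add: lborel_prod)

lemma lborel_integral_translate:
  fixes f :: "'b::euclidean_space \<Rightarrow> real"
  assumes [measurable]: "f \<in> borel_measurable borel"
  shows "(LBINT y. f (x + y)) = (LBINT y. f y)"
  by (subst lborel_distr_plus[symmetric, of x], subst integral_distr) auto

definition ucauchy :: "(nat \<Rightarrow> nat \<Rightarrow> real) \<Rightarrow> bool" where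
  "ucauchy B \<longleftrightarrow> (\<forall>e>0. \<exists>n0. \<forall>n\<ge>n0. \<forall>n'\<ge>n0. \<forall>m. \<bar>B n m - B n' m\<bar> \<le> e)"

lemma ucauchy_add:
  assumes "ucauchy A" "ucauchy B"
  shows "ucauchy (\<lambda>n m. A n m + B n m)"
  unfolding ucauchy_def
proof (intro allI impI)
  fix e :: real assume "e > 0"
  then have "e / 2 > 0" by simp
  then obtain n1 n2 where *: "\<And>n n' m. n \<ge> n1 \<Longrightarrow> n' \<ge> n1 \<Longrightarrow> \<bar>A n m - A n' m\<bar> \<le> e / 2"
     "\<And>n n' m. n \<ge> n2 \<Longrightarrow> n' \<ge> n2 \<Longrightarrow> \<bar>B n m - B n' m\<bar> \<le> e / 2"
    using assms unfolding ucauchy_def by meson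
  have "\<bar>A n m + B n m - (A n' m + B n' m)\<bar> \<le> e" if "n \<ge> max n1 n2" "n' \<ge> max n1 n2" for n n' m
    using *(1)[of n n' m] *(2)[of n n' m] that unfolding max.bounded_iff by linarith
  then show "\<exists>n0. \<forall>n\<ge>n0. \<forall>n'\<ge>n0. \<forall>m. \<bar>A n m + B n m - (A n' m + B n' m)\<bar> \<le> e" by blast
qed

lemma ucauchy_approx:
  assumes "\<And>e. e > 0 \<Longrightarrow> \<exists>A. ucauchy A \<and> (\<forall>n m. \<bar>B n m - A n m\<bar> \<le> e)"
  shows "ucauchy B"
  unfolding ucauchy_def
proof (intro allI impI)
  fix e :: real assume "e > 0"
  then have e: "e / 3 > 0" by simp
  obtain A where A: "ucauchy A" "\<And>n m. \<bar>B n m - A n m\<bar> \<le> e / 3" using assms[OF e] by blast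
  obtain n0 where n0: "\<And>n n' m. n \<ge> n0 \<Longrightarrow> n' \<ge> n0 \<Longrightarrow> \<bar>A n m - A n' m\<bar> \<le> e / 3"
    using A(1) e unfolding ucauchy_def by meson
  have "\<bar>B n m - B n' m\<bar> \<le> e" if "n \<ge> n0" "n' \<ge> n0" for n n' m
    using n0[OF that, of m] A(2)[of n m] A(2)[of n' m] by linarith
  then show "\<exists>n0. \<forall>n\<ge>n0. \<forall>n'\<ge>n0. \<forall>m. \<bar>B n m - B n' m\<bar> \<le> e" by blast
qed

text \<open>The factors play different roles: \<open>a\<close> has to be smooth because it will be
  approximated in the discrete spaces, whereas \<open>c\<close> and \<open>d\<close> only need to be
  continuous, hence bounded on compact sets. The nesting ((x, t), y) puts the argument of the first
  sequence in \<open>fst\<close> and the extra space variable in \<open>snd\<close>.\<close>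

inductive separated :: "(('a::euclidean_space \<times> real) \<times> 'a \<Rightarrow> real) \<Rightarrow> bool" where
  base: "smooth_expr a \<Longrightarrow> continuous_on UNIV c \<Longrightarrow> continuous_on UNIV d \<Longrightarrow>
           separated (\<lambda>w. a (fst (fst w)) * c (snd (fst w)) * d (snd w))"
| add: "separated f \<Longrightarrow> separated g \<Longrightarrow> separated (\<lambda>w. f w + g w)"

lemma separated_continuous_on: "separated f \<Longrightarrow> continuous_on S f"
proof (induction rule: separated.induct)
  case (base a c d)
  have "continuous_on S (\<lambda>w. a (fst (fst w)))"
    by (rule continuous_on_compose2[OF smooth_expr_continuous_on[OF base(1), of UNIV]])
       (auto intro!: continuous_intros)
  moreover have "continuous_on S (\<lambda>w. c (snd (fst w)))"
    by (rule continuous_on_compose2[OF base(2)])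
       (auto intro!: continuous_intros)
  moreover have "continuous_on S (\<lambda>w. d (snd w))"
    by (rule continuous_on_compose2[OF base(3)]) (auto intro!: continuous_intros)
  ultimately show ?case by (intro continuous_on_mult)
next
  case (add f g) then show ?case by (intro continuous_intros)
qed

lemma separated_mult: "separated f \<Longrightarrow> separated g \<Longrightarrow> separated (\<lambda>w. f w * g w)"
proof (induction f rule: separated.induct)
  case (base a c d)
  note f = this(1-3)
  show ?case using base(4)
  proof (induction g rule: separated.induct)
    case (base a' c' d')
    have "separated (\<lambda>w. (a (fst (fst w)) * a' (fst (fst w))) * (c (snd (fst w)) * c' (snd (fst w)))
        * (d (snd w) * d' (snd w)))"
      using separated.base[of "\<lambda>x. a x * a' x" "\<lambda>t. c t * c' t" "\<lambda>y. d y * d' y"] f base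
      by (auto intro!: smooth_expr.mult continuous_intros)
    then show ?case by (simp only: ac_simps)
  next
    case (add g h) then show ?case unfolding distrib_left by (intro separated.add)
  qed
next
  case (add f g) then show ?case unfolding distrib_right by (intro separated.add) auto
qed

text \<open>The coordinates x . v, t and y . v, each of product form with trivial other factors,
  separate points. Asking for a smooth factor in x costs nothing, as linear functions are
  smooth.\<close>

lemma separated_approx:
  assumes S: "compact S" and K: "continuous_on S K" and "e > 0"
  shows "\<exists>g. separated g \<and> (\<forall>w\<in>S. \<bar>K w - g w\<bar> < e)"
proof (rule Stone_Weierstrass_HOL[OF S _ _ _ _ _ K \<open>e > 0\<close>])
  show const: "separated (\<lambda>x. c)" for c
    using separated.base[OF smooth_expr.const[of c] continuous_on_const[of _ 1] continuous_on_const[of _ 1]] by simp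
  show "separated f \<Longrightarrow> continuous_on S f" for f by (rule separated_continuous_on)
  show "separated f \<and> separated g \<Longrightarrow> separated (\<lambda>x. f x + g x)" for f g by (auto intro: separated.add)
  show "separated f \<and> separated g \<Longrightarrow> separated (\<lambda>x. f x * g x)" for f g by (auto intro: separated_mult)
  fix w w' :: "('a \<times> real) \<times> 'a" assume "w \<in> S \<and> w' \<in> S \<and> w \<noteq> w'"
  then obtain x t y x' t' y' where w: "w = ((x, t), y)" "w' = ((x', t'), y')"
      and ne: "x \<noteq> x' \<or> t \<noteq> t' \<or> y \<noteq> y'"
    by (cases w; cases w'; cases "fst w"; cases "fst w'") auto
  have s1: "separated (\<lambda>w. fst (fst w) \<bullet> v)" for v :: 'a
    using separated.base[OF smooth_expr.inner[of v] continuous_on_const[of _ 1] continuous_on_const[of _ 1]] by simp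
  have s2: "separated (\<lambda>w. snd (fst w))"
    using separated.base[OF smooth_expr.const[of 1] continuous_on_id continuous_on_const[of _ 1]] by simp
  have s3: "separated (\<lambda>w. snd w \<bullet> v)" for v :: 'a
    using separated.base[OF smooth_expr.const[of 1] continuous_on_const[of _ 1]
        continuous_on_inner[OF continuous_on_id continuous_on_const[of _ v]]] by simp
  show "\<exists>f. separated f \<and> f w \<noteq> f w'"
    using ne
  proof (elim disjE)
    assume "x \<noteq> x'"
    then obtain v where "x \<bullet> v \<noteq> x' \<bullet> v" using euclidean_eqI[of x x'] by blast
    then show ?thesis
      using s1[of v]
      by (intro exI[of _ "\<lambda>w. fst (fst w) \<bullet> v"]) (simp add: w)
  next
    assume "t \<noteq> t'"
    then show ?thesis
      using s2 by (intro exI[of _ "\<lambda>w. snd (fst w)"]) (simp add: w)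
  next
    assume "y \<noteq> y'"
    then obtain v where "y \<bullet> v \<noteq> y' \<bullet> v" using euclidean_eqI[of y y'] by blast
    then show ?thesis
      using s3[of v]
      by (intro exI[of _ "\<lambda>w. snd w \<bullet> v"]) (simp add: w)
  qed
qed


text \<open>Stated once because both sequences are sliced in this way. The sup bound
  \<open>B\<close> gives integrability and stays out of the last estimate, which is Cauchy-Schwarz
  in x at fixed t, integrated in t. The indicator appears there since \<open>a\<close> is controlled
  on \<open>\<Omega>\<close> only.\<close>

lemma slice_bounded:
  fixes g :: "'a::euclidean_space \<times> real \<Rightarrow> real" and a :: "'a \<Rightarrow> real"
  assumes \<Omega>: "bounded \<Omega>" and \<Omega>m [measurable]: "\<Omega> \<in> sets borel"
    and gm [measurable]: "g \<in> borel_measurable borel" and am [measurable]: "a \<in> borel_measurable borel"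
    and gs: "\<And>w. w \<notin> \<Omega> \<times> {0..T} \<Longrightarrow> g w = 0" and gB: "\<And>w. \<bar>g w\<bar> \<le> B"
    and aM: "\<And>x. x \<in> \<Omega> \<Longrightarrow> \<bar>a x\<bar> \<le> M"
  shows slice_product_integrable: "integrable lborel (\<lambda>w. g w * a (fst w))"
    and slice_integrable: "integrable lborel (\<lambda>x. g (x, t) * a x)"
    and slice_measurable: "(\<lambda>t. LBINT x. g (x, t) * a x) \<in> borel_measurable borel"
    and slice_eq_0: "t \<notin> {0..T} \<Longrightarrow> (LBINT x. g (x, t) * a x) = 0"
    and slice_le: "\<bar>LBINT x. g (x, t) * a x\<bar> \<le> measure lborel \<Omega> * (B * M)"
    and slice_square_integrable: "integrable lborel (\<lambda>t. (LBINT x. g (x, t) * a x)\<^sup>2)"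
    and slice_L2: "(LBINT t. (LBINT x. g (x, t) * a x)\<^sup>2)
          \<le> (LBINT w. (g w)\<^sup>2) * (LBINT x. indicator \<Omega> x * (a x)\<^sup>2)"
proof -
  have B0: "0 \<le> B" using gB[of undefined] by linarith
  have gx: "g (x, t) = 0" if "x \<notin> \<Omega>" for x t using gs[of "(x, t)"] that by auto
  have bQ: "bounded (\<Omega> \<times> {0..T})" using \<Omega> by (intro bounded_Times) auto
  have ga: "\<bar>g (x, t) * a x\<bar> \<le> B * M" if "x \<in> \<Omega>" for x t
    using gB[of "(x, t)"] aM[OF that] B0 unfolding abs_mult by (intro mult_mono) auto
  show I: "integrable lborel (\<lambda>w. g w * a (fst w))"
    by (rule integrable_bounded_support[OF _ bQ, of _ "B * M"]) (use ga gs in \<open>auto simp: mem_Times_iff\<close>)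
  show It: "integrable lborel (\<lambda>x. g (x, t) * a x)" for t
    by (rule integrable_bounded_support[OF _ \<Omega>, of _ "B * M"]) (use ga gx in auto)
  show m [measurable]: "(\<lambda>t. LBINT x. g (x, t) * a x) \<in> borel_measurable borel"
    using borel_measurable_integrable[OF lborel_integrable_snd[OF I]] by simp
  show z: "(LBINT x. g (x, t) * a x) = 0" if "t \<notin> {0..T}" for t
    using gs that by (simp add: mem_Times_iff)
  have i\<Omega>: "integrable lborel (\<lambda>x. indicator \<Omega> x * c)" for c :: real
    by (rule integrable_bounded_support[OF _ \<Omega>, of _ "\<bar>c\<bar>"]) auto
  show le: "\<bar>LBINT x. g (x, t) * a x\<bar> \<le> measure lborel \<Omega> * (B * M)" for t
  proof -
    have "\<bar>LBINT x. g (x, t) * a x\<bar> \<le> (LBINT x. indicator \<Omega> x * (B * M))"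
      by (rule integral_abs_bound_integral[OF It i\<Omega>]) (use ga gx in \<open>auto simp: indicator_def\<close>)
    then show ?thesis by simp
  qed
  show I2: "integrable lborel (\<lambda>t. (LBINT x. g (x, t) * a x)\<^sup>2)"
  proof (rule integrable_bounded_support[of _ "{0..T}" "(measure lborel \<Omega> * (B * M))\<^sup>2"])
    show "\<bar>(LBINT x. g (x, t) * a x)\<^sup>2\<bar> \<le> (measure lborel \<Omega> * (B * M))\<^sup>2" for t
      using power_mono[OF le[of t] abs_ge_zero, of 2] by simp
  qed (use z in auto)
  have g2: "\<bar>(g w)\<^sup>2\<bar> \<le> B\<^sup>2" for w using power_mono[OF gB[of w] abs_ge_zero, of 2] by simp
  have Ig2: "integrable lborel (\<lambda>w. (g w)\<^sup>2)"
    by (rule integrable_bounded_support[OF _ bQ, of _ "B\<^sup>2"]) (use g2 gs in auto)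
  have Ig2t: "integrable lborel (\<lambda>x. (g (x, t))\<^sup>2)" for t
    by (rule integrable_bounded_support[OF _ \<Omega>, of _ "B\<^sup>2"]) (use g2 gx in auto)
  have Ia2: "integrable lborel (\<lambda>x. (indicator \<Omega> x * a x)\<^sup>2)"
  proof (rule integrable_bounded_support[OF _ \<Omega>, of _ "M\<^sup>2"])
    show "\<bar>(indicator \<Omega> x * a x)\<^sup>2\<bar> \<le> M\<^sup>2" if "x \<in> \<Omega>" for x
      using power_mono[OF aM[OF that] abs_ge_zero, of 2] that by simp
  qed auto
  have a2: "(LBINT x. (indicator \<Omega> x * a x)\<^sup>2) = (LBINT x. indicator \<Omega> x * (a x)\<^sup>2)"
    by (rule Bochner_Integration.integral_cong) (auto simp: indicator_def)
  have cs: "(LBINT x. g (x, t) * a x)\<^sup>2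
      \<le> (LBINT x. (g (x, t))\<^sup>2) * (LBINT x. indicator \<Omega> x * (a x)\<^sup>2)" for t
  proof -
    have "(LBINT x. g (x, t) * a x) = (LBINT x. g (x, t) * (indicator \<Omega> x * a x))"
      by (rule Bochner_Integration.integral_cong) (auto simp: indicator_def gx)
    then show ?thesis
      using Cauchy_Schwarz_integral[of "\<lambda>x. g (x, t)" lborel "\<lambda>x. indicator \<Omega> x * a x", OF _ _ Ig2t Ia2]
      by (simp add: a2)
  qed
  have "(LBINT t. (LBINT x. g (x, t) * a x)\<^sup>2)
      \<le> (LBINT t. (LBINT x. (g (x, t))\<^sup>2) * (LBINT x. indicator \<Omega> x * (a x)\<^sup>2))"
    by (rule integral_mono[OF I2 _ cs]) (use lborel_integrable_snd[OF Ig2] in simp)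
  also have "\<dots> = (LBINT w. (g w)\<^sup>2) * (LBINT x. indicator \<Omega> x * (a x)\<^sup>2)"
    by (simp add: lborel_integral_snd[OF Ig2])
  finally show "(LBINT t. (LBINT x. g (x, t) * a x)\<^sup>2)
          \<le> (LBINT w. (g w)\<^sup>2) * (LBINT x. indicator \<Omega> x * (a x)\<^sup>2)" .
qed

section \<open>Pairings through a kernel on the space-time strip\<close>

locale strip_sequences =
  fixes \<Omega> :: "'a::euclidean_space set" and T :: real and b z :: "nat \<Rightarrow> 'a \<times> real \<Rightarrow> real" and C :: real
  assumes open_\<Omega>: "open \<Omega>" and bounded_\<Omega>: "bounded \<Omega>" and T_pos: "T > 0"
    and b_measurable [measurable]: "\<And>n. b n \<in> borel_measurable borel"
    and z_measurable [measurable]: "\<And>m. z m \<in> borel_measurable borel"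
    and b_support: "\<And>n w. w \<notin> \<Omega> \<times> {0..T} \<Longrightarrow> b n w = 0"
    and z_support: "\<And>m w. w \<notin> \<Omega> \<times> {0..T} \<Longrightarrow> z m w = 0"
    and b_bounded: "\<And>n. \<exists>B. \<forall>w. \<bar>b n w\<bar> \<le> B"
    and z_bounded: "\<And>m. \<exists>B. \<forall>w. \<bar>z m w\<bar> \<le> B"
    and b_L2: "\<And>n. (LBINT w. (b n w)\<^sup>2) \<le> C"
    and z_L2: "\<And>m. (LBINT w. (z m w)\<^sup>2) \<le> C"
begin

lemma \<Omega>_borel [measurable]: "\<Omega> \<in> sets borel" using open_\<Omega> by simp

lemma bounded_strip: "bounded (\<Omega> \<times> {0..T})"
  using bounded_\<Omega> by (intro bounded_Times) auto

lemma C_nonneg: "0 \<le> C"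
proof -
  have "0 \<le> (LBINT w. (b 0 w)\<^sup>2)" by simp
  then show ?thesis using b_L2[of 0] by linarith
qed

definition admissible :: "(('a \<times> real) \<times> 'a \<Rightarrow> real) \<Rightarrow> bool" where
  "admissible K \<longleftrightarrow> K \<in> borel_measurable borel \<and> (\<exists>M. \<forall>w\<in>\<Omega> \<times> {0..T}. \<forall>y\<in>\<Omega>. \<bar>K (w, y)\<bar> \<le> M)"

text \<open>Nonlocal in space but local in time: with p = ((x, t), y), both sequences are taken at
  the same t, at the points x and y. The integral to be studied corresponds formally to a Dirac
  kernel at y = x, times \<open>\<phi>\<close>.\<close>

definition pairing :: "nat \<Rightarrow> nat \<Rightarrow> (('a \<times> real) \<times> 'a \<Rightarrow> real) \<Rightarrow> real" where
  "pairing n m K = (LBINT p. b n (fst p) * K p * z m (snd p, snd (fst p)))"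

lemma admissible_continuous:
  assumes "continuous_on UNIV K" shows "admissible K"
proof -
  have "compact ((closure \<Omega> \<times> {0..T}) \<times> closure \<Omega>)"
    using bounded_\<Omega> by (intro compact_Times) (auto simp: compact_closure)
  then have "bounded (K ` ((closure \<Omega> \<times> {0..T}) \<times> closure \<Omega>))"
    by (intro compact_imp_bounded compact_continuous_image continuous_on_subset[OF assms]) auto
  then obtain M where "\<And>p. p \<in> (closure \<Omega> \<times> {0..T}) \<times> closure \<Omega> \<Longrightarrow> \<bar>K p\<bar> \<le> M"
    unfolding bounded_iff by auto
  then have "\<forall>w\<in>\<Omega> \<times> {0..T}. \<forall>y\<in>\<Omega>. \<bar>K (w, y)\<bar> \<le> M"
    using closure_subset[of \<Omega>] by blast
  then show ?thesis
    unfolding admissible_def using borel_measurable_continuous_onI[OF assms] by blast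
qed

text \<open>The individual sup bounds may grow with the index; they provide integrability, and with
  it Fubini, while the common constant \<open>C\<close> is what enters the estimates.\<close>

lemma pairing_integrable:
  assumes "admissible K"
  shows "integrable lborel (\<lambda>p. b n (fst p) * K p * z m (snd p, snd (fst p)))"
proof -
  obtain M where [measurable]: "K \<in> borel_measurable borel"
      and M: "\<And>w y. w \<in> \<Omega> \<times> {0..T} \<Longrightarrow> y \<in> \<Omega> \<Longrightarrow> \<bar>K (w, y)\<bar> \<le> M"
    using assms unfolding admissible_def by blast
  obtain B where B: "\<And>w. \<bar>b n w\<bar> \<le> B" using b_bounded by blast
  obtain B' where B': "\<And>w. \<bar>z m w\<bar> \<le> B'" using z_bounded by blast
  show ?thesis
  proof (rule integrable_bounded_support[of _ "(\<Omega> \<times> {0..T}) \<times> \<Omega>" "B * M * B'"])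
    show "bounded ((\<Omega> \<times> {0..T}) \<times> \<Omega>)" by (intro bounded_Times bounded_strip bounded_\<Omega>)
    show "b n (fst p) * K p * z m (snd p, snd (fst p)) = 0" if "p \<notin> (\<Omega> \<times> {0..T}) \<times> \<Omega>" for p
      using that b_support[of "fst p" n] z_support[of "(snd p, snd (fst p))" m]
      by (auto simp: mem_Times_iff)
    fix p assume p: "p \<in> (\<Omega> \<times> {0..T}) \<times> \<Omega>"
    then have "\<bar>K p\<bar> \<le> M" using M[of "fst p" "snd p"] by auto
    then show "\<bar>b n (fst p) * K p * z m (snd p, snd (fst p))\<bar> \<le> B * M * B'"
      using B[of "fst p"] B'[of "(snd p, snd (fst p))"] unfolding abs_mult
      by (intro mult_mono) (auto intro: order_trans[OF abs_ge_zero] mult_nonneg_nonneg)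
  qed measurable
qed

lemma pairing_add:
  assumes "admissible K" "admissible K'"
  shows "pairing n m (\<lambda>p. K p + K' p) = pairing n m K + pairing n m K'"
proof -
  have "(\<lambda>p. b n (fst p) * (K p + K' p) * z m (snd p, snd (fst p)))
     = (\<lambda>p. b n (fst p) * K p * z m (snd p, snd (fst p)) + b n (fst p) * K' p * z m (snd p, snd (fst p)))"
    by (simp add: algebra_simps)
  then show ?thesis unfolding pairing_def
    using Bochner_Integration.integral_add[OF pairing_integrable[OF assms(1)] pairing_integrable[OF assms(2)]]
    by simp
qed

lemma square_integrable: "integrable lborel (\<lambda>w. (b n w)\<^sup>2)" "integrable lborel (\<lambda>w. (z n w)\<^sup>2)"
proof -
  obtain B where B: "\<And>w. \<bar>b n w\<bar> \<le> B" using b_bounded by blast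
  obtain B' where B': "\<And>w. \<bar>z n w\<bar> \<le> B'" using z_bounded by blast
  have "\<bar>(b n w)\<^sup>2\<bar> \<le> B\<^sup>2" for w using power_mono[OF B[of w] abs_ge_zero, of 2] by simp
  then show "integrable lborel (\<lambda>w. (b n w)\<^sup>2)"
    by (intro integrable_bounded_support[OF _ bounded_strip, of _ "B\<^sup>2"]) (auto simp: b_support)
  have "\<bar>(z n w)\<^sup>2\<bar> \<le> B'\<^sup>2" for w using power_mono[OF B'[of w] abs_ge_zero, of 2] by simp
  then show "integrable lborel (\<lambda>w. (z n w)\<^sup>2)"
    by (intro integrable_bounded_support[OF _ bounded_strip, of _ "B'\<^sup>2"]) (auto simp: z_support)
qed

text \<open>Young's inequality |b z| <= (b^2 + z^2) / 2 splits the integrand into \<open>P\<close>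
  and \<open>R\<close>. In each of them one space variable is idle and integrates to the measure of
  \<open>\<Omega>\<close>, which leaves the squared L^2 norms.\<close>

lemma pairing_le:
  assumes K: "admissible K" and e: "\<And>w y. w \<in> \<Omega> \<times> {0..T} \<Longrightarrow> y \<in> \<Omega> \<Longrightarrow> \<bar>K (w, y)\<bar> \<le> e" and e0: "0 \<le> e"
  shows "\<bar>pairing n m K\<bar> \<le> e * (measure lborel \<Omega> * C)"
proof -
  obtain B where B: "\<And>w. \<bar>b n w\<bar> \<le> B" using b_bounded by blast
  obtain B' where B': "\<And>w. \<bar>z m w\<bar> \<le> B'" using z_bounded by blast
  have bS: "bounded ((\<Omega> \<times> {0..T}) \<times> \<Omega>)" by (intro bounded_Times bounded_strip bounded_\<Omega>)
  define P where "P p = (b n (fst p))\<^sup>2 * indicator \<Omega> (snd p)" for p :: "('a \<times> real) \<times> 'a"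
  define R where "R p = indicator \<Omega> (fst (fst p)) * (z m (snd p, snd (fst p)))\<^sup>2" for p :: "('a \<times> real) \<times> 'a"
  have Pi: "integrable lborel P"
  proof (rule integrable_bounded_support[OF _ bS, of _ "B\<^sup>2"])
    show "P \<in> borel_measurable borel" unfolding P_def by measurable
    show "\<bar>P p\<bar> \<le> B\<^sup>2" for p
      using power_mono[OF B[of "fst p"] abs_ge_zero, of 2] by (simp add: P_def indicator_def)
    show "P p = 0" if "p \<notin> (\<Omega> \<times> {0..T}) \<times> \<Omega>" for p
      using that b_support[of "fst p" n] by (auto simp: P_def mem_Times_iff indicator_def)
  qed
  have Ri: "integrable lborel R"
  proof (rule integrable_bounded_support[OF _ bS, of _ "B'\<^sup>2"])
    show "R \<in> borel_measurable borel" unfolding R_def by measurable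
    show "\<bar>R p\<bar> \<le> B'\<^sup>2" for p
      using power_mono[OF B'[of "(snd p, snd (fst p))"] abs_ge_zero, of 2] by (simp add: R_def indicator_def)
    show "R p = 0" if "p \<notin> (\<Omega> \<times> {0..T}) \<times> \<Omega>" for p
      using that z_support[of "(snd p, snd (fst p))" m] by (auto simp: R_def mem_Times_iff indicator_def)
  qed
  have "(LBINT p. P p) = measure lborel \<Omega> * (LBINT w. (b n w)\<^sup>2)"
    unfolding lborel_integral_fst[OF Pi] by (simp add: P_def)
  then have P: "(LBINT p. P p) \<le> measure lborel \<Omega> * C"
    by (simp add: b_L2 mult_left_mono)
  have Ri': "integrable lborel (\<lambda>w. LBINT y. R (w, y))" by (rule lborel_integrable_fst[OF Ri])
  have "(LBINT p. R p) = measure lborel \<Omega> * (LBINT w. (z m w)\<^sup>2)"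
    unfolding lborel_integral_fst[OF Ri] lborel_integral_snd[OF Ri'] lborel_integral_snd[OF square_integrable(2)]
    by (simp add: R_def)
  then have R: "(LBINT p. R p) \<le> measure lborel \<Omega> * C"
    by (simp add: z_L2 mult_left_mono)
  have "\<bar>pairing n m K\<bar> \<le> (LBINT p. e / 2 * (P p + R p))"
    unfolding pairing_def
  proof (rule integral_abs_bound_integral[OF pairing_integrable[OF K]])
    show "integrable lborel (\<lambda>p. e / 2 * (P p + R p))" using Pi Ri by simp
    fix p
    show "\<bar>b n (fst p) * K p * z m (snd p, snd (fst p))\<bar> \<le> e / 2 * (P p + R p)"
    proof (cases "p \<in> (\<Omega> \<times> {0..T}) \<times> \<Omega>")
      case True
      define \<alpha> \<gamma> where "\<alpha> = \<bar>b n (fst p)\<bar>" and "\<gamma> = \<bar>z m (snd p, snd (fst p))\<bar>"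
      have "\<bar>K p\<bar> \<le> e" using True e[of "fst p" "snd p"] by auto
      then have "\<bar>b n (fst p) * K p * z m (snd p, snd (fst p))\<bar> \<le> \<alpha> * e * \<gamma>"
        unfolding abs_mult \<alpha>_def \<gamma>_def by (intro mult_mono) auto
      also have "\<dots> = e / 2 * (2 * \<alpha> * \<gamma>)" by simp
      also have "\<dots> \<le> e / 2 * (\<alpha>\<^sup>2 + \<gamma>\<^sup>2)"
        using sum_squares_bound[of \<alpha> \<gamma>] e0 by (intro mult_left_mono) auto
      also have "\<dots> = e / 2 * (P p + R p)"
        using True by (auto simp: P_def R_def \<alpha>_def \<gamma>_def mem_Times_iff)
      finally show ?thesis .
    next
      case False
      then have "b n (fst p) * K p * z m (snd p, snd (fst p)) = 0"
        using b_support[of "fst p" n] z_support[of "(snd p, snd (fst p))" m] by (auto simp: mem_Times_iff)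
      moreover have "0 \<le> e / 2 * (P p + R p)" using e0 by (simp add: P_def R_def)
      ultimately show ?thesis by (simp only: abs_zero)
    qed
  qed
  also have "\<dots> = e / 2 * ((LBINT p. P p) + (LBINT p. R p))" using Pi Ri by simp
  also have "\<dots> \<le> e / 2 * (measure lborel \<Omega> * C + measure lborel \<Omega> * C)"
    using P R e0 by (intro mult_left_mono add_mono) auto
  finally show ?thesis by (simp add: mult.commute)
qed

lemma pairing_product:
  assumes a: "continuous_on UNIV a" and c: "continuous_on UNIV c" and d: "continuous_on UNIV d"
  shows "pairing n m (\<lambda>p. a (fst (fst p)) * c (snd (fst p)) * d (snd p))
    = (LBINT t. (LBINT x. b n (x, t) * a x) * (c t * (LBINT y. z m (y, t) * d y)))"
proof -
  have "continuous_on UNIV (\<lambda>p. a (fst (fst p)) * c (snd (fst p)) * d (snd p))"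
    by (intro continuous_on_mult continuous_on_compose2[OF a] continuous_on_compose2[OF c]
        continuous_on_compose2[OF d] continuous_on_fst continuous_on_snd continuous_on_id) auto
  then have I: "integrable lborel (\<lambda>p. b n (fst p) * (a (fst (fst p)) * c (snd (fst p)) * d (snd p)) * z m (snd p, snd (fst p)))"
    by (intro pairing_integrable admissible_continuous)
  note I' = lborel_integrable_fst[OF I]
  show ?thesis
    unfolding pairing_def lborel_integral_fst[OF I] lborel_integral_snd[OF I']
  proof (rule Bochner_Integration.integral_cong[OF refl])
    fix t
    have "(LBINT y. b n (x, t) * (a x * c t * d y) * z m (y, t))
        = (b n (x, t) * a x) * (c t * (LBINT y. z m (y, t) * d y))" for x
    proof -
      have "(\<lambda>y. b n (x, t) * (a x * c t * d y) * z m (y, t))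
          = (\<lambda>y. (b n (x, t) * a x * c t) * (z m (y, t) * d y))" by (simp add: ac_simps)
      then show ?thesis by simp
    qed
    then show "(LBINT x. LBINT y. b n (fst ((x, t), y)) *
              (a (fst (fst ((x, t), y))) * c (snd (fst ((x, t), y))) * d (snd ((x, t), y))) *
              z m (snd ((x, t), y), snd (fst ((x, t), y))))
       = (LBINT x. b n (x, t) * a x) * (c t * (LBINT y. z m (y, t) * d y))"
      by simp
  qed
qed

lemma continuous_bounded_on_\<Omega>:
  assumes "continuous_on UNIV (a :: 'a \<Rightarrow> real)"
  obtains M where "\<And>x. x \<in> \<Omega> \<Longrightarrow> \<bar>a x\<bar> \<le> M"
proof -
  have "bounded (a ` closure \<Omega>)"
    using bounded_\<Omega> by (intro compact_imp_bounded compact_continuous_image continuous_on_subset[OF assms])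
      (auto simp: compact_closure)
  then show ?thesis using that closure_subset[of \<Omega>] unfolding bounded_iff by auto
qed

text \<open>At each time a product kernel factorises the pairing into F n(t) c(t) G m(t).
  Cauchy-Schwarz in t leaves the norm of F n - F n' times a norm of c G m that is bounded
  independently of m.\<close>

lemma ucauchy_pairing_product:
  assumes a: "continuous_on UNIV a" and c: "continuous_on UNIV c" and d: "continuous_on UNIV d"
    and F: "\<And>e. e > 0 \<Longrightarrow> \<exists>n0. \<forall>n\<ge>n0. \<forall>n'\<ge>n0.
        (LBINT t. ((LBINT x. b n (x, t) * a x) - (LBINT x. b n' (x, t) * a x))\<^sup>2) \<le> e"
  shows "ucauchy (\<lambda>n m. pairing n m (\<lambda>p. a (fst (fst p)) * c (snd (fst p)) * d (snd p)))"
proof -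
  have [measurable]: "a \<in> borel_measurable borel" "c \<in> borel_measurable borel" "d \<in> borel_measurable borel"
    using a c d by (auto intro: borel_measurable_continuous_onI)
  obtain Ma where Ma: "\<And>x. x \<in> \<Omega> \<Longrightarrow> \<bar>a x\<bar> \<le> Ma" by (rule continuous_bounded_on_\<Omega>[OF a]) blast
  obtain Md where Md: "\<And>x. x \<in> \<Omega> \<Longrightarrow> \<bar>d x\<bar> \<le> Md" by (rule continuous_bounded_on_\<Omega>[OF d]) blast
  have "bounded (c ` {0..T})"
    by (intro compact_imp_bounded compact_continuous_image continuous_on_subset[OF c]) auto
  then obtain Mc where Mc: "\<And>t. t \<in> {0..T} \<Longrightarrow> \<bar>c t\<bar> \<le> Mc"
    unfolding bounded_iff by (metis imageI real_norm_def)
  define F where "F n t = (LBINT x. b n (x, t) * a x)" for n t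
  define G where "G m t = (LBINT y. z m (y, t) * d y)" for m t
  have Fm [measurable]: "F n \<in> borel_measurable borel" and F2: "integrable lborel (\<lambda>t. (F n t)\<^sup>2)" for n
  proof -
    obtain B where B: "\<And>w. \<bar>b n w\<bar> \<le> B" using b_bounded by blast
    note * = bounded_\<Omega> \<Omega>_borel b_measurable \<open>a \<in> borel_measurable borel\<close> b_support B Ma
    show "F n \<in> borel_measurable borel" unfolding F_def by (rule slice_measurable[OF *])
    show "integrable lborel (\<lambda>t. (F n t)\<^sup>2)" unfolding F_def by (rule slice_square_integrable[OF *])
  qed
  define D where "D = (LBINT x. indicator \<Omega> x * (d x)\<^sup>2)"
  have D0: "0 \<le> D" unfolding D_def by simp
  have Gm [measurable]: "G m \<in> borel_measurable borel" and G2: "integrable lborel (\<lambda>t. (G m t)\<^sup>2)"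
    and GL: "(LBINT t. (G m t)\<^sup>2) \<le> C * D" and G0: "t \<notin> {0..T} \<Longrightarrow> G m t = 0" for m t
  proof -
    obtain B where B: "\<And>w. \<bar>z m w\<bar> \<le> B" using z_bounded by blast
    note * = bounded_\<Omega> \<Omega>_borel z_measurable \<open>d \<in> borel_measurable borel\<close> z_support B Md
    show "G m \<in> borel_measurable borel" unfolding G_def by (rule slice_measurable[OF *])
    show "integrable lborel (\<lambda>t. (G m t)\<^sup>2)" unfolding G_def by (rule slice_square_integrable[OF *])
    show "(LBINT t. (G m t)\<^sup>2) \<le> C * D"
      unfolding G_def D_def
      using slice_L2[OF *] mult_right_mono[OF z_L2[of m] D0] unfolding D_def by (rule order_trans)
    show "t \<notin> {0..T} \<Longrightarrow> G m t = 0" unfolding G_def by (rule slice_eq_0[OF *])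
  qed
  have cG: "(c t * G m t)\<^sup>2 \<le> Mc\<^sup>2 * (G m t)\<^sup>2" for m t
  proof (cases "t \<in> {0..T}")
    case True
    have "(c t)\<^sup>2 \<le> Mc\<^sup>2" using power_mono[OF Mc[OF True] abs_ge_zero, of 2] by simp
    then show ?thesis by (simp add: power_mult_distrib mult_right_mono)
  qed (simp add: G0)
  have cGi: "integrable lborel (\<lambda>t. (c t * G m t)\<^sup>2)" for m
    by (rule Bochner_Integration.integrable_bound[of _ "\<lambda>t. Mc\<^sup>2 * (G m t)\<^sup>2"]) (use cG G2 in auto)
  have cGL: "(LBINT t. (c t * G m t)\<^sup>2) \<le> Mc\<^sup>2 * (C * D)" for m
  proof -
    have "(LBINT t. (c t * G m t)\<^sup>2) \<le> (LBINT t. Mc\<^sup>2 * (G m t)\<^sup>2)"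
      by (rule integral_mono[OF cGi _ cG]) (use G2 in simp)
    also have "\<dots> \<le> Mc\<^sup>2 * (C * D)" using GL by (simp add: mult_left_mono)
    finally show ?thesis .
  qed
  \<comment> \<open>The summand 1 keeps the divisor positive when the bound is 0.\<close>
  define R where "R = Mc\<^sup>2 * (C * D) + 1"
  have R: "R > 0" unfolding R_def using D0 C_nonneg by (simp add: add_nonneg_pos)
  have FG: "integrable lborel (\<lambda>t. F n t * (c t * G m t))" for n m
    by (rule integrable_mult_L2) (use F2 cGi in auto)
  show ?thesis
    unfolding ucauchy_def pairing_product[OF a c d] F_def[symmetric] G_def[symmetric]
  proof (intro allI impI)
    fix e :: real assume e: "e > 0"
    then have "e\<^sup>2 / R > 0" using R by simp
    then obtain n0 where n0: "\<And>n n'. n \<ge> n0 \<Longrightarrow> n' \<ge> n0 \<Longrightarrow> (LBINT t. (F n t - F n' t)\<^sup>2) \<le> e\<^sup>2 / R"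
      using assms(4)[of "e\<^sup>2 / R"] unfolding F_def by blast
    have "\<bar>(LBINT t. F n t * (c t * G m t)) - (LBINT t. F n' t * (c t * G m t))\<bar> \<le> e"
      if n: "n \<ge> n0" "n' \<ge> n0" for n n' m
    proof -
      have Fd: "integrable lborel (\<lambda>t. (F n t - F n' t)\<^sup>2)"
      proof (rule Bochner_Integration.integrable_bound[of _ "\<lambda>t. 2 * (F n t)\<^sup>2 + 2 * (F n' t)\<^sup>2"])
        have "(x - y)\<^sup>2 \<le> 2 * x\<^sup>2 + 2 * y\<^sup>2" for x y :: real
          using zero_le_power2[of "x + y"] by (simp add: power2_sum power2_diff)
        then show "AE t in lborel. norm ((F n t - F n' t)\<^sup>2) \<le> norm (2 * (F n t)\<^sup>2 + 2 * (F n' t)\<^sup>2)"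
          by (simp add: add_nonneg_nonneg)
      qed (use F2 in auto)
      have "(LBINT t. F n t * (c t * G m t)) - (LBINT t. F n' t * (c t * G m t))
          = (LBINT t. (F n t - F n' t) * (c t * G m t))"
        unfolding left_diff_distrib by (rule Bochner_Integration.integral_diff[OF FG FG, symmetric])
      also have "\<dots>\<^sup>2 \<le> (LBINT t. (F n t - F n' t)\<^sup>2) * (LBINT t. (c t * G m t)\<^sup>2)"
        by (rule Cauchy_Schwarz_integral) (use Fd cGi in auto)
      also have "\<dots> \<le> e\<^sup>2 / R * R"
        using n0[OF n] cGL[of m] R by (intro mult_mono) (auto simp: R_def)
      also have "\<dots> = e\<^sup>2" using R by simp
      finally show ?thesis using e by (simp add: abs_le_square_iff[symmetric])
    qed
    then show "\<exists>n0. \<forall>n\<ge>n0. \<forall>n'\<ge>n0. \<forall>m.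
       \<bar>(LBINT t. F n t * (c t * G m t)) - (LBINT t. F n' t * (c t * G m t))\<bar> \<le> e"
      by blast
  qed
qed

lemma ucauchy_pairing_separated:
  assumes F: "\<And>a e. smooth_expr a \<Longrightarrow> e > 0 \<Longrightarrow> \<exists>n0. \<forall>n\<ge>n0. \<forall>n'\<ge>n0.
        (LBINT t. ((LBINT x. b n (x, t) * a x) - (LBINT x. b n' (x, t) * a x))\<^sup>2) \<le> e"
    and "separated K"
  shows "ucauchy (\<lambda>n m. pairing n m K)"
  using assms(2)
proof induction
  case (base a c d)
  then show ?case
    by (intro ucauchy_pairing_product F smooth_expr_continuous_on[of a])
next
  case (add f g)
  have "admissible f" "admissible g"
    using add.hyps by (auto intro: admissible_continuous separated_continuous_on)
  then show ?case using add.IH by (simp add: pairing_add ucauchy_add)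
qed

end


section \<open>Spatial mollification\<close>

lemma mollifier_exists:
  fixes \<delta> :: real
  assumes "\<delta> > 0"
  obtains \<rho> :: "'a::euclidean_space \<Rightarrow> real" and M where
    "continuous_on UNIV \<rho>" "\<And>\<xi>. 0 \<le> \<rho> \<xi>" "\<And>\<xi>. \<rho> \<xi> \<le> M" "\<And>\<xi>. \<delta> \<le> norm \<xi> \<Longrightarrow> \<rho> \<xi> = 0"
    "(LBINT \<xi>. \<rho> \<xi>) = 1"
proof -
  \<comment> \<open>A cone, normalised below: the kernel has only to be continuous, because
    Stone-Weierstrass afterwards supplies smooth factors.\<close>
  define r where "r \<xi> = max 0 (\<delta> - norm \<xi>)" for \<xi> :: 'a
  have rc: "continuous_on UNIV r" unfolding r_def by (intro continuous_intros)
  then have [measurable]: "r \<in> borel_measurable borel" by (rule borel_measurable_continuous_onI)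
  have ri: "integrable lborel r"
    by (rule integrable_bounded_support[of _ "ball 0 \<delta>" \<delta>]) (auto simp: r_def)
  define c where "c = (LBINT \<xi>. r \<xi>)"
  have "0 < \<delta> / 2 * measure lborel (ball (0::'a) (\<delta> / 2))"
    using assms content_ball_pos[of "\<delta> / 2" "0::'a"] by simp
  also have "\<dots> = (LBINT \<xi>. \<delta> / 2 * indicator (ball (0::'a) (\<delta> / 2)) \<xi>)" by simp
  also have "\<dots> \<le> c"
    unfolding c_def
  proof (rule integral_mono[OF _ ri])
    show "integrable lborel (\<lambda>\<xi>. \<delta> / 2 * indicator (ball (0::'a) (\<delta> / 2)) \<xi>)"
    proof (rule integrable_bounded_support[of _ "ball 0 (\<delta> / 2)" "\<delta> / 2"])
      show "(\<lambda>\<xi>. \<delta> / 2 * indicator (ball (0::'a) (\<delta> / 2)) \<xi>) \<in> borel_measurable borel"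
        by (intro borel_measurable_times borel_measurable_const borel_measurable_indicator) simp
    qed (use assms in auto)
  qed (auto simp: r_def indicator_def max_def)
  finally have c: "c > 0" .
  show ?thesis
  proof (rule that[of "\<lambda>\<xi>. r \<xi> / c" "\<delta> / c"])
    show "continuous_on UNIV (\<lambda>\<xi>. r \<xi> / c)" using rc c by (intro continuous_intros) auto
    show "(LBINT \<xi>. r \<xi> / c) = 1" using c by (simp add: c_def)
  qed (use c assms in \<open>auto simp: r_def divide_right_mono\<close>)
qed

context strip_sequences
begin

text \<open>After the substitution y = x + \<xi>, and since \<open>\<rho>\<close> has mass 1, the
  difference is the \<open>\<rho>\<close>-average over \<xi> of the integral of u (z(. + \<xi>) -
  z), with u = b \<phi>. For each |\<xi>| < \<delta> Cauchy-Schwarz and the translation bound apply,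
  and averaging costs no constant.\<close>

lemma pairing_mollifier:
  assumes \<phi>m [measurable]: "\<phi> \<in> borel_measurable borel" and \<phi>M: "\<And>w. \<bar>\<phi> w\<bar> \<le> M"
    and \<rho>m [measurable]: "\<rho> \<in> borel_measurable borel" and \<rho>0: "\<And>\<xi>. 0 \<le> \<rho> \<xi>" and \<rho>N: "\<And>\<xi>. \<rho> \<xi> \<le> N"
    and \<rho>s: "\<And>\<xi>. \<delta> \<le> norm \<xi> \<Longrightarrow> \<rho> \<xi> = 0" and \<rho>1: "(LBINT \<xi>. \<rho> \<xi>) = 1"
    and tr: "\<And>\<xi>. norm \<xi> < \<delta> \<Longrightarrow> (LBINT w. (z m (fst w + \<xi>, snd w) - z m w)\<^sup>2) \<le> \<epsilon>\<^sup>2"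
    and \<epsilon>: "0 \<le> \<epsilon>"
  shows "\<bar>pairing n m (\<lambda>p. \<rho> (snd p - fst (fst p)) * \<phi> (fst p)) - (LBINT w. b n w * z m w * \<phi> w)\<bar>
     \<le> M * sqrt C * \<epsilon>"
proof -
  obtain B where B: "\<And>w. \<bar>b n w\<bar> \<le> B" using b_bounded by blast
  obtain B' where B': "\<And>w. \<bar>z m w\<bar> \<le> B'" using z_bounded by blast
  have M0: "0 \<le> M" using \<phi>M[of undefined] by linarith
  have B0: "0 \<le> B" "0 \<le> B'" using B[of undefined] B'[of undefined] by linarith+
  have N0: "0 \<le> N" using \<rho>0[of undefined] \<rho>N[of undefined] by linarith
  have \<rho>i: "integrable lborel \<rho>"
    by (rule integrable_bounded_support[of _ "ball 0 \<delta>" N]) (use \<rho>0 \<rho>N \<rho>s in auto)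
  define u where "u w = b n w * \<phi> w" for w
  have um [measurable]: "u \<in> borel_measurable borel" unfolding u_def by measurable
  have us: "u w = 0" if "w \<notin> \<Omega> \<times> {0..T}" for w using b_support[OF that] by (simp add: u_def)
  have uB: "\<bar>u w\<bar> \<le> B * M" for w
    unfolding u_def abs_mult by (intro mult_mono B \<phi>M B0) auto
  have u2: "(u w)\<^sup>2 \<le> M\<^sup>2 * (b n w)\<^sup>2" for w
  proof -
    have "(\<phi> w)\<^sup>2 \<le> M\<^sup>2" using power_mono[OF \<phi>M[of w] abs_ge_zero, of 2] by simp
    then show ?thesis by (simp add: u_def power_mult_distrib mult.commute mult_right_mono)
  qed
  have u2i: "integrable lborel (\<lambda>w. (u w)\<^sup>2)"
    by (rule Bochner_Integration.integrable_bound[of _ "\<lambda>w. M\<^sup>2 * (b n w)\<^sup>2"])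
       (use u2 square_integrable in auto)
  have u2L: "(LBINT w. (u w)\<^sup>2) \<le> M\<^sup>2 * C"
  proof -
    have "(LBINT w. (u w)\<^sup>2) \<le> (LBINT w. M\<^sup>2 * (b n w)\<^sup>2)"
      by (rule integral_mono[OF u2i _ u2]) (use square_integrable in simp)
    also have "\<dots> \<le> M\<^sup>2 * C" using b_L2 by (simp add: mult_left_mono)
    finally show ?thesis .
  qed
  define K where "K = (\<lambda>p. \<rho> (snd p - fst (fst p)) * \<phi> (fst p))"
  have K: "admissible K"
    unfolding admissible_def
  proof
    show "K \<in> borel_measurable borel" unfolding K_def by measurable
    have "\<bar>K (w, y)\<bar> \<le> N * M" for w y
      unfolding K_def abs_mult using \<rho>0 \<rho>N \<phi>M N0 by (intro mult_mono) auto
    then show "\<exists>M. \<forall>w\<in>\<Omega> \<times> {0..T}. \<forall>y\<in>\<Omega>. \<bar>K (w, y)\<bar> \<le> M" by blast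
  qed
  note PI = pairing_integrable[OF K, of n m]
  define P1 where "P1 w = u w * (LBINT \<xi>. \<rho> \<xi> * z m (fst w + \<xi>, snd w))" for w
  have inner: "(LBINT y. b n (fst (w, y)) * K (w, y) * z m (snd (w, y), snd (fst (w, y)))) = P1 w" for w
  proof -
    have "(LBINT y. b n (fst (w, y)) * K (w, y) * z m (snd (w, y), snd (fst (w, y))))
        = (LBINT y. u w * (\<rho> (y - fst w) * z m (y, snd w)))"
      by (rule Bochner_Integration.integral_cong) (auto simp: K_def u_def)
    also have "\<dots> = u w * (LBINT y. \<rho> (y - fst w) * z m (y, snd w))" by simp
    also have "(LBINT y. \<rho> (y - fst w) * z m (y, snd w))
        = (LBINT \<xi>. \<rho> (fst w + \<xi> - fst w) * z m (fst w + \<xi>, snd w))"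
      by (rule lborel_integral_translate[symmetric]) measurable
    finally show ?thesis by (simp add: P1_def)
  qed
  have P1i: "integrable lborel P1" using lborel_integrable_fst[OF PI] unfolding inner by simp
  have P1: "pairing n m K = (LBINT w. P1 w)"
    unfolding pairing_def lborel_integral_fst[OF PI] inner ..
  have P2i: "integrable lborel (\<lambda>w. b n w * z m w * \<phi> w)"
  proof (rule integrable_bounded_support[OF _ bounded_strip, of _ "B * B' * M"])
    show "\<bar>b n w * z m w * \<phi> w\<bar> \<le> B * B' * M" for w
      unfolding abs_mult by (intro mult_mono B B' \<phi>M B0 mult_nonneg_nonneg) auto
  qed (auto simp: b_support)
  define D where "D p = u (fst p) * (\<rho> (snd p) * (z m (fst (fst p) + snd p, snd (fst p)) - z m (fst p)))"
    for p :: "('a \<times> real) \<times> 'a"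
  have Di: "integrable lborel D"
  proof (rule integrable_bounded_support[of _ "(\<Omega> \<times> {0..T}) \<times> ball 0 \<delta>" "(B * M) * (N * (B' + B'))"])
    show "D \<in> borel_measurable borel" unfolding D_def by measurable
    show "bounded ((\<Omega> \<times> {0..T}) \<times> ball (0::'a) \<delta>)" by (intro bounded_Times bounded_strip bounded_ball)
    show "D p = 0" if "p \<notin> (\<Omega> \<times> {0..T}) \<times> ball 0 \<delta>" for p
      using that us[of "fst p"] \<rho>s[of "snd p"] by (auto simp: D_def mem_Times_iff)
    show "\<bar>D p\<bar> \<le> (B * M) * (N * (B' + B'))" for p
    proof -
      have "\<bar>z m (fst (fst p) + snd p, snd (fst p)) - z m (fst p)\<bar> \<le> B' + B'"
        using B'[of "(fst (fst p) + snd p, snd (fst p))"] B'[of "fst p"] by linarith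
      then show ?thesis
        unfolding D_def abs_mult using \<rho>0 \<rho>N uB B0 M0 N0
        by (intro mult_mono) (auto intro: mult_nonneg_nonneg)
    qed
  qed
  have "pairing n m K - (LBINT w. b n w * z m w * \<phi> w) = (LBINT w. P1 w - b n w * z m w * \<phi> w)"
    unfolding P1 by (rule Bochner_Integration.integral_diff[OF P1i P2i, symmetric])
  also have "\<dots> = (LBINT w. (LBINT \<xi>. D (w, \<xi>)))"
  proof (rule Bochner_Integration.integral_cong[OF refl])
    fix w
    have zi: "integrable lborel (\<lambda>\<xi>. \<rho> \<xi> * z m (fst w + \<xi>, snd w))"
    proof (rule integrable_bounded_support[of _ "ball 0 \<delta>" "N * B'"])
      show "\<bar>\<rho> \<xi> * z m (fst w + \<xi>, snd w)\<bar> \<le> N * B'" for \<xi>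
        unfolding abs_mult using \<rho>0 \<rho>N B' N0 by (intro mult_mono) auto
    qed (use \<rho>s in auto)
    have "(LBINT \<xi>. D (w, \<xi>)) = u w * (LBINT \<xi>. \<rho> \<xi> * z m (fst w + \<xi>, snd w) - \<rho> \<xi> * z m w)"
    proof -
      have "(\<lambda>\<xi>. D (w, \<xi>)) = (\<lambda>\<xi>. u w * (\<rho> \<xi> * z m (fst w + \<xi>, snd w) - \<rho> \<xi> * z m w))"
        by (auto simp: D_def algebra_simps)
      then show ?thesis by simp
    qed
    also have "\<dots> = u w * ((LBINT \<xi>. \<rho> \<xi> * z m (fst w + \<xi>, snd w)) - (LBINT \<xi>. \<rho> \<xi> * z m w))"
      by (subst Bochner_Integration.integral_diff[OF zi]) (use \<rho>i in simp_all)
    also have "\<dots> = P1 w - b n w * z m w * \<phi> w"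
      using \<rho>1 by (simp add: P1_def u_def right_diff_distrib)
    finally show "P1 w - b n w * z m w * \<phi> w = (LBINT \<xi>. D (w, \<xi>))" ..
  qed
  \<comment> \<open>The order is exchanged to have \<xi> outermost: the translation estimate is an
    L^2 bound over (x, t) at fixed \<xi>.\<close>
  also have "\<dots> = (LBINT \<xi>. (LBINT w. D (w, \<xi>)))"
    using lborel_integral_fst[OF Di] lborel_integral_snd[OF Di] by simp
  also have "\<bar>\<dots>\<bar> \<le> (LBINT \<xi>. \<rho> \<xi> * (M * sqrt C * \<epsilon>))"
  proof (rule integral_abs_bound_integral[OF lborel_integrable_snd[OF Di]])
    show "integrable lborel (\<lambda>\<xi>. \<rho> \<xi> * (M * sqrt C * \<epsilon>))" using \<rho>i by simp
    fix \<xi> :: 'a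
    show "\<bar>LBINT w. D (w, \<xi>)\<bar> \<le> \<rho> \<xi> * (M * sqrt C * \<epsilon>)"
    proof (cases "norm \<xi> < \<delta>")
      case False
      then show ?thesis using \<rho>s[of \<xi>] by (simp add: D_def)
    next
      case True
      define v where "v w = z m (fst w + \<xi>, snd w) - z m w" for w
      have vm [measurable]: "v \<in> borel_measurable borel" unfolding v_def by measurable
      have v2i: "integrable lborel (\<lambda>w. (v w)\<^sup>2)"
      proof (rule integrable_bounded_support[of _ "(\<Omega> \<union> (\<lambda>x. x - \<xi>) ` \<Omega>) \<times> {0..T}" "(B' + B')\<^sup>2"])
        have "(\<lambda>x. x - \<xi>) ` \<Omega> = (+) (- \<xi>) ` \<Omega>" by (auto simp: image_iff)
        then show "bounded ((\<Omega> \<union> (\<lambda>x. x - \<xi>) ` \<Omega>) \<times> {0..T})"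
          using bounded_\<Omega> bounded_translation[OF bounded_\<Omega>, of "- \<xi>"] by (intro bounded_Times) auto
        have "\<bar>v w\<bar> \<le> B' + B'" for w
          using B'[of "(fst w + \<xi>, snd w)"] B'[of w] unfolding v_def by linarith
        then show "\<bar>(v w)\<^sup>2\<bar> \<le> (B' + B')\<^sup>2" for w
          using power_mono[of "\<bar>v w\<bar>" "B' + B'" 2] by simp
        show "(v w)\<^sup>2 = 0" if "w \<notin> (\<Omega> \<union> (\<lambda>x. x - \<xi>) ` \<Omega>) \<times> {0..T}" for w
        proof -
          have "z m w = 0" using that by (intro z_support) (auto simp: mem_Times_iff)
          moreover have "z m (fst w + \<xi>, snd w) = 0"
            using that by (intro z_support) (force simp: mem_Times_iff image_iff)
          ultimately show ?thesis by (simp add: v_def)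
        qed
      qed measurable
      have "(LBINT w. D (w, \<xi>)) = (LBINT w. \<rho> \<xi> * (u w * v w))"
        by (rule Bochner_Integration.integral_cong) (auto simp: D_def v_def)
      then have "\<bar>LBINT w. D (w, \<xi>)\<bar> = \<rho> \<xi> * \<bar>LBINT w. u w * v w\<bar>"
        using \<rho>0[of \<xi>] by (simp add: abs_mult)
      also have "\<dots> \<le> \<rho> \<xi> * (M * sqrt C * \<epsilon>)"
      proof (rule mult_left_mono[OF _ \<rho>0])
        have "\<bar>LBINT w. u w * v w\<bar> \<le> sqrt (LBINT w. (u w)\<^sup>2) * sqrt (LBINT w. (v w)\<^sup>2)"
          by (rule Cauchy_Schwarz_integral_sqrt) (use u2i v2i in auto)
        also have "\<dots> \<le> sqrt (M\<^sup>2 * C) * sqrt (\<epsilon>\<^sup>2)"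
          using u2L tr[OF True] by (intro mult_mono real_sqrt_le_mono) (auto simp: v_def C_nonneg)
        also have "\<dots> = M * sqrt C * \<epsilon>" using M0 \<epsilon> by (simp add: real_sqrt_mult)
        finally show "\<bar>LBINT w. u w * v w\<bar> \<le> M * sqrt C * \<epsilon>" .
      qed
      finally show ?thesis .
    qed
  qed
  also have "\<dots> = M * sqrt C * \<epsilon>" using \<rho>1 by simp
  finally show ?thesis unfolding K_def .
qed

theorem ucauchy_product:
  assumes F: "\<And>a e. smooth_expr a \<Longrightarrow> e > 0 \<Longrightarrow> \<exists>n0. \<forall>n\<ge>n0. \<forall>n'\<ge>n0.
        (LBINT t. ((LBINT x. b n (x, t) * a x) - (LBINT x. b n' (x, t) * a x))\<^sup>2) \<le> e"
    and tr: "\<And>\<epsilon>. \<epsilon> > 0 \<Longrightarrow> \<exists>\<delta>>0. \<forall>\<xi> m. norm \<xi> < \<delta> \<longrightarrow>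
        (LBINT w. (z m (fst w + \<xi>, snd w) - z m w)\<^sup>2) \<le> \<epsilon>\<^sup>2"
    and \<phi>: "continuous_on (closure \<Omega> \<times> {0..T}) \<phi>"
  shows "ucauchy (\<lambda>n m. LBINT w. b n w * z m w * \<phi> w)"
proof (rule ucauchy_approx)
  fix e :: real assume e: "e > 0"
  define Q where "Q = \<Omega> \<times> {0..T}"
  have Qm [measurable]: "Q \<in> sets borel" unfolding Q_def using open_\<Omega> by (intro borel_Times) auto
  have Qsub: "Q \<subseteq> closure \<Omega> \<times> {0..T}" unfolding Q_def using closure_subset by blast
  have comp: "compact (closure \<Omega> \<times> {0..T})"
    using bounded_\<Omega> by (intro compact_Times) (auto simp: compact_closure)
  then have "bounded (\<phi> ` (closure \<Omega> \<times> {0..T}))"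
    by (intro compact_imp_bounded compact_continuous_image \<phi>)
  then obtain M where M: "\<And>w. w \<in> closure \<Omega> \<times> {0..T} \<Longrightarrow> \<bar>\<phi> w\<bar> \<le> M"
    unfolding bounded_iff by auto
  \<comment> \<open>Extension by zero: \<open>\<phi>\<close> is prescribed only on the closed strip
    and need not be measurable elsewhere.\<close>
  define \<psi> where "\<psi> w = (if w \<in> Q then \<phi> w else 0)" for w
  have "(\<lambda>w. indicator Q w *\<^sub>R \<phi> w) \<in> borel_measurable borel"
    by (rule borel_measurable_continuous_on_indicator[OF Qm continuous_on_subset[OF \<phi> Qsub]])
  then have \<psi>m [measurable]: "\<psi> \<in> borel_measurable borel"
    unfolding \<psi>_def indicator_scaleR_eq_if .
  have \<psi>M: "\<bar>\<psi> w\<bar> \<le> max M 0" for w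
    unfolding \<psi>_def using M[of w] Qsub by (auto simp: max_def)
  \<comment> \<open>Half of \<open>e\<close> is spent on mollification and half, through
    \<open>e'\<close>, on the approximation of the kernel; the summands 1 guard against vanishing
    denominators.\<close>
  define \<epsilon> where "\<epsilon> = e / (2 * (max M 0 * sqrt C + 1))"
  have pos: "max M 0 * sqrt C + 1 > 0" using C_nonneg by (simp add: add_nonneg_pos)
  then have \<epsilon>: "\<epsilon> > 0" using e by (simp add: \<epsilon>_def)
  have \<epsilon>2: "max M 0 * sqrt C * \<epsilon> \<le> e / 2"
  proof -
    have "max M 0 * sqrt C * \<epsilon> \<le> (max M 0 * sqrt C + 1) * \<epsilon>" using \<epsilon> by (intro mult_right_mono) auto
    also have "\<dots> = e / 2" using pos unfolding \<epsilon>_def by (simp add: field_simps)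
    finally show ?thesis .
  qed
  obtain \<delta> where \<delta>: "\<delta> > 0" "\<And>\<xi> m. norm \<xi> < \<delta> \<Longrightarrow> (LBINT w. (z m (fst w + \<xi>, snd w) - z m w)\<^sup>2) \<le> \<epsilon>\<^sup>2"
    using tr[OF \<epsilon>] by blast
  obtain \<rho> :: "'a \<Rightarrow> real" and N where \<rho>: "continuous_on UNIV \<rho>" "\<And>\<xi>. 0 \<le> \<rho> \<xi>" "\<And>\<xi>. \<rho> \<xi> \<le> N"
      "\<And>\<xi>. \<delta> \<le> norm \<xi> \<Longrightarrow> \<rho> \<xi> = 0" "(LBINT \<xi>. \<rho> \<xi>) = 1"
    using mollifier_exists[OF \<delta>(1)] by blast
  have \<rho>m [measurable]: "\<rho> \<in> borel_measurable borel" using \<rho>(1) by (rule borel_measurable_continuous_onI)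
  \<comment> \<open>Two versions of one kernel: \<open>K\<close> is continuous on the compact set
    \<open>S\<close>, as Stone-Weierstrass requires, while \<open>K'\<close> is Borel everywhere, as
    \<open>admissible\<close> requires. They agree for (x, t) in the strip.\<close>
  define K where "K p = \<rho> (snd p - fst (fst p)) * \<phi> (fst p)" for p
  define K' where "K' p = \<rho> (snd p - fst (fst p)) * \<psi> (fst p)" for p
  define S where "S = (closure \<Omega> \<times> {0..T}) \<times> closure \<Omega>"
  have cS: "compact S" unfolding S_def using bounded_\<Omega> by (intro compact_Times[OF comp]) (auto simp: compact_closure)
  have cK: "continuous_on S K"
  proof -
    have "continuous_on S (\<lambda>p. \<rho> (snd p - fst (fst p)))"
      by (rule continuous_on_compose2[OF \<rho>(1)]) (auto intro!: continuous_intros)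
    moreover have "continuous_on S (\<lambda>p. \<phi> (fst p))"
      by (rule continuous_on_compose2[OF \<phi>]) (auto intro!: continuous_intros simp: S_def)
    ultimately show ?thesis unfolding K_def by (intro continuous_on_mult)
  qed
  define e' where "e' = e / (2 * (measure lborel \<Omega> * C + 1))"
  have pos': "measure lborel \<Omega> * C + 1 > 0" using C_nonneg by (simp add: add_nonneg_pos)
  have e'0: "e' > 0" using e pos' by (simp add: e'_def)
  obtain g where g: "separated g" "\<And>p. p \<in> S \<Longrightarrow> \<bar>K p - g p\<bar> < e'"
    using separated_approx[OF cS cK e'0] by blast
  have gad: "admissible g" by (intro admissible_continuous separated_continuous_on g)
  have gm [measurable]: "g \<in> borel_measurable borel" using gad by (simp add: admissible_def)
  define h where "h p = K' p + - 1 * g p" for p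
  have hb: "\<bar>h (w, y)\<bar> \<le> e'" if "w \<in> \<Omega> \<times> {0..T}" "y \<in> \<Omega>" for w y
  proof -
    have "(w, y) \<in> S" using that closure_subset[of \<Omega>] by (auto simp: S_def)
    moreover have "K' (w, y) = K (w, y)" using that by (simp add: K_def K'_def \<psi>_def Q_def)
    ultimately show ?thesis using g(2)[of "(w, y)"] by (simp add: h_def)
  qed
  have hm: "h \<in> borel_measurable borel" unfolding h_def K'_def by measurable
  have had: "admissible h" unfolding admissible_def using hm hb by blast
  have K'eq: "pairing n m K' = pairing n m g + pairing n m h" for n m
    using pairing_add[OF gad had, of n m] by (simp add: h_def)
  have small: "\<bar>pairing n m h\<bar> \<le> e / 2" for n m
  proof -
    have "\<bar>pairing n m h\<bar> \<le> e' * (measure lborel \<Omega> * C)"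
      by (rule pairing_le[OF had]) (use hb e'0 in auto)
    also have "\<dots> \<le> e' * (measure lborel \<Omega> * C + 1)" using e'0 by (intro mult_left_mono) auto
    also have "\<dots> = e / 2" using pos' unfolding e'_def by (simp add: field_simps)
    finally show ?thesis .
  qed
  have eq: "(LBINT w. b n w * z m w * \<phi> w) = (LBINT w. b n w * z m w * \<psi> w)" for n m
    by (rule Bochner_Integration.integral_cong) (auto simp: \<psi>_def Q_def b_support)
  have close: "\<bar>pairing n m K' - (LBINT w. b n w * z m w * \<psi> w)\<bar> \<le> e / 2" for n m
    using pairing_mollifier[OF \<psi>m \<psi>M \<rho>m \<rho>(2,3,4,5) \<delta>(2) less_imp_le[OF \<epsilon>], of \<delta> n m] \<epsilon>2
    unfolding K'_def by linarith
  have "\<bar>(LBINT w. b n w * z m w * \<phi> w) - pairing n m g\<bar> \<le> e" for n m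
    using close[of n m] small[of n m] K'eq[of n m] unfolding eq by linarith
  then show "\<exists>A. ucauchy A \<and> (\<forall>n m. \<bar>(LBINT w. b n w * z m w * \<phi> w) - A n m\<bar> \<le> e)"
    using ucauchy_pairing_separated[OF F g(1)] by blast
qed

end


section \<open>Gradient discretisations\<close>

lemma finite_bounded_convergent_subsequence:
  fixes v :: "nat \<Rightarrow> 'i \<Rightarrow> real"
  assumes "finite I" "\<And>k i. i \<in> I \<Longrightarrow> \<bar>v k i\<bar> \<le> B"
  shows "\<exists>r l. strict_mono (r :: nat \<Rightarrow> nat) \<and> (\<forall>i\<in>I. (\<lambda>k. v (r k) i) \<longlonglongrightarrow> l i)"
  using assms
proof (induction I)
  case empty
  show ?case by (auto intro!: exI[of _ id] simp: strict_mono_id)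
next
  case (insert j I)
  then obtain r l where r: "strict_mono (r :: nat \<Rightarrow> nat)" "\<And>i. i \<in> I \<Longrightarrow> (\<lambda>k. v (r k) i) \<longlonglongrightarrow> l i"
    by blast
  have "bounded (range (\<lambda>k. v (r k) j))"
    unfolding bounded_iff using insert.prems[of j] by auto
  then obtain c s where s: "strict_mono (s :: nat \<Rightarrow> nat)" "((\<lambda>k. v (r k) j) \<circ> s) \<longlonglongrightarrow> c"
    using bounded_imp_convergent_subsequence by blast
  have "(\<lambda>k. v ((r \<circ> s) k) i) \<longlonglongrightarrow> (l(j := c)) i" if "i \<in> insert j I" for i
  proof (cases "i = j")
    case True then show ?thesis using s(2) by (simp add: o_def)
  next
    case False
    then show ?thesis using LIMSEQ_subseq_LIMSEQ[OF r(2) s(1)] that by (auto simp: o_def)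
  qed
  then show ?case using strict_mono_o[OF r(1) s(1)] by blast
qed

lemma norm_add_powr_le:
  fixes x y :: "'b::real_normed_vector"
  assumes "p > 0"
  shows "norm (x + y) powr p \<le> 2 powr p * (norm x powr p + norm y powr p)"
proof -
  have "norm (x + y) \<le> 2 * max (norm x) (norm y)"
    using norm_triangle_ineq[of x y] by (simp add: max_def)
  then have "norm (x + y) powr p \<le> (2 * max (norm x) (norm y)) powr p"
    using assms by (intro powr_mono2) auto
  also have "\<dots> = 2 powr p * max (norm x) (norm y) powr p" by (simp add: powr_mult)
  also have "\<dots> \<le> 2 powr p * (norm x powr p + norm y powr p)"
    by (intro mult_left_mono) (auto simp: max_def)
  finally show ?thesis .
qed

text \<open>With r = |f| / l the pointwise bound r^2 <= 1 + r^p, valid for r >= 0 and p >= 2, is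
  integrated over \<open>S\<close>. It stands in for Hoelder's inequality, at the price of a
  nonoptimal constant.\<close>

lemma L2_le_Lp:
  fixes f :: "'b::euclidean_space \<Rightarrow> real"
  assumes [measurable]: "f \<in> borel_measurable borel" and S: "bounded S" and Sm [measurable]: "S \<in> sets borel"
    and B: "\<And>x. \<bar>f x\<bar> \<le> B" and f0: "\<And>x. x \<notin> S \<Longrightarrow> f x = 0"
    and p: "p \<ge> 2" and l: "l > 0" "lpnorm lborel p f \<le> l"
  shows "(LBINT x. (f x)\<^sup>2) \<le> l\<^sup>2 * (measure lborel S + 1)"
proof -
  have fp: "integrable lborel (\<lambda>x. norm (f x) powr p)"
    by (rule integrable_bounded_support[OF _ S, of _ "B powr p"])
       (use B p in \<open>auto simp: f0 intro!: powr_mono2\<close>)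
  have Si: "integrable lborel (indicator S :: 'b \<Rightarrow> real)"
    by (rule integrable_bounded_support[OF _ S, of _ 1]) auto
  have le: "(LBINT x. norm (f x) powr p) \<le> l powr p"
  proof -
    define A where "A = (LBINT x. norm (f x) powr p)"
    have A: "A \<ge> 0" unfolding A_def by (simp add: integral_nonneg)
    have "(A powr (1 / p)) powr p \<le> l powr p"
      using l(2) p unfolding lpnorm_def A_def by (intro powr_mono2) auto
    then show ?thesis using p A by (simp add: powr_powr A_def)
  qed
  have pt: "(f x)\<^sup>2 \<le> l\<^sup>2 * (indicator S x + norm (f x) powr p / l powr p)" for x
  proof (cases "x \<in> S")
    case True
    define r where "r = \<bar>f x\<bar> / l"
    have r0: "r \<ge> 0" using l by (simp add: r_def)
    have "r\<^sup>2 \<le> 1 + r powr p"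
    proof (cases "r \<le> 1")
      case True
      then have "r\<^sup>2 \<le> 1" using r0 by (simp add: power_le_one)
      then show ?thesis by (simp add: add_increasing2)
    next
      case False
      then have "r powr 2 \<le> r powr p" using p by (intro powr_mono) auto
      then show ?thesis using False by (simp add: powr_numeral)
    qed
    then have "l\<^sup>2 * r\<^sup>2 \<le> l\<^sup>2 * (1 + r powr p)" by (intro mult_left_mono) auto
    moreover have "l\<^sup>2 * r\<^sup>2 = (f x)\<^sup>2" using l by (simp add: r_def power_divide)
    moreover have "r powr p = norm (f x) powr p / l powr p" using l by (simp add: r_def powr_divide)
    ultimately show ?thesis using True by simp
  qed (simp add: f0)
  have "(LBINT x. (f x)\<^sup>2) \<le> (LBINT x. l\<^sup>2 * (indicator S x + norm (f x) powr p / l powr p))"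
    by (rule integral_mono'[OF _ pt]) (use fp Si in auto)
  also have "\<dots> = l\<^sup>2 * (measure lborel S + (LBINT x. norm (f x) powr p) / l powr p)"
    using fp Si by simp
  also have "\<dots> \<le> l\<^sup>2 * (measure lborel S + 1)"
    using le l by (intro mult_left_mono add_left_mono) auto
  finally show ?thesis .
qed

text \<open>Choosing the Borel part inside \<open>A\<close> keeps supports inside
  \<open>\<Omega>\<close> everywhere rather than almost everywhere. The remainder need not be Borel,
  so only its inclusion in a Borel null set is recorded.\<close>

definition borel_core :: "'a::euclidean_space set \<Rightarrow> 'a set" where
  "borel_core A = (SOME B. B \<in> sets borel \<and> B \<subseteq> A \<and> (\<exists>Z\<in>null_sets lborel. A - B \<subseteq> Z))"

lemma borel_core:
  assumes "A \<in> sets lebesgue"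
  shows borel_core_borel: "borel_core A \<in> sets borel" and borel_core_subset: "borel_core A \<subseteq> A"
    and borel_core_null: "\<exists>Z\<in>null_sets lborel. A - borel_core A \<subseteq> Z"
proof -
  obtain S N N' where "A = S \<union> N" "N \<subseteq> N'" "N' \<in> null_sets lborel" "S \<in> sets lborel"
    by (rule sets_completionE[OF assms])
  then have "S \<in> sets borel \<and> S \<subseteq> A \<and> (\<exists>Z\<in>null_sets lborel. A - S \<subseteq> Z)"
    by auto
  then have "borel_core A \<in> sets borel \<and> borel_core A \<subseteq> A \<and> (\<exists>Z\<in>null_sets lborel. A - borel_core A \<subseteq> Z)"
    unfolding borel_core_def by (rule someI)
  then show "borel_core A \<in> sets borel" "borel_core A \<subseteq> A"
      "\<exists>Z\<in>null_sets lborel. A - borel_core A \<subseteq> Z"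
    by auto
qed

text \<open>Fubini's theorem is used for \<open>lborel\<close>, whereas the cells are only Lebesgue measurable.\<close>

definition PiB :: "'a::euclidean_space gdisc \<Rightarrow> (nat \<Rightarrow> real) \<Rightarrow> 'a \<Rightarrow> real" where
  "PiB D u x = (\<Sum>i\<in>gd_I D. u i * indicator (borel_core (gd_cell D i)) x)"

section \<open>Equivalence of norms on the discrete space\<close>

locale stgd =
  fixes \<Omega> :: "'a::euclidean_space set" and p T :: real and D :: "'a gdisc"
  assumes open_\<Omega>: "open \<Omega>" and bounded_\<Omega>: "bounded \<Omega>" and p: "p \<ge> 2" and T_pos: "T > 0"
    and is_stgd: "is_stgd \<Omega> p T D"
begin

lemma finite_I: "finite (gd_I D)"
  and cell_lebesgue: "i \<in> gd_I D \<Longrightarrow> gd_cell D i \<in> sets lebesgue"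
  and cell_subset: "i \<in> gd_I D \<Longrightarrow> gd_cell D i \<subseteq> \<Omega>"
  and grad_Lp: "u \<in> XD D \<Longrightarrow> memLp (lebesgue_on \<Omega>) p (gd_grad D u)"
  and grad_linear: "u \<in> XD D \<Longrightarrow> v \<in> XD D \<Longrightarrow> AE x in lebesgue_on \<Omega>.
         gd_grad D (\<lambda>i. a * u i + c * v i) x = a *\<^sub>R gd_grad D u x + c *\<^sub>R gd_grad D v x"
  and grad_eq_0: "u \<in> XD D \<Longrightarrow> lpnorm (lebesgue_on \<Omega>) p (gd_grad D u) = 0 \<Longrightarrow> u i = 0"
  and t_0: "gd_t D 0 = 0" and t_less: "n < gd_N D \<Longrightarrow> gd_t D n < gd_t D (Suc n)" and t_N: "gd_t D (gd_N D) = T"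
  using is_stgd unfolding is_stgd_def by blast+

lemma \<Omega>_borel [measurable]: "\<Omega> \<in> sets borel" using open_\<Omega> by simp

lemma XD_lincomb: "u \<in> XD D \<Longrightarrow> v \<in> XD D \<Longrightarrow> (\<lambda>i. a * u i + c * v i) \<in> XD D"
  by (simp add: XD_def)

lemma XD_scale: "u \<in> XD D \<Longrightarrow> (\<lambda>i. a * u i) \<in> XD D"
  by (simp add: XD_def)

definition gnorm :: "(nat \<Rightarrow> real) \<Rightarrow> real" where
  "gnorm u = lpnorm (lebesgue_on \<Omega>) p (gd_grad D u)"

text \<open>The p-th power of the gradient norm. A pointwise estimate gives it a triangle inequality
  up to the factor 2^p, which serves in place of Minkowski's inequality.\<close>

definition gmod :: "(nat \<Rightarrow> real) \<Rightarrow> real" where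
  "gmod u = (\<integral>x. norm (gd_grad D u x) powr p \<partial>lebesgue_on \<Omega>)"

lemma gmod_nonneg: "0 \<le> gmod u" unfolding gmod_def by (simp add: integral_nonneg)

lemma gnorm_nonneg: "0 \<le> gnorm u" unfolding gnorm_def lpnorm_def by simp

lemma gnorm_eq: "gnorm u = gmod u powr (1 / p)"
  unfolding gnorm_def gmod_def lpnorm_def ..

lemma gmod_eq: "gmod u = gnorm u powr p"
  using p gmod_nonneg[of u] by (simp add: gnorm_eq powr_powr)

lemma gmod_lincomb_le:
  assumes u: "u \<in> XD D" and v: "v \<in> XD D"
  shows "gmod (\<lambda>i. a * u i + c * v i) \<le> 2 powr p * (\<bar>a\<bar> powr p * gmod u + \<bar>c\<bar> powr p * gmod v)"
proof -
  have [measurable]: "gd_grad D u \<in> borel_measurable (lebesgue_on \<Omega>)" "gd_grad D v \<in> borel_measurable (lebesgue_on \<Omega>)"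
    and iu: "integrable (lebesgue_on \<Omega>) (\<lambda>x. norm (gd_grad D u x) powr p)"
    and iv: "integrable (lebesgue_on \<Omega>) (\<lambda>x. norm (gd_grad D v x) powr p)"
    and iw: "integrable (lebesgue_on \<Omega>) (\<lambda>x. norm (gd_grad D (\<lambda>i. a * u i + c * v i) x) powr p)"
    using grad_Lp[OF u] grad_Lp[OF v] grad_Lp[OF XD_lincomb[OF u v, of a c]] unfolding memLp_def by auto
  have "gmod (\<lambda>i. a * u i + c * v i) \<le> (\<integral>x. 2 powr p *
      (\<bar>a\<bar> powr p * norm (gd_grad D u x) powr p + \<bar>c\<bar> powr p * norm (gd_grad D v x) powr p) \<partial>lebesgue_on \<Omega>)"
    unfolding gmod_def
  proof (rule integral_mono_AE[OF iw])
    show "integrable (lebesgue_on \<Omega>) (\<lambda>x. 2 powr p *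
      (\<bar>a\<bar> powr p * norm (gd_grad D u x) powr p + \<bar>c\<bar> powr p * norm (gd_grad D v x) powr p))"
      using iu iv by simp
    show "AE x in lebesgue_on \<Omega>. norm (gd_grad D (\<lambda>i. a * u i + c * v i) x) powr p \<le> 2 powr p *
      (\<bar>a\<bar> powr p * norm (gd_grad D u x) powr p + \<bar>c\<bar> powr p * norm (gd_grad D v x) powr p)"
      using grad_linear[OF u v, of a c]
    proof eventually_elim
      case (elim x)
      show ?case unfolding elim
        using norm_add_powr_le[of p "a *\<^sub>R gd_grad D u x" "c *\<^sub>R gd_grad D v x"] p
        by (simp add: powr_mult)
    qed
  qed
  also have "\<dots> = 2 powr p * (\<bar>a\<bar> powr p * gmod u + \<bar>c\<bar> powr p * gmod v)"
    using iu iv by (simp add: gmod_def)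
  finally show ?thesis .
qed

lemma gnorm_scale:
  assumes u: "u \<in> XD D" shows "gnorm (\<lambda>i. a * u i) = \<bar>a\<bar> * gnorm u"
proof -
  have [measurable]: "gd_grad D u \<in> borel_measurable (lebesgue_on \<Omega>)"
      "gd_grad D (\<lambda>i. a * u i) \<in> borel_measurable (lebesgue_on \<Omega>)"
    using grad_Lp[OF u] grad_Lp[OF XD_scale[OF u, of a]] unfolding memLp_def by auto
  have "gmod (\<lambda>i. a * u i) = (\<integral>x. \<bar>a\<bar> powr p * norm (gd_grad D u x) powr p \<partial>lebesgue_on \<Omega>)"
    unfolding gmod_def
  proof (rule integral_cong_AE)
    show "AE x in lebesgue_on \<Omega>. norm (gd_grad D (\<lambda>i. a * u i) x) powr p = \<bar>a\<bar> powr p * norm (gd_grad D u x) powr p"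
      using grad_linear[OF u u, of a 0] by eventually_elim (simp add: powr_mult)
  qed measurable
  also have "\<dots> = \<bar>a\<bar> powr p * gmod u" by (simp add: gmod_def)
  finally show ?thesis using p gmod_nonneg[of u]
    by (simp add: gnorm_eq powr_mult powr_powr)
qed

text \<open>Induction over the set of active coordinates; each step splits off one basis vector
  \<open>E\<close> by the quasi-triangle inequality. The constant depends on the discretisation, and
  only its finiteness matters.\<close>

lemma gmod_le_coeffs: "\<exists>C\<ge>0. \<forall>u\<in>XD D. gmod u \<le> C * (\<Sum>i\<in>gd_I D. \<bar>u i\<bar> powr p)"
proof -
  have z: "(\<lambda>i. 0) \<in> XD D" by (simp add: XD_def)
  have "\<exists>C\<ge>0. \<forall>u. (\<forall>i. i \<notin> J \<longrightarrow> u i = 0) \<longrightarrow> gmod u \<le> C * (\<Sum>i\<in>J. \<bar>u i\<bar> powr p)"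
    if "finite J" "J \<subseteq> gd_I D" for J
    using that
  proof (induction J)
    case empty
    \<comment> \<open>With both coefficients 0 the right-hand side of the inequality is 0, as 0 powr
      p = 0.\<close>
    have "gmod (\<lambda>i. 0) \<le> 0" using gmod_lincomb_le[OF z z, of 0 0] by simp
    then have "gmod u \<le> 0 * (\<Sum>i\<in>{}. \<bar>u i\<bar> powr p)" if "\<forall>i. i \<notin> {} \<longrightarrow> u i = 0" for u :: "nat \<Rightarrow> real"
    proof -
      have "u = (\<lambda>i. 0)" using that by auto
      then show ?thesis using \<open>gmod (\<lambda>i. 0) \<le> 0\<close> by simp
    qed
    then show ?case by blast
  next
    case (insert j J)
    then obtain C where C: "C \<ge> 0" "\<And>u. (\<forall>i. i \<notin> J \<longrightarrow> u i = 0) \<Longrightarrow> gmod u \<le> C * (\<Sum>i\<in>J. \<bar>u i\<bar> powr p)"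
      by auto
    define E where "E = (\<lambda>i. if i = j then 1 else 0 :: real)"
    have E: "E \<in> XD D" using insert.prems by (auto simp: XD_def E_def)
    have "gmod u \<le> (2 powr p * (C + gmod E)) * (\<Sum>i\<in>insert j J. \<bar>u i\<bar> powr p)"
      if u: "\<forall>i. i \<notin> insert j J \<longrightarrow> u i = 0" for u
    proof -
      have u': "u(j := 0) \<in> XD D" using u insert.prems by (auto simp: XD_def)
      have eq: "u = (\<lambda>i. 1 * (u(j := 0)) i + u j * E i)" by (auto simp: E_def)
      have s: "(\<Sum>i\<in>J. \<bar>(u(j := 0)) i\<bar> powr p) = (\<Sum>i\<in>J. \<bar>u i\<bar> powr p)"
        using insert.hyps by (intro sum.cong) auto
      have nn: "0 \<le> (\<Sum>i\<in>J. \<bar>u i\<bar> powr p)" by (simp add: sum_nonneg)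
      have "gmod u \<le> 2 powr p * (\<bar>1\<bar> powr p * gmod (u(j := 0)) + \<bar>u j\<bar> powr p * gmod E)"
        using gmod_lincomb_le[OF u' E, of 1 "u j"] unfolding eq[symmetric] .
      also have "\<dots> \<le> 2 powr p * (C * (\<Sum>i\<in>J. \<bar>u i\<bar> powr p) + \<bar>u j\<bar> powr p * gmod E)"
      proof (intro mult_left_mono add_right_mono)
        have "gmod (u(j := 0)) \<le> C * (\<Sum>i\<in>J. \<bar>(u(j := 0)) i\<bar> powr p)"
          using u by (intro C(2)) simp
        then show "\<bar>1\<bar> powr p * gmod (u(j := 0)) \<le> C * (\<Sum>i\<in>J. \<bar>u i\<bar> powr p)" unfolding s by simp
      qed simp
      also have "\<dots> \<le> 2 powr p * ((C + gmod E) * (\<bar>u j\<bar> powr p + (\<Sum>i\<in>J. \<bar>u i\<bar> powr p)))"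
      proof (rule mult_left_mono)
        have "0 \<le> C * \<bar>u j\<bar> powr p" "0 \<le> gmod E * (\<Sum>i\<in>J. \<bar>u i\<bar> powr p)"
          using C(1) gmod_nonneg[of E] nn by simp_all
        then show "C * (\<Sum>i\<in>J. \<bar>u i\<bar> powr p) + \<bar>u j\<bar> powr p * gmod E
            \<le> (C + gmod E) * (\<bar>u j\<bar> powr p + (\<Sum>i\<in>J. \<bar>u i\<bar> powr p))"
          by (simp add: distrib_left distrib_right mult.commute)
      qed simp
      finally show ?thesis using insert.hyps by (simp add: mult.assoc)
    qed
    then show ?case using C(1) gmod_nonneg[of E]
      by (intro exI[of _ "2 powr p * (C + gmod E)"]) auto
  qed
  from this[OF finite_I order_refl] show ?thesis by (auto simp: XD_def)
qed

text \<open>Compactness of the unit sphere in finite dimension: vectors with coefficient sum 1 and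
  gradient norm tending to 0 would have a limit with coefficient sum 1 and zero gradient, against
  definiteness. The purpose is to bound the sets behind \<open>dualnorm\<close> and
  \<open>T_comp\<close> from above, so that their \<open>Sup\<close> really dominates each element.
  The constant depends on \<open>D\<close> and never enters a uniform estimate.\<close>

lemma coeffs_le_gnorm: "\<exists>c\<ge>0. \<forall>u\<in>XD D. (\<Sum>i\<in>gd_I D. \<bar>u i\<bar>) \<le> c * gnorm u"
proof (rule ccontr)
  define s where "s u = (\<Sum>i\<in>gd_I D. \<bar>u i\<bar>)" for u :: "nat \<Rightarrow> real"
  assume "\<not> ?thesis"
  then have "\<forall>k. \<exists>u\<in>XD D. s u > real (Suc k) * gnorm u"
    unfolding s_def by (metis not_le of_nat_0_le_iff)
  then obtain u where u: "\<And>k. u k \<in> XD D" "\<And>k. s (u k) > real (Suc k) * gnorm (u k)" by metis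
  have su: "s (u k) > 0" for k
    using u(2)[of k] gnorm_nonneg[of "u k"] by (meson le_less_trans mult_nonneg_nonneg of_nat_0_le_iff)
  define v where "v k = (\<lambda>i. (1 / s (u k)) * u k i)" for k
  have vX: "v k \<in> XD D" for k unfolding v_def by (rule XD_scale[OF u(1)])
  have sv: "s (v k) = 1" for k
  proof -
    have "s (v k) = s (u k) / s (u k)"
      unfolding v_def using su[of k] by (simp add: s_def abs_mult flip: sum_divide_distrib)
    then show ?thesis using su[of k] by simp
  qed
  have gv: "gnorm (v k) \<le> 1 / real (Suc k)" for k
  proof -
    have "gnorm (v k) = gnorm (u k) / s (u k)"
      unfolding v_def gnorm_scale[OF u(1)] using su[of k] by simp
    also have "\<dots> \<le> 1 / real (Suc k)"
      using u(2)[of k] su[of k] by (simp add: field_simps)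
    finally show ?thesis .
  qed
  have vb: "\<bar>v k i\<bar> \<le> 1" if "i \<in> gd_I D" for k i
    using member_le_sum[OF that, of "\<lambda>i. \<bar>v k i\<bar>"] finite_I sv[of k] by (simp add: s_def)
  obtain r l where r: "strict_mono (r :: nat \<Rightarrow> nat)" "\<And>i. i \<in> gd_I D \<Longrightarrow> (\<lambda>k. v (r k) i) \<longlonglongrightarrow> l i"
    using finite_bounded_convergent_subsequence[OF finite_I, of v 1] vb by blast
  define w where "w i = (if i \<in> gd_I D then l i else 0)" for i
  have wX: "w \<in> XD D" by (simp add: w_def XD_def)
  have wl: "(\<lambda>k. v (r k) i) \<longlonglongrightarrow> w i" if "i \<in> gd_I D" for i using r(2)[OF that] that by (simp add: w_def)
  have "(\<lambda>k. s (v (r k))) \<longlonglongrightarrow> s w"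
    unfolding s_def by (intro tendsto_sum tendsto_rabs wl)
  then have sw: "s w = 1" unfolding sv by (simp add: LIMSEQ_const_iff)
  obtain C where C: "C \<ge> 0" "\<And>u. u \<in> XD D \<Longrightarrow> gmod u \<le> C * (\<Sum>i\<in>gd_I D. \<bar>u i\<bar> powr p)"
    using gmod_le_coeffs by blast
  \<comment> \<open>The first term tends to 0 by construction, the second because the coefficients
    converge; the quasi-triangle inequality thus replaces continuity of the gradient norm.\<close>
  have le: "gmod w \<le> 2 powr p * (gmod (v (r k)) + C * (\<Sum>i\<in>gd_I D. \<bar>w i - v (r k) i\<bar> powr p))" for k
  proof -
    have d: "(\<lambda>i. w i - v (r k) i) \<in> XD D" using wX vX[of "r k"] by (simp add: XD_def)
    have "w = (\<lambda>i. 1 * v (r k) i + 1 * (w i - v (r k) i))" by auto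
    then have "gmod w \<le> 2 powr p * (gmod (v (r k)) + gmod (\<lambda>i. w i - v (r k) i))"
      using gmod_lincomb_le[OF vX d, of 1 "r k" 1] by simp
    also have "\<dots> \<le> 2 powr p * (gmod (v (r k)) + C * (\<Sum>i\<in>gd_I D. \<bar>w i - v (r k) i\<bar> powr p))"
      by (intro mult_left_mono add_left_mono C(2)[OF d]) simp
    finally show ?thesis .
  qed
  have lim: "(\<lambda>k. 2 powr p * (gmod (v (r k)) + C * (\<Sum>i\<in>gd_I D. \<bar>w i - v (r k) i\<bar> powr p)))
      \<longlonglongrightarrow> 2 powr p * (0 + C * (\<Sum>i\<in>gd_I D. 0))"
  proof (intro tendsto_intros)
    have "gnorm (v (r k)) \<le> 1 / real (Suc k)" for k
    proof -
      have "1 / real (Suc (r k)) \<le> 1 / real (Suc k)"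
        using seq_suble[OF r(1), of k] by (intro divide_left_mono) auto
      then show ?thesis using gv[of "r k"] by linarith
    qed
    then have "(\<lambda>k. gnorm (v (r k))) \<longlonglongrightarrow> 0"
      using gnorm_nonneg LIMSEQ_Suc[OF lim_1_over_n]
      by (intro tendsto_sandwich[of "\<lambda>_. 0" "\<lambda>k. gnorm (v (r k))" sequentially "\<lambda>k. 1 / real (Suc k)"]) auto
    then have "(\<lambda>k. gnorm (v (r k)) powr p) \<longlonglongrightarrow> 0 powr p"
      using p gnorm_nonneg by (intro tendsto_powr2) auto
    then show "(\<lambda>k. gmod (v (r k))) \<longlonglongrightarrow> 0" using p by (simp add: gmod_eq)
    fix i assume i: "i \<in> gd_I D"
    have "(\<lambda>k. \<bar>w i - v (r k) i\<bar>) \<longlonglongrightarrow> \<bar>w i - w i\<bar>" by (intro tendsto_intros wl i)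
    then have "(\<lambda>k. \<bar>w i - v (r k) i\<bar> powr p) \<longlonglongrightarrow> \<bar>w i - w i\<bar> powr p"
      using p by (intro tendsto_powr2) auto
    then show "(\<lambda>k. \<bar>w i - v (r k) i\<bar> powr p) \<longlonglongrightarrow> 0" using p by simp
  qed
  have "gmod w \<le> 2 powr p * (0 + C * (\<Sum>i\<in>gd_I D. 0))"
    using le by (intro LIMSEQ_le_const[OF lim]) blast
  then have "gmod w = 0" using gmod_nonneg[of w] by simp
  then have "gnorm w = 0" using p by (simp add: gnorm_eq)
  then have "w i = 0" for i using grad_eq_0[OF wX] by (simp add: gnorm_def)
  then show False using sw by (simp add: s_def)
qed

end


section \<open>From Lebesgue to Borel integrals\<close>

lemma borel_measurable_lebesgue_if_eq_off_null:
  fixes f f' :: "'b::euclidean_space \<Rightarrow> real"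
  assumes f': "f' \<in> borel_measurable borel" and Z: "Z \<in> null_sets lborel" and eq: "\<And>x. x \<notin> Z \<Longrightarrow> f x = f' x"
  shows "f \<in> borel_measurable lebesgue"
proof (rule borel_measurableI)
  fix U :: "real set" assume "open U"
  have f'l: "f' \<in> borel_measurable lebesgue" using f' by (simp add: measurable_completion)
  have "f' -` U \<in> sets lebesgue" using measurable_sets[OF f'l, of U] \<open>open U\<close> by simp
  moreover have "Z \<in> sets lebesgue" using null_sets_completionI[OF Z] by auto
  moreover have "f -` U \<inter> Z \<in> sets lebesgue"
    using null_sets_completion_subset[of "f -` U \<inter> Z" Z lborel] null_sets_completionI[OF Z] by auto
  moreover have "f -` U \<inter> space lebesgue = (f' -` U - Z) \<union> (f -` U \<inter> Z)" using eq by auto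
  ultimately show "f -` U \<inter> space lebesgue \<in> sets lebesgue"
    by (simp only: sets.Un sets.Diff)
qed

lemma lebesgue_eq_off_null:
  fixes f f' :: "'b::euclidean_space \<Rightarrow> real"
  assumes f': "f' \<in> borel_measurable borel" and Z: "Z \<in> null_sets lborel" and eq: "\<And>x. x \<notin> Z \<Longrightarrow> f x = f' x"
  shows lebesgue_integral_eq_off_null: "(\<integral>x. f x \<partial>lebesgue) = (LBINT x. f' x)"
    and lebesgue_integrable_eq_off_null: "integrable lebesgue f \<longleftrightarrow> integrable lborel f'"
proof -
  have m: "f \<in> borel_measurable lebesgue" "f' \<in> borel_measurable lebesgue"
    using borel_measurable_lebesgue_if_eq_off_null[OF f' Z eq] f' by (auto simp: measurable_completion)
  have ae: "AE x in lebesgue. f x = f' x"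
    using AE_not_in[OF null_sets_completionI[OF Z]] by eventually_elim (rule eq)
  show "(\<integral>x. f x \<partial>lebesgue) = (LBINT x. f' x)"
    using integral_cong_AE[OF m ae] integral_completion[of f' lborel] f' by simp
  show "integrable lebesgue f \<longleftrightarrow> integrable lborel f'"
    using integrable_cong_AE[OF m ae] integrable_completion[of f' lborel] f' by simp
qed

text \<open>The dictionary between the integrals in the definitions and those over
  \<open>lborel\<close>. \<open>f\<close> is constrained only on \<open>S\<close> and off
  \<open>Z\<close>, so reconstructions over Lebesgue measurable cells qualify, and so do functions
  of time that are controlled on [0, T] alone.\<close>

lemma lebesgue_on_eq_off_null:
  fixes f f' :: "'b::euclidean_space \<Rightarrow> real"
  assumes S [measurable]: "S \<in> sets borel" and f' [measurable]: "f' \<in> borel_measurable borel"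
    and Z: "Z \<in> null_sets lborel" and eq: "\<And>x. x \<in> S \<Longrightarrow> x \<notin> Z \<Longrightarrow> f x = f' x"
  shows lebesgue_on_integral_eq: "(\<integral>x. f x \<partial>lebesgue_on S) = (LBINT x. indicator S x * f' x)"
    and lebesgue_on_integrable_eq: "integrable (lebesgue_on S) f \<longleftrightarrow> integrable lborel (\<lambda>x. indicator S x * f' x)"
    and lebesgue_on_measurable: "f \<in> borel_measurable (lebesgue_on S)"
proof -
  have Sl: "S \<inter> space lebesgue \<in> sets lebesgue" by simp
  have m: "(\<lambda>x. indicator S x * f' x) \<in> borel_measurable borel" by measurable
  have eq': "indicator S x *\<^sub>R f x = indicator S x * f' x" if "x \<notin> Z" for x
    using eq[OF _ that] by (auto simp: indicator_def)
  show "(\<integral>x. f x \<partial>lebesgue_on S) = (LBINT x. indicator S x * f' x)"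
    unfolding integral_restrict_space[OF Sl] by (rule lebesgue_integral_eq_off_null[OF m Z eq'])
  show "integrable (lebesgue_on S) f \<longleftrightarrow> integrable lborel (\<lambda>x. indicator S x * f' x)"
    unfolding integrable_restrict_space[OF Sl] by (rule lebesgue_integrable_eq_off_null[OF m Z eq'])
  show "f \<in> borel_measurable (lebesgue_on S)"
    unfolding borel_measurable_restrict_space_iff[OF Sl]
    by (rule borel_measurable_lebesgue_if_eq_off_null[OF m Z eq'])
qed

section \<open>Bounds extracted from the two suprema\<close>

context stgd
begin

lemma core_borel: "i \<in> gd_I D \<Longrightarrow> borel_core (gd_cell D i) \<in> sets borel"
  by (rule borel_core_borel[OF cell_lebesgue])

lemma PiB_measurable [measurable]: "PiB D u \<in> borel_measurable borel"
  unfolding PiB_def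
  by (intro borel_measurable_sum borel_measurable_times borel_measurable_const borel_measurable_indicator)
     (simp add: core_borel)

lemma PiB_support: "x \<notin> \<Omega> \<Longrightarrow> PiB D u x = 0"
  unfolding PiB_def
  using cell_subset borel_core_subset[OF cell_lebesgue] by (intro sum.neutral) (auto simp: indicator_def)

lemma PiB_bound: "\<bar>PiB D u x\<bar> \<le> (\<Sum>i\<in>gd_I D. \<bar>u i\<bar>)"
  unfolding PiB_def by (rule order_trans[OF sum_abs]) (auto intro!: sum_mono simp: indicator_def)

lemma PiB_lincomb: "PiB D (\<lambda>i. a * u i + c * v i) x = a * PiB D u x + c * PiB D v x"
  unfolding PiB_def by (simp add: sum_distrib_left sum.distrib distrib_right mult.assoc)

lemma PiB_scale: "PiB D (\<lambda>i. a * u i) x = a * PiB D u x"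
  using PiB_lincomb[of a u 0 u x] by simp

text \<open>The exceptional set is contained in the finite union of the defects of the cells, hence
  can be chosen independently of \<open>u\<close>. This matters for space-time functions, whose
  coefficient vector changes with time.\<close>

lemma PiD_eq_PiB: "\<exists>Z\<in>null_sets lborel. \<forall>x. x \<notin> Z \<longrightarrow> (\<forall>u. PiD D u x = PiB D u x)"
proof -
  obtain Z where Z: "\<And>i. i \<in> gd_I D \<Longrightarrow> Z i \<in> null_sets lborel"
      "\<And>i. i \<in> gd_I D \<Longrightarrow> gd_cell D i - borel_core (gd_cell D i) \<subseteq> Z i"
    using borel_core_null[OF cell_lebesgue] by metis
  have "(\<Union>i\<in>gd_I D. Z i) \<in> null_sets lborel"
    using finite_I Z(1) by (intro null_sets_UN') (auto intro: countable_finite)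
  moreover have "PiD D u x = PiB D u x" if "x \<notin> (\<Union>i\<in>gd_I D. Z i)" for x u
    unfolding PiD_def PiB_def
  proof (rule sum.cong[OF refl])
    fix i assume i: "i \<in> gd_I D"
    have "x \<in> gd_cell D i \<longleftrightarrow> x \<in> borel_core (gd_cell D i)"
      using that i Z(2)[OF i] borel_core_subset[OF cell_lebesgue[OF i]] by auto
    then show "u i * indicator (gd_cell D i) x = u i * indicator (borel_core (gd_cell D i)) x"
      by (simp add: indicator_def)
  qed
  ultimately show ?thesis by blast
qed

lemma PiB_product_integrable: "integrable lborel (\<lambda>x. PiB D u x * PiB D v x)"
proof (rule integrable_bounded_support[OF _ bounded_\<Omega>, of _ "(\<Sum>i\<in>gd_I D. \<bar>u i\<bar>) * (\<Sum>i\<in>gd_I D. \<bar>v i\<bar>)"])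
  show "\<bar>PiB D u x * PiB D v x\<bar> \<le> (\<Sum>i\<in>gd_I D. \<bar>u i\<bar>) * (\<Sum>i\<in>gd_I D. \<bar>v i\<bar>)" for x
    unfolding abs_mult by (intro mult_mono PiB_bound) (auto simp: sum_nonneg)
qed (auto simp: PiB_support)

lemma pairing_PiD_eq:
  "(\<integral>x. PiD D u x * PiD D v x \<partial>lebesgue_on \<Omega>) = (LBINT x. PiB D u x * PiB D v x)"
proof -
  obtain Z where Z: "Z \<in> null_sets lborel" "\<And>x u. x \<notin> Z \<Longrightarrow> PiD D u x = PiB D u x"
    using PiD_eq_PiB by blast
  have "(\<integral>x. PiD D u x * PiD D v x \<partial>lebesgue_on \<Omega>) = (LBINT x. indicator \<Omega> x * (PiB D u x * PiB D v x))"
    by (rule lebesgue_on_integral_eq[OF \<Omega>_borel _ Z(1)]) (use Z(2) in auto)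
  also have "\<dots> = (LBINT x. PiB D u x * PiB D v x)"
    by (rule Bochner_Integration.integral_cong) (auto simp: indicator_def PiB_support)
  finally show ?thesis .
qed

text \<open>By homogeneity it suffices to test with z normalised, and both signs of the normalised
  vector are allowed, which gives the modulus. The tested set is bounded above thanks to
  \<open>coeffs_le_gnorm\<close>. If \<open>gnorm z = 0\<close>, then z = 0 and both sides
  vanish.\<close>

lemma dualnorm_pairing_le:
  assumes z: "z \<in> XD D"
  shows "\<bar>LBINT x. PiB D w x * PiB D z x\<bar> \<le> dualnorm \<Omega> p D w * gnorm z"
proof -
  obtain c where c: "c \<ge> 0" "\<And>u. u \<in> XD D \<Longrightarrow> (\<Sum>i\<in>gd_I D. \<bar>u i\<bar>) \<le> c * gnorm u"
    using coeffs_le_gnorm by blast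
  define A where "A = {(LBINT x. PiB D w x * PiB D z x) | z. z \<in> XD D \<and> gnorm z = 1}"
  have dn: "dualnorm \<Omega> p D w = Sup A"
    unfolding dualnorm_def A_def gnorm_def pairing_PiD_eq ..
  have bdd: "bdd_above A"
    unfolding bdd_above_def
  proof (intro exI ballI)
    fix y assume "y \<in> A"
    then obtain z where z: "z \<in> XD D" "gnorm z = 1" "y = (LBINT x. PiB D w x * PiB D z x)"
      unfolding A_def by blast
    have le: "\<bar>PiB D w x * PiB D z x\<bar> \<le> indicator \<Omega> x * ((\<Sum>i\<in>gd_I D. \<bar>w i\<bar>) * c)" for x
    proof (cases "x \<in> \<Omega>")
      case True
      have "\<bar>PiB D z x\<bar> \<le> c" using PiB_bound[of z x] c(2)[OF z(1)] z(2) by simp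
      then show ?thesis unfolding abs_mult using True PiB_bound[of w x]
        by (auto intro!: mult_mono simp: sum_nonneg)
    qed (simp add: PiB_support)
    have "y \<le> (LBINT x. indicator \<Omega> x * ((\<Sum>i\<in>gd_I D. \<bar>w i\<bar>) * c))"
      unfolding z(3)
    proof (rule integral_mono[OF PiB_product_integrable])
      show "integrable lborel (\<lambda>x. indicator \<Omega> x * ((\<Sum>i\<in>gd_I D. \<bar>w i\<bar>) * c))"
        by (rule integrable_bounded_support[OF _ bounded_\<Omega>, of _ "\<bar>(\<Sum>i\<in>gd_I D. \<bar>w i\<bar>) * c\<bar>"]) auto
      show "PiB D w x * PiB D z x \<le> indicator \<Omega> x * ((\<Sum>i\<in>gd_I D. \<bar>w i\<bar>) * c)" for x
        using le[of x] by linarith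
    qed
    then show "y \<le> (LBINT x. indicator \<Omega> x * ((\<Sum>i\<in>gd_I D. \<bar>w i\<bar>) * c))" .
  qed
  show ?thesis
  proof (cases "gnorm z = 0")
    case True
    then have "PiB D z x = 0" for x using grad_eq_0[OF z] by (simp add: PiB_def gnorm_def)
    then show ?thesis using True by simp
  next
    case False
    then have g: "gnorm z > 0" using gnorm_nonneg[of z] by simp
    have "(a / gnorm z) * (LBINT x. PiB D w x * PiB D z x) \<le> Sup A" if "\<bar>a\<bar> = 1" for a
    proof -
      have "gnorm (\<lambda>i. (a / gnorm z) * z i) = 1" unfolding gnorm_scale[OF z] using g that by simp
      then have "(LBINT x. PiB D w x * PiB D (\<lambda>i. (a / gnorm z) * z i) x) \<in> A"
        unfolding A_def using XD_scale[OF z] by blast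
      moreover have "(LBINT x. PiB D w x * PiB D (\<lambda>i. (a / gnorm z) * z i) x)
          = (LBINT x. (a / gnorm z) * (PiB D w x * PiB D z x))"
        unfolding PiB_scale by (simp add: ac_simps)
      ultimately show ?thesis using cSup_upper[OF _ bdd] by simp
    qed
    from this[of 1] this[of "-1"] have "\<bar>LBINT x. PiB D w x * PiB D z x\<bar> / gnorm z \<le> Sup A"
      by (simp add: abs_if)
    then show ?thesis unfolding dn using g by (simp add: field_simps)
  qed
qed

text \<open>For fixed \<xi> the quotients are bounded: the difference is at most 2 c gnorm v and
  lives in a ball containing \<Omega> and its translate. So the supremum is a genuine upper bound.
  Comparing the norms over \<open>lebesgue\<close> and \<open>lborel\<close> discards a null set
  together with its translate.\<close>

lemma T_comp_bound:
  assumes v: "v \<in> XD D"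
  shows "lpnorm lborel p (\<lambda>x. PiB D v (x + \<xi>) - PiB D v x) \<le> T_comp \<Omega> p D \<xi> * gnorm v"
proof (cases "v = (\<lambda>i. 0)")
  case True
  then show ?thesis using p gmod_lincomb_le[OF v v, of 0 0] gmod_nonneg[of v]
    by (simp add: PiB_def lpnorm_def gnorm_eq)
next
  case False
  obtain c where c: "c \<ge> 0" "\<And>u. u \<in> XD D \<Longrightarrow> (\<Sum>i\<in>gd_I D. \<bar>u i\<bar>) \<le> c * gnorm u"
    using coeffs_le_gnorm by blast
  obtain Z where Z: "Z \<in> null_sets lborel" "\<And>x u. x \<notin> Z \<Longrightarrow> PiD D u x = PiB D u x"
    using PiD_eq_PiB by blast
  define Z' where "Z' = (\<lambda>x. x + \<xi>) -` Z"
  have Z': "Z' \<in> null_sets lborel"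
    using null_sets_translation[OF Z(1), of "- \<xi>"] by (simp add: Z'_def vimage_def)
  have eq: "lpnorm lebesgue p (\<lambda>x. PiD D v (x + \<xi>) - PiD D v x) = lpnorm lborel p (\<lambda>x. PiB D v (x + \<xi>) - PiB D v x)" for v
    unfolding lpnorm_def
    by (subst lebesgue_integral_eq_off_null[of "\<lambda>x. norm (PiB D v (x + \<xi>) - PiB D v x) powr p" "Z \<union> Z'"])
       (use Z Z' in \<open>auto simp: Z'_def\<close>)
  define A where "A = {lpnorm lborel p (\<lambda>x. PiB D v (x + \<xi>) - PiB D v x) / gnorm v | v. v \<in> XD D \<and> v \<noteq> (\<lambda>i. 0)}"
  have TA: "T_comp \<Omega> p D \<xi> = Sup A" unfolding T_comp_def A_def gnorm_def eq ..
  have gpos: "gnorm v > 0" if "v \<in> XD D" "v \<noteq> (\<lambda>i. 0)" for v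
    using grad_eq_0[OF that(1)] that(2) gnorm_nonneg[of v] unfolding gnorm_def by (metis ext less_eq_real_def)
  obtain R where R: "\<And>x. x \<in> \<Omega> \<Longrightarrow> norm x \<le> R" using bounded_\<Omega> unfolding bounded_iff by blast
  define S where "S = cball (0::'a) (R + norm \<xi>)"
  have bdd: "bdd_above A"
    unfolding bdd_above_def
  proof (intro exI ballI)
    fix y assume "y \<in> A"
    then obtain v where v: "v \<in> XD D" "v \<noteq> (\<lambda>i. 0)" "y = lpnorm lborel p (\<lambda>x. PiB D v (x + \<xi>) - PiB D v x) / gnorm v"
      unfolding A_def by blast
    define s where "s = 2 * (c * gnorm v)"
    have s0: "s \<ge> 0" using c(1) gnorm_nonneg[of v] by (simp add: s_def)
    have ds: "\<bar>PiB D v (x + \<xi>) - PiB D v x\<bar> \<le> s" for x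
      using PiB_bound[of v x] PiB_bound[of v "x + \<xi>"] c(2)[OF v(1)] unfolding s_def by linarith
    have d0: "PiB D v (x + \<xi>) - PiB D v x = 0" if "x \<notin> S" for x
    proof -
      have "x \<notin> \<Omega>" using that R[of x] norm_ge_zero[of \<xi>] by (force simp: S_def)
      moreover have "x + \<xi> \<notin> \<Omega>" using that R[of "x + \<xi>"] norm_triangle_ineq4[of "x + \<xi>" \<xi>] by (force simp: S_def)
      ultimately show ?thesis by (simp add: PiB_support)
    qed
    have le: "norm (PiB D v (x + \<xi>) - PiB D v x) powr p \<le> indicator S x * s powr p" for x
      using ds[of x] d0[of x] p by (cases "x \<in> S") (auto intro!: powr_mono2)
    have si: "integrable lborel (\<lambda>x. indicator S x * s powr p)"
    proof (rule integrable_bounded_support[of _ S "s powr p"])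
      have "S \<in> sets borel" by (simp add: S_def)
      then show "(\<lambda>x. indicator S x * s powr p) \<in> borel_measurable borel" by measurable
    qed (auto simp: S_def)
    have "(LBINT x. norm (PiB D v (x + \<xi>) - PiB D v x) powr p) \<le> (LBINT x. indicator S x * s powr p)"
      by (rule integral_mono'[OF si le]) simp
    also have "\<dots> = measure lborel S * s powr p" by simp
    finally have "lpnorm lborel p (\<lambda>x. PiB D v (x + \<xi>) - PiB D v x) \<le> (measure lborel S * s powr p) powr (1 / p)"
      unfolding lpnorm_def using p by (intro powr_mono2) (auto intro: integral_nonneg)
    also have "\<dots> = measure lborel S powr (1 / p) * s"
      using p s0 by (simp add: powr_mult powr_powr)
    finally have "y \<le> measure lborel S powr (1 / p) * s / gnorm v"
      unfolding v(3) using gpos[OF v(1,2)] by (intro divide_right_mono) auto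
    also have "\<dots> = measure lborel S powr (1 / p) * (2 * c)"
      using gpos[OF v(1,2)] by (simp add: s_def)
    finally show "y \<le> measure lborel S powr (1 / p) * (2 * c)" .
  qed
  have "lpnorm lborel p (\<lambda>x. PiB D v (x + \<xi>) - PiB D v x) / gnorm v \<in> A"
    unfolding A_def using v False by blast
  then have "lpnorm lborel p (\<lambda>x. PiB D v (x + \<xi>) - PiB D v x) / gnorm v \<le> Sup A"
    by (rule cSup_upper[OF _ bdd])
  then show ?thesis unfolding TA using gpos[OF v False] by (simp add: field_simps)
qed

lemma translate_L2:
  assumes v: "v \<in> XD D" and T: "T_comp \<Omega> p D \<xi> \<le> \<epsilon>" and \<epsilon>: "\<epsilon> > 0"
    and S: "bounded S" "S \<in> sets borel" "\<Omega> \<subseteq> S" "\<And>x. x + \<xi> \<in> \<Omega> \<Longrightarrow> x \<in> S"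
  shows "(LBINT x. (PiB D v (x + \<xi>) - PiB D v x)\<^sup>2) \<le> (\<epsilon> * gnorm v)\<^sup>2 * (measure lborel S + 1)"
proof (cases "gnorm v = 0")
  \<comment> \<open>\<open>L2_le_Lp\<close> asks for a positive bound, here \<epsilon> gnorm v, so
    the degenerate vector is handled separately.\<close>
  case True
  then have "PiB D v x = 0" for x using grad_eq_0[OF v] by (simp add: PiB_def gnorm_def)
  then show ?thesis by simp
next
  case False
  then have g: "gnorm v > 0" using gnorm_nonneg[of v] by simp
  show ?thesis
  proof (rule L2_le_Lp[OF _ S(1,2) _ _ p])
    show "\<bar>PiB D v (x + \<xi>) - PiB D v x\<bar> \<le> 2 * (\<Sum>i\<in>gd_I D. \<bar>v i\<bar>)" for x
      using PiB_bound[of v x] PiB_bound[of v "x + \<xi>"] by linarith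
    show "PiB D v (x + \<xi>) - PiB D v x = 0" if "x \<notin> S" for x
    proof -
      have "x \<notin> \<Omega>" "x + \<xi> \<notin> \<Omega>" using that S by blast+
      then show ?thesis by (simp add: PiB_support)
    qed
    show "lpnorm lborel p (\<lambda>x. PiB D v (x + \<xi>) - PiB D v x) \<le> \<epsilon> * gnorm v"
      using T_comp_bound[OF v, of \<xi>] mult_right_mono[OF T less_imp_le[OF g]] by linarith
    show "(\<lambda>x. PiB D v (x + \<xi>) - PiB D v x) \<in> borel_measurable borel" by measurable
  qed (use \<epsilon> g in simp)
qed

end


text \<open>Agrees with \<open>kidx\<close> on \<open>[0, T]\<close>, but is Borel measurable and bounded on the whole line.\<close>

definition kid :: "'a gdisc \<Rightarrow> real \<Rightarrow> nat" where
  "kid D t = (\<Sum>n<gd_N D. if gd_t D n < t then 1 else 0)"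

lemma kid_measurable [measurable]: "kid D \<in> measurable borel (count_space UNIV)"
  unfolding kid_def by measurable

lemma kid_le: "kid D t \<le> gd_N D"
  unfolding kid_def using sum_mono[of "{..<gd_N D}" "\<lambda>n. if gd_t D n < t then 1 else 0" "\<lambda>n. 1::nat"] by simp

lemma kid_mono: "s \<le> t \<Longrightarrow> kid D s \<le> kid D t"
  unfolding kid_def by (rule sum_mono) auto

lemma memLp_continuous:
  fixes f :: "'a::euclidean_space \<Rightarrow> 'b::euclidean_space"
  assumes f: "continuous_on UNIV f" and \<Omega>: "open \<Omega>" "bounded \<Omega>" and q: "q \<ge> 0"
  shows "memLp (lebesgue_on \<Omega>) q f"
proof -
  have fm [measurable]: "f \<in> borel_measurable borel" using f by (rule borel_measurable_continuous_onI)
  have \<Omega>m [measurable]: "\<Omega> \<in> sets borel" using \<Omega> by simp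
  have "bounded (f ` closure \<Omega>)"
    using \<Omega> by (intro compact_imp_bounded compact_continuous_image continuous_on_subset[OF f])
      (auto simp: compact_closure)
  then obtain M where M: "\<And>x. x \<in> \<Omega> \<Longrightarrow> norm (f x) \<le> M"
    using closure_subset[of \<Omega>] unfolding bounded_iff by auto
  have "integrable lborel (\<lambda>x. indicator \<Omega> x * norm (f x) powr q)"
    by (rule integrable_bounded_support[OF _ \<Omega>(2), of _ "M powr q"]) (use M q in \<open>auto intro!: powr_mono2\<close>)
  then have "integrable (lebesgue_on \<Omega>) (\<lambda>x. norm (f x) powr q)"
    by (subst lebesgue_on_integrable_eq[of _ "\<lambda>x. norm (f x) powr q" "{}"]) auto
  moreover have "f \<in> borel_measurable (lebesgue_on \<Omega>)"
    using fm by (intro measurable_restrict_space1 measurable_completion) simp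
  ultimately show ?thesis by (simp add: memLp_def)
qed

text \<open>Membership in the closure is witnessed by the constant sequence.\<close>

lemma W1p0_smooth:
  assumes a: "smooth_expr a" and s: "compact (closure {x. a x \<noteq> 0})" "closure {x. a x \<noteq> 0} \<subseteq> \<Omega>"
    and \<Omega>: "open \<Omega>" "bounded \<Omega>" and p: "p > 0"
  shows "W1p0 \<Omega> p a (grad_fun a)"
  unfolding W1p0_def
proof (intro conjI exI allI)
  show "memLp (lebesgue_on \<Omega>) p a" using p by (intro memLp_continuous smooth_expr_continuous_on a \<Omega>) auto
  show "memLp (lebesgue_on \<Omega>) p (grad_fun a)"
    using p by (intro memLp_continuous smooth_expr_continuous_grad a \<Omega>) auto
  show "Cc_inf \<Omega> ((\<lambda>k. a) k)" for k :: nat using s smooth_expr_Cinf[OF a] by (simp add: Cc_inf_def)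
qed (use p in \<open>simp_all add: lpnorm_def\<close>)

section \<open>Time levels and variation in time\<close>

context stgd
begin

lemma t_mono: "m \<le> n \<Longrightarrow> n \<le> gd_N D \<Longrightarrow> gd_t D m \<le> gd_t D n"
proof (induction n rule: dec_induct)
  case (step n)
  then show ?case using t_less[of n] by simp
qed simp

text \<open>\<open>kid\<close> counts the levels strictly below t. By monotonicity these form an
  initial segment, whose length is the first index at which the level reaches t.\<close>

lemma kidx_eq_kid:
  assumes "0 \<le> t" "t \<le> T" shows "kidx D t = kid D t"
    and t_less_iff: "n \<le> gd_N D \<Longrightarrow> gd_t D n < t \<longleftrightarrow> n < kid D t"
proof -
  have ex: "t \<le> gd_t D (gd_N D)" using assms t_N by simp
  have 1: "t \<le> gd_t D (kidx D t)" unfolding kidx_def by (rule LeastI[of "\<lambda>n. t \<le> gd_t D n", OF ex])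
  have 2: "kidx D t \<le> gd_N D" unfolding kidx_def by (rule Least_le[of "\<lambda>n. t \<le> gd_t D n", OF ex])
  have iff: "gd_t D n < t \<longleftrightarrow> n < kidx D t" if "n \<le> gd_N D" for n
  proof
    assume "gd_t D n < t"
    then show "n < kidx D t" using 1 t_mono[OF _ that, of "kidx D t"] by (meson le_less_trans not_le order_trans)
  next
    assume "n < kidx D t"
    then show "gd_t D n < t" unfolding kidx_def using not_less_Least[of n "\<lambda>n. t \<le> gd_t D n"] by (simp add: not_le)
  qed
  have "kid D t = (\<Sum>n<gd_N D. if n < kidx D t then 1 else 0)"
    unfolding kid_def using iff by (intro sum.cong) auto
  also have "\<dots> = card ({..<gd_N D} \<inter> {n. n < kidx D t})" by (simp add: sum.If_cases)
  also have "{..<gd_N D} \<inter> {n. n < kidx D t} = {..<kidx D t}" using 2 by auto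
  finally show eq: "kidx D t = kid D t" by simp
  show "n \<le> gd_N D \<Longrightarrow> gd_t D n < t \<longleftrightarrow> n < kid D t" using iff eq by simp
qed

text \<open>Converts the assumed time integral of the dual semi-norm into the finite sum over time
  steps that bounds the variation of pairings.\<close>

lemma step_integral:
  fixes F :: "nat \<Rightarrow> real"
  shows "(\<integral>t. F (kidx D t) \<partial>lebesgue_on {0..T}) = (\<Sum>n<gd_N D. (gd_t D (Suc n) - gd_t D n) * F (Suc n))"
proof -
  have [measurable]: "(\<lambda>t. F (kid D t)) \<in> borel_measurable borel" by measurable
  have "(\<integral>t. F (kidx D t) \<partial>lebesgue_on {0..T}) = (LBINT t. indicator {0..T} t * F (kid D t))"
    by (rule lebesgue_on_integral_eq[of _ _ "{}"]) (auto simp: kidx_eq_kid)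
  also have "\<dots> = (LBINT t. (\<Sum>n<gd_N D. F (Suc n) * indicator {gd_t D n<..gd_t D (Suc n)} t))"
  proof (rule integral_cong_AE)
    \<comment> \<open>At t = 0 the index is 0, whereas no half-open cell contains 0; this one point
      is discarded.\<close>
    have "AE t in lborel. t \<noteq> (0::real)" by (rule AE_lborel_singleton)
    then show "AE t in lborel. indicator {0..T} t * F (kid D t)
        = (\<Sum>n<gd_N D. F (Suc n) * indicator {gd_t D n<..gd_t D (Suc n)} t)"
    proof eventually_elim
      case (elim t)
      show ?case
      proof (cases "t \<in> {0..T}")
        case True
        then have t: "0 \<le> t" "t \<le> T" "0 < t" using elim by auto
        have k: "0 < kid D t" using t_less_iff[OF t(1,2), of 0] t(3) t_0 by simp
        have ind: "indicator {gd_t D n<..gd_t D (Suc n)} t = (if n = kid D t - 1 then 1 else 0 :: real)" if "n < gd_N D" for n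
        proof -
          have "t \<in> {gd_t D n<..gd_t D (Suc n)} \<longleftrightarrow> n < kid D t \<and> \<not> Suc n < kid D t"
            using t_less_iff[OF t(1,2), of n] t_less_iff[OF t(1,2), of "Suc n"] that by (auto simp: not_less)
          also have "\<dots> \<longleftrightarrow> n = kid D t - 1" using k by auto
          finally show ?thesis by (simp add: indicator_def)
        qed
        have "(\<Sum>n<gd_N D. F (Suc n) * indicator {gd_t D n<..gd_t D (Suc n)} t)
            = (\<Sum>n<gd_N D. if n = kid D t - 1 then F (Suc n) else 0)"
          by (intro sum.cong) (auto simp: ind)
        also have "\<dots> = F (kid D t)" using k kid_le[of D t] by (subst sum.delta) auto
        finally show ?thesis using True by simp
      next
        case False
        have "t \<notin> {gd_t D n<..gd_t D (Suc n)}" if "n < gd_N D" for n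
          using False t_mono[of 0 n] t_mono[of "Suc n" "gd_N D"] that t_0 t_N by auto
        then show ?thesis using False by (simp add: sum.neutral)
      qed
    qed
  qed measurable
  also have "\<dots> = (\<Sum>n<gd_N D. LBINT t. F (Suc n) * indicator {gd_t D n<..gd_t D (Suc n)} t)"
  proof (rule Bochner_Integration.integral_sum)
    show "integrable lborel (\<lambda>t. F (Suc n) * indicator {gd_t D n<..gd_t D (Suc n)} t)" for n
      by (rule integrable_bounded_support[of _ "{gd_t D n<..gd_t D (Suc n)}" "\<bar>F (Suc n)\<bar>"]) auto
  qed
  also have "\<dots> = (\<Sum>n<gd_N D. (gd_t D (Suc n) - gd_t D n) * F (Suc n))"
    using t_less by (intro sum.cong) (auto simp: mult.commute less_imp_le)
  finally show ?thesis .
qed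

text \<open>Between consecutive levels the pairing changes by the time step times the pairing of the
  difference quotient with w, which is at most the dual semi-norm times \<open>gnorm w\<close>.
  Summation makes \<open>\<mu>\<close> a running integral of this bound over completed steps. The
  index j - 1 in \<open>F\<close> mirrors \<open>deltaD\<close>.\<close>

lemma pairing_variation:
  fixes v :: "nat \<Rightarrow> nat \<Rightarrow> real"
  assumes w: "w \<in> XD D" and st: "s \<le> t"
  defines "F \<equiv> \<lambda>j. dualnorm \<Omega> p D (\<lambda>i. (v j i - v (j - 1) i) / (gd_t D j - gd_t D (j - 1)))"
  defines "\<mu> \<equiv> \<lambda>t. \<Sum>k<kid D t. (gd_t D (Suc k) - gd_t D k) * F (Suc k) * gnorm w"
  defines "f \<equiv> \<lambda>t. LBINT x. PiB D (v (kid D t)) x * PiB D w x"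
  shows "\<bar>f t - f s\<bar> \<le> \<mu> t - \<mu> s"
proof -
  define h where "h k = (LBINT x. PiB D (v k) x * PiB D w x)" for k
  define J where "J k = (gd_t D (Suc k) - gd_t D k) * F (Suc k) * gnorm w" for k
  have one: "\<bar>h (Suc k) - h k\<bar> \<le> J k" if k: "k < gd_N D" for k
  proof -
    define d where "d = gd_t D (Suc k) - gd_t D k"
    have d: "d > 0" using t_less[OF k] by (simp add: d_def)
    define u where "u i = (v (Suc k) i - v k i) / d" for i
    have "v (Suc k) = (\<lambda>i. d * u i + 1 * v k i)" using d by (auto simp: u_def)
    then have "PiB D (v (Suc k)) x * PiB D w x = d * (PiB D u x * PiB D w x) + PiB D (v k) x * PiB D w x" for x
      using PiB_lincomb[of d u 1 "v k" x] by (simp add: algebra_simps)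
    then have "h (Suc k) = d * (LBINT x. PiB D u x * PiB D w x) + h k"
      unfolding h_def by (simp add: PiB_product_integrable)
    then have "\<bar>h (Suc k) - h k\<bar> = d * \<bar>LBINT x. PiB D u x * PiB D w x\<bar>" using d by (simp add: abs_mult)
    also have "\<dots> \<le> d * (dualnorm \<Omega> p D u * gnorm w)"
      using d by (intro mult_left_mono dualnorm_pairing_le w) auto
    also have "dualnorm \<Omega> p D u = F (Suc k)" unfolding F_def u_def[abs_def] d_def by simp
    finally show ?thesis by (simp add: J_def d_def mult.assoc)
  qed
  have "\<bar>h n - h m\<bar> \<le> (\<Sum>k<n. J k) - (\<Sum>k<m. J k)" if "m \<le> n" "n \<le> gd_N D" for m n
    using that
  proof (induction n rule: dec_induct)
    case (step n)
    then show ?case using one[of n] by simp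
  qed simp
  from this[OF kid_mono[OF st] kid_le] show ?thesis
    unfolding f_def \<mu>_def h_def J_def .
qed

text \<open>\<open>S_hat\<close> is an infimum, hence the strict bound \<open>l\<close>. Of its two
  summands, the reconstruction error gives the L^2 estimate through \<open>L2_le_Lp\<close>, while
  the gradient error is used merely to bound the gradient of w in terms of l and G.\<close>

lemma consistent_interpolant:
  assumes a: "continuous_on UNIV a" and G: "memLp (lebesgue_on \<Omega>) p G" and l: "S_hat \<Omega> p D a G < l" "l > 0"
  obtains w where "w \<in> XD D"
    "(LBINT x. indicator \<Omega> x * (PiB D w x - a x)\<^sup>2) \<le> l\<^sup>2 * (measure lborel \<Omega> + 1)"
    "gmod w \<le> 2 powr p * (l powr p + (\<integral>x. norm (G x) powr p \<partial>lebesgue_on \<Omega>))"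
proof -
  have am [measurable]: "a \<in> borel_measurable borel" using a by (rule borel_measurable_continuous_onI)
  have mp: "max p 2 = p" using p by simp
  have "(\<lambda>i. 0) \<in> XD D" by (simp add: XD_def)
  then obtain w where w: "w \<in> XD D"
     and wl: "lpnorm (lebesgue_on \<Omega>) p (\<lambda>x. PiD D w x - a x) + lpnorm (lebesgue_on \<Omega>) p (\<lambda>x. gd_grad D w x - G x) < l"
    using cInf_lessD[OF _ l(1)[unfolded S_hat_def mp]] by blast
  have nn: "0 \<le> lpnorm (lebesgue_on \<Omega>) p (\<lambda>x. PiD D w x - a x)" "0 \<le> lpnorm (lebesgue_on \<Omega>) p (\<lambda>x. gd_grad D w x - G x)"
    by (simp_all add: lpnorm_def)
  obtain Z where Z: "Z \<in> null_sets lborel" "\<And>x u. x \<notin> Z \<Longrightarrow> PiD D u x = PiB D u x"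
    using PiD_eq_PiB by blast
  have "bounded (a ` closure \<Omega>)"
    using bounded_\<Omega> by (intro compact_imp_bounded compact_continuous_image continuous_on_subset[OF a])
      (auto simp: compact_closure)
  then obtain M where M: "\<And>x. x \<in> \<Omega> \<Longrightarrow> \<bar>a x\<bar> \<le> M"
    using closure_subset[of \<Omega>] unfolding bounded_iff by auto
  define g where "g x = indicator \<Omega> x * (PiB D w x - a x)" for x
  have gm [measurable]: "g \<in> borel_measurable borel" unfolding g_def by measurable
  have gB: "\<bar>g x\<bar> \<le> max 0 ((\<Sum>i\<in>gd_I D. \<bar>w i\<bar>) + M)" for x
    using PiB_bound[of w x] M[of x] by (cases "x \<in> \<Omega>") (auto simp: g_def)
  have "(\<integral>x. norm (PiD D w x - a x) powr p \<partial>lebesgue_on \<Omega>) = (LBINT x. indicator \<Omega> x * norm (PiB D w x - a x) powr p)"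
    by (rule lebesgue_on_integral_eq[OF \<Omega>_borel _ Z(1)]) (use Z(2) in auto)
  also have "\<dots> = (LBINT x. norm (g x) powr p)"
    by (rule Bochner_Integration.integral_cong) (use p in \<open>auto simp: g_def indicator_def\<close>)
  finally have "lpnorm lborel p g = lpnorm (lebesgue_on \<Omega>) p (\<lambda>x. PiD D w x - a x)"
    by (simp only: lpnorm_def)
  then have gl: "lpnorm lborel p g \<le> l" using wl nn by linarith
  have "(LBINT x. (g x)\<^sup>2) \<le> l\<^sup>2 * (measure lborel \<Omega> + 1)"
    by (rule L2_le_Lp[OF gm bounded_\<Omega> \<Omega>_borel gB _ p l(2) gl]) (simp add: g_def)
  moreover have "(LBINT x. (g x)\<^sup>2) = (LBINT x. indicator \<Omega> x * (PiB D w x - a x)\<^sup>2)"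
    by (rule Bochner_Integration.integral_cong) (auto simp: g_def indicator_def)
  moreover have "gmod w \<le> 2 powr p * (l powr p + (\<integral>x. norm (G x) powr p \<partial>lebesgue_on \<Omega>))"
  proof -
    have wm [measurable]: "gd_grad D w \<in> borel_measurable (lebesgue_on \<Omega>)"
      and wi: "integrable (lebesgue_on \<Omega>) (\<lambda>x. norm (gd_grad D w x) powr p)"
      using grad_Lp[OF w] by (auto simp: memLp_def)
    have Gm [measurable]: "G \<in> borel_measurable (lebesgue_on \<Omega>)"
      and Gi: "integrable (lebesgue_on \<Omega>) (\<lambda>x. norm (G x) powr p)"
      using G by (auto simp: memLp_def)
    have di: "integrable (lebesgue_on \<Omega>) (\<lambda>x. norm (gd_grad D w x - G x) powr p)"
    proof (rule Bochner_Integration.integrable_bound)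
      show "integrable (lebesgue_on \<Omega>) (\<lambda>x. 2 powr p * (norm (gd_grad D w x) powr p + norm (- G x) powr p))"
        using wi Gi by simp
      show "AE x in lebesgue_on \<Omega>. norm (norm (gd_grad D w x - G x) powr p)
          \<le> norm (2 powr p * (norm (gd_grad D w x) powr p + norm (- G x) powr p))"
        using norm_add_powr_le[of p _ "- G _"] p by (intro AE_I2) (simp add: add_nonneg_nonneg)
    qed measurable
    have A: "(\<integral>x. norm (gd_grad D w x - G x) powr p \<partial>lebesgue_on \<Omega>) \<le> l powr p"
    proof -
      define A where "A = (\<integral>x. norm (gd_grad D w x - G x) powr p \<partial>lebesgue_on \<Omega>)"
      have "A \<ge> 0" unfolding A_def by (simp add: integral_nonneg)
      moreover have "(A powr (1 / p)) powr p \<le> l powr p"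
      proof (rule powr_mono2)
        show "A powr (1 / p) \<le> l" using wl nn unfolding A_def lpnorm_def by linarith
      qed (use p in auto)
      ultimately show ?thesis using p by (simp add: powr_powr A_def)
    qed
    have "gmod w \<le> (\<integral>x. 2 powr p * (norm (gd_grad D w x - G x) powr p + norm (G x) powr p) \<partial>lebesgue_on \<Omega>)"
      unfolding gmod_def
    proof (rule integral_mono[OF wi])
      show "integrable (lebesgue_on \<Omega>) (\<lambda>x. 2 powr p * (norm (gd_grad D w x - G x) powr p + norm (G x) powr p))"
        using di Gi by simp
      show "norm (gd_grad D w x) powr p \<le> 2 powr p * (norm (gd_grad D w x - G x) powr p + norm (G x) powr p)" for x
        using norm_add_powr_le[of p "gd_grad D w x - G x" "G x"] p by simp
    qed
    also have "\<dots> = 2 powr p * ((\<integral>x. norm (gd_grad D w x - G x) powr p \<partial>lebesgue_on \<Omega>) + (\<integral>x. norm (G x) powr p \<partial>lebesgue_on \<Omega>))"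
      using di Gi by simp
    also have "\<dots> \<le> 2 powr p * (l powr p + (\<integral>x. norm (G x) powr p \<partial>lebesgue_on \<Omega>))"
      using A by (intro mult_left_mono add_right_mono) auto
    finally show ?thesis .
  qed
  ultimately show ?thesis using that w by simp
qed

end


section \<open>Space-time reconstructions as Borel functions\<close>

definition PiBT :: "'a::euclidean_space gdisc \<Rightarrow> real \<Rightarrow> (nat \<Rightarrow> nat \<Rightarrow> real) \<Rightarrow> 'a \<times> real \<Rightarrow> real" where
  "PiBT D T v w = indicator {0..T} (snd w) * PiB D (v (kid D (snd w))) (fst w)"

context stgd
begin

lemma PiBT_measurable [measurable]: "PiBT D T v \<in> borel_measurable borel"
proof -
  have [measurable]: "(\<lambda>w::'a \<times> real. indicator (borel_core (gd_cell D i)) (fst w) :: real) \<in> borel_measurable borel"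
    if "i \<in> gd_I D" for i
    using measurable_compose[OF borel_measurable_fst_snd(1) borel_measurable_indicator[OF core_borel[OF that]]] .
  have [measurable]: "(\<lambda>w::'a \<times> real. v (kid D (snd w)) i) \<in> borel_measurable borel" for i by measurable
  have "(\<lambda>w. PiB D (v (kid D (snd w))) (fst w)) \<in> borel_measurable borel"
    unfolding PiB_def by (intro borel_measurable_sum borel_measurable_times) measurable
  then show ?thesis unfolding PiBT_def by measurable
qed

lemma PiBT_support: "w \<notin> \<Omega> \<times> {0..T} \<Longrightarrow> PiBT D T v w = 0"
  by (auto simp: PiBT_def mem_Times_iff PiB_support)

lemma PiBT_bounded: "\<exists>B. \<forall>w. \<bar>PiBT D T v w\<bar> \<le> B"
proof (intro exI allI)
  fix w :: "'a \<times> real"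
  have "\<bar>PiBT D T v w\<bar> \<le> \<bar>PiB D (v (kid D (snd w))) (fst w)\<bar>" by (simp add: PiBT_def indicator_def)
  also have "\<dots> \<le> (\<Sum>i\<in>gd_I D. \<bar>v (kid D (snd w)) i\<bar>)" by (rule PiB_bound)
  also have "\<dots> \<le> (\<Sum>k\<le>gd_N D. \<Sum>i\<in>gd_I D. \<bar>v k i\<bar>)"
    using kid_le[of D "snd w"] by (intro member_le_sum[of _ _ "\<lambda>k. \<Sum>i\<in>gd_I D. \<bar>v k i\<bar>"]) (auto intro: sum_nonneg)
  finally show "\<bar>PiBT D T v w\<bar> \<le> (\<Sum>k\<le>gd_N D. \<Sum>i\<in>gd_I D. \<bar>v k i\<bar>)" .
qed

text \<open>\<open>PiBT\<close> is cut off in time because \<open>kidx\<close> is uncontrolled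
  beyond T. The same spatial null set serves every t and every coefficient vector, so its product
  with the time axis is null and independent of \<open>v\<close>.\<close>

lemma PiST_eq_PiBT:
  "\<exists>Z\<in>null_sets lborel. \<forall>w. w \<in> \<Omega> \<times> {0..T} \<longrightarrow> w \<notin> Z \<longrightarrow> (\<forall>v. PiST D v w = PiBT D T v w)"
proof -
  obtain Z where Z: "Z \<in> null_sets lborel" "\<And>x u. x \<notin> Z \<Longrightarrow> PiD D u x = PiB D u x"
    using PiD_eq_PiB by blast
  have "Z \<times> (UNIV :: real set) \<in> null_sets lborel"
    using lborel.times_in_null_sets1[OF Z(1), of "UNIV :: real set"] by (simp add: lborel_prod)
  moreover have "PiST D v w = PiBT D T v w" if "w \<in> \<Omega> \<times> {0..T}" "w \<notin> Z \<times> UNIV" for v w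
    using that Z(2)[of "fst w"] by (auto simp: PiST_def PiBT_def mem_Times_iff kidx_eq_kid)
  ultimately show ?thesis by blast
qed

lemma strip_borel [measurable]: "\<Omega> \<times> {0..T} \<in> sets borel"
  by (intro borel_Times) auto

lemma bounded_strip: "bounded (\<Omega> \<times> {0..T})"
  using bounded_\<Omega> by (intro bounded_Times) auto

text \<open>Only space is translated, so the estimate is applied slice by slice. It is quadratic in
  the gradient norm of the slice, which integrates in time to exactly the squared norm in L^2(0,T;
  L^p). \<open>S\<close> absorbs \<Omega> together with its translate.\<close>

lemma PiBT_translate_L2:
  assumes v: "\<And>k. k \<le> gd_N D \<Longrightarrow> v k \<in> XD D" and Tc: "T_comp \<Omega> p D \<xi> \<le> \<epsilon>" and \<epsilon>: "\<epsilon> > 0"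
    and S: "bounded S" "S \<in> sets borel" "\<Omega> \<subseteq> S" "\<And>x. x + \<xi> \<in> \<Omega> \<Longrightarrow> x \<in> S"
  shows "(LBINT w. (PiBT D T v (fst w + \<xi>, snd w) - PiBT D T v w)\<^sup>2)
    \<le> \<epsilon>\<^sup>2 * (measure lborel S + 1) * (\<integral>t. (lpnorm (lebesgue_on \<Omega>) p (gradST D v t))\<^sup>2 \<partial>lebesgue_on {0..T})"
proof -
  obtain B where B: "\<And>w. \<bar>PiBT D T v w\<bar> \<le> B" using PiBT_bounded by blast
  define d where "d w = PiBT D T v (fst w + \<xi>, snd w) - PiBT D T v w" for w
  have dm [measurable]: "d \<in> borel_measurable borel" unfolding d_def by measurable
  have di: "integrable lborel (\<lambda>w. (d w)\<^sup>2)"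
  proof (rule integrable_bounded_support[of _ "S \<times> {0..T}" "(2 * B)\<^sup>2"])
    show "bounded (S \<times> {0..T})" using S(1) by (intro bounded_Times) auto
    have "\<bar>d w\<bar> \<le> 2 * B" for w
      using B[of w] B[of "(fst w + \<xi>, snd w)"] unfolding d_def by linarith
    then show "\<bar>(d w)\<^sup>2\<bar> \<le> (2 * B)\<^sup>2" for w using power_mono[of "\<bar>d w\<bar>" "2 * B" 2] by simp
    show "(d w)\<^sup>2 = 0" if "w \<notin> S \<times> {0..T}" for w
    proof -
      have "w \<notin> \<Omega> \<times> {0..T}" "(fst w + \<xi>, snd w) \<notin> \<Omega> \<times> {0..T}"
        using that S(3) S(4)[of "fst w"] by (auto simp: mem_Times_iff)
      then show ?thesis by (simp add: d_def PiBT_support)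
    qed
  qed measurable
  define q where "q t = indicator {0..T} t * (gnorm (v (kid D t)))\<^sup>2" for t :: real
  have qm [measurable]: "q \<in> borel_measurable borel" unfolding q_def by measurable
  have qi: "integrable lborel q"
  proof (rule integrable_bounded_support[of _ "{0..T}" "\<Sum>k\<le>gd_N D. (gnorm (v k))\<^sup>2"])
    show "\<bar>q t\<bar> \<le> (\<Sum>k\<le>gd_N D. (gnorm (v k))\<^sup>2)" for t
    proof -
      have "\<bar>q t\<bar> \<le> (gnorm (v (kid D t)))\<^sup>2" by (simp add: q_def indicator_def)
      also have "\<dots> \<le> (\<Sum>k\<le>gd_N D. (gnorm (v k))\<^sup>2)"
        using kid_le[of D t] by (intro member_le_sum[of _ _ "\<lambda>k. (gnorm (v k))\<^sup>2"]) auto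
      finally show ?thesis .
    qed
  qed (auto simp: q_def)
  have pt: "(LBINT x. (d (x, t))\<^sup>2) \<le> \<epsilon>\<^sup>2 * (measure lborel S + 1) * q t" for t
  proof (cases "t \<in> {0..T}")
    case True
    have "(LBINT x. (d (x, t))\<^sup>2) = (LBINT x. (PiB D (v (kid D t)) (x + \<xi>) - PiB D (v (kid D t)) x)\<^sup>2)"
      using True by (simp add: d_def PiBT_def)
    also have "\<dots> \<le> (\<epsilon> * gnorm (v (kid D t)))\<^sup>2 * (measure lborel S + 1)"
      by (rule translate_L2[OF v[OF kid_le] Tc \<epsilon> S])
    finally show ?thesis using True by (simp add: q_def power_mult_distrib ac_simps)
  qed (simp add: d_def PiBT_def q_def)
  have "(LBINT w. (d w)\<^sup>2) = (LBINT t. (LBINT x. (d (x, t))\<^sup>2))"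
    by (rule lborel_integral_snd[OF di])
  also have "\<dots> \<le> (LBINT t. \<epsilon>\<^sup>2 * (measure lborel S + 1) * q t)"
    by (rule integral_mono[OF lborel_integrable_snd[OF di] _ pt]) (use qi in simp)
  also have "\<dots> = \<epsilon>\<^sup>2 * (measure lborel S + 1) * (LBINT t. q t)" by simp
  also have "(LBINT t. q t) = (\<integral>t. (lpnorm (lebesgue_on \<Omega>) p (gradST D v t))\<^sup>2 \<partial>lebesgue_on {0..T})"
    unfolding q_def gradST_def gnorm_def[symmetric]
    by (rule lebesgue_on_integral_eq[of _ _ "{}", symmetric]) (auto simp: kidx_eq_kid)
  finally show ?thesis unfolding d_def .
qed

end

section \<open>Compactness in time of spatial averages\<close>

lemma square_sum3_le: "(x + y + z)\<^sup>2 \<le> 3 * (x\<^sup>2 + y\<^sup>2 + z\<^sup>2)" for x y z :: real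
proof -
  have "0 \<le> (x - y)\<^sup>2 + (y - z)\<^sup>2 + (x - z)\<^sup>2" by simp
  then show ?thesis by (simp add: power2_eq_square algebra_simps)
qed

text \<open>The cut-off is close in L^2 only, and its gradient may blow up as \<eta> tends to 0.
  This is harmless, since \<open>a'\<close> is fixed by the target accuracy before the mesh index
  moves.\<close>

lemma smooth_cutoff_L2:
  fixes a :: "'a::euclidean_space \<Rightarrow> real"
  assumes a: "smooth_expr a" and \<Omega>: "open \<Omega>" "bounded \<Omega>" and \<eta>: "\<eta> > 0"
  obtains a' where "smooth_expr a'" "compact (closure {x. a' x \<noteq> 0})" "closure {x. a' x \<noteq> 0} \<subseteq> \<Omega>"
    "(LBINT x. indicator \<Omega> x * (a x - a' x)\<^sup>2) \<le> \<eta>"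
proof -
  obtain \<kappa> :: "nat \<Rightarrow> 'a \<Rightarrow> real" where \<kappa>:
    "\<And>n. smooth_expr (\<kappa> n)" "\<And>n x. 0 \<le> \<kappa> n x" "\<And>n x. \<kappa> n x \<le> 1"
    "\<And>n. compact (closure {x. \<kappa> n x \<noteq> 0})" "\<And>n. closure {x. \<kappa> n x \<noteq> 0} \<subseteq> \<Omega>"
    "\<And>x. x \<in> \<Omega> \<Longrightarrow> (\<lambda>n. \<kappa> n x) \<longlonglongrightarrow> 1"
    by (rule open_smooth_cutoff[OF \<Omega>(1)]) (rule that)
  have [measurable]: "a \<in> borel_measurable borel" "\<And>n. \<kappa> n \<in> borel_measurable borel" "\<Omega> \<in> sets borel"
    using a \<kappa>(1) \<Omega> by (auto intro: borel_measurable_continuous_onI smooth_expr_continuous_on)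
  have "bounded (a ` closure \<Omega>)"
    using \<Omega> by (intro compact_imp_bounded compact_continuous_image smooth_expr_continuous_on[OF a])
      (auto simp: compact_closure)
  then obtain M where M: "\<And>x. x \<in> \<Omega> \<Longrightarrow> \<bar>a x\<bar> \<le> M"
    using closure_subset[of \<Omega>] unfolding bounded_iff by auto
  have "(\<lambda>n. LBINT x. indicator \<Omega> x * (a x - a x * \<kappa> n x)\<^sup>2) \<longlonglongrightarrow> (\<integral>x. 0 \<partial>(lborel :: 'a measure))"
  proof (rule integral_dominated_convergence[where w = "\<lambda>x. indicator \<Omega> x * M\<^sup>2"])
    show "integrable lborel (\<lambda>x. indicator \<Omega> x * M\<^sup>2)"
      by (rule integrable_bounded_support[OF _ \<Omega>(2), of _ "M\<^sup>2"]) auto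
    show "AE x in lborel. (\<lambda>n. indicator \<Omega> x * (a x - a x * \<kappa> n x)\<^sup>2) \<longlonglongrightarrow> 0"
    proof (rule AE_I2)
      fix x
      show "(\<lambda>n. indicator \<Omega> x * (a x - a x * \<kappa> n x)\<^sup>2) \<longlonglongrightarrow> 0"
      proof (cases "x \<in> \<Omega>")
        case True
        then have "(\<lambda>n. indicator \<Omega> x * (a x - a x * \<kappa> n x)\<^sup>2) \<longlonglongrightarrow> indicator \<Omega> x * (a x - a x * 1)\<^sup>2"
          by (intro tendsto_intros \<kappa>(6))
        then show ?thesis by simp
      qed simp
    qed
    show "AE x in lborel. norm (indicator \<Omega> x * (a x - a x * \<kappa> n x)\<^sup>2) \<le> indicator \<Omega> x * M\<^sup>2" for n
    proof (rule AE_I2)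
      fix x
      show "norm (indicator \<Omega> x * (a x - a x * \<kappa> n x)\<^sup>2) \<le> indicator \<Omega> x * M\<^sup>2"
      proof (cases "x \<in> \<Omega>")
        case True
        have "\<bar>a x - a x * \<kappa> n x\<bar> = \<bar>a x\<bar> * (1 - \<kappa> n x)"
          using \<kappa>(3)[of n x] by (simp add: right_diff_distrib[of "a x" 1, simplified, symmetric] abs_mult)
        also have "\<dots> \<le> M * 1" using M[OF True] \<kappa>(2,3)[of n x] by (intro mult_mono) auto
        finally show ?thesis using True power_mono[of "\<bar>a x - a x * \<kappa> n x\<bar>" M 2] by simp
      qed simp
    qed
  qed measurable
  then have "eventually (\<lambda>n. (LBINT x. indicator \<Omega> x * (a x - a x * \<kappa> n x)\<^sup>2) < \<eta>) sequentially"
    using \<eta> by (auto dest: order_tendstoD(2))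
  then obtain n where n: "(LBINT x. indicator \<Omega> x * (a x - a x * \<kappa> n x)\<^sup>2) < \<eta>"
    by (meson eventually_sequentially order_refl)
  have sub: "closure {x. a x * \<kappa> n x \<noteq> 0} \<subseteq> closure {x. \<kappa> n x \<noteq> 0}" by (intro closure_mono) auto
  show ?thesis
  proof (rule that[of "\<lambda>x. a x * \<kappa> n x"])
    show "smooth_expr (\<lambda>x. a x * \<kappa> n x)" by (intro smooth_expr.mult a \<kappa>)
    show "compact (closure {x. a x * \<kappa> n x \<noteq> 0})"
      using compact_Int_closed[OF \<kappa>(4) closed_closure, of n "{x. a x * \<kappa> n x \<noteq> 0}"] sub by (simp add: Int_absorb1)
    show "closure {x. a x * \<kappa> n x \<noteq> 0} \<subseteq> \<Omega>" using sub \<kappa>(5) by blast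
  qed (use n in simp)
qed


lemma consistent_interpolants:
  assumes D: "\<And>n. stgd \<Omega> p T (Ds n)" and cons: "consistent \<Omega> p Ds"
    and a: "smooth_expr a" "compact (closure {x. a x \<noteq> 0})" "closure {x. a x \<noteq> 0} \<subseteq> \<Omega>"
  obtains w M where "\<And>n. w n \<in> XD (Ds n)" "\<And>n. lpnorm (lebesgue_on \<Omega>) p (gd_grad (Ds n) (w n)) \<le> M"
    "(\<lambda>n. LBINT x. indicator \<Omega> x * (PiB (Ds n) (w n) x - a x)\<^sup>2) \<longlonglongrightarrow> 0"
proof -
  interpret D0: stgd \<Omega> p T "Ds 0" by (rule D)
  have \<Omega>: "open \<Omega>" "bounded \<Omega>" and p: "p > 0" using D0.open_\<Omega> D0.bounded_\<Omega> D0.p by auto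
  have ac: "continuous_on UNIV a" using a(1) by (rule smooth_expr_continuous_on)
  define G where "G = grad_fun a"
  have W: "W1p0 \<Omega> p a G" unfolding G_def by (rule W1p0_smooth[OF a \<Omega> p])
  have G: "memLp (lebesgue_on \<Omega>) p G" using W by (simp add: W1p0_def)
  define S where "S n = S_hat \<Omega> p (Ds n) a G" for n
  have "memLp (lebesgue_on \<Omega>) 2 a" by (rule memLp_continuous[OF ac \<Omega>]) simp
  then have S: "S \<longlonglongrightarrow> 0" unfolding S_def using cons W unfolding consistent_def by blast
  \<comment> \<open>The increment 1/(n+1) gives strict room above an infimum that may fail to be
    attained; the modulus makes positivity immediate.\<close>
  define l where "l n = \<bar>S n\<bar> + 1 / real (Suc n)" for n
  have l0: "l n > 0" and lS: "S n < l n" for n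
  proof -
    have "1 / real (Suc n) > 0" by simp
    then show "l n > 0" "S n < l n" using abs_ge_zero[of "S n"] abs_ge_self[of "S n"] unfolding l_def by linarith+
  qed
  have "(\<lambda>n. \<bar>S n\<bar> + 1 / real (Suc n)) \<longlonglongrightarrow> \<bar>0\<bar> + 0"
    by (intro tendsto_intros S LIMSEQ_Suc[OF lim_1_over_n])
  then have llim: "l \<longlonglongrightarrow> 0" unfolding l_def by simp
  have "bounded (range l)" using convergent_imp_bounded[OF llim] .
  then obtain L where L: "\<And>n. \<bar>l n\<bar> \<le> L" unfolding bounded_iff by auto
  define g where "g = (\<integral>x. norm (G x) powr p \<partial>lebesgue_on \<Omega>)"
  define P where "P n w \<longleftrightarrow> w \<in> XD (Ds n) \<and>
      (LBINT x. indicator \<Omega> x * (PiB (Ds n) w x - a x)\<^sup>2) \<le> (l n)\<^sup>2 * (measure lborel \<Omega> + 1) \<and>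
      (\<integral>x. norm (gd_grad (Ds n) w x) powr p \<partial>lebesgue_on \<Omega>) \<le> 2 powr p * (l n powr p + g)" for n w
  have "\<exists>w. P n w" for n
  proof -
    interpret stgd \<Omega> p T "Ds n" by (rule D)
    obtain w where "w \<in> XD (Ds n)"
    "(LBINT x. indicator \<Omega> x * (PiB (Ds n) w x - a x)\<^sup>2) \<le> (l n)\<^sup>2 * (measure lborel \<Omega> + 1)"
    "gmod w \<le> 2 powr p * (l n powr p + (\<integral>x. norm (G x) powr p \<partial>lebesgue_on \<Omega>))"
      by (rule consistent_interpolant[OF ac G lS[unfolded S_def] l0]) (rule that)
    then show ?thesis unfolding P_def gmod_def g_def by blast
  qed
  then have "\<forall>n. \<exists>w. P n w" by blast
  from choice[OF this] obtain w where "\<forall>n. P n (w n)" by blast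
  then have w: "\<And>n. w n \<in> XD (Ds n)"
     and wa: "\<And>n. (LBINT x. indicator \<Omega> x * (PiB (Ds n) (w n) x - a x)\<^sup>2) \<le> (l n)\<^sup>2 * (measure lborel \<Omega> + 1)"
     and wg: "\<And>n. (\<integral>x. norm (gd_grad (Ds n) (w n) x) powr p \<partial>lebesgue_on \<Omega>) \<le> 2 powr p * (l n powr p + g)"
    unfolding P_def by blast+
  show ?thesis
  proof (rule that)
    show "w n \<in> XD (Ds n)" for n by (rule w)
    show "lpnorm (lebesgue_on \<Omega>) p (gd_grad (Ds n) (w n)) \<le> (2 powr p * (L powr p + g)) powr (1 / p)" for n
      unfolding lpnorm_def
    proof (rule powr_mono2)
      have "l n powr p \<le> L powr p" using L[of n] l0[of n] p by (intro powr_mono2) auto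
      then have "2 powr p * (l n powr p + g) \<le> 2 powr p * (L powr p + g)" by (intro mult_left_mono) auto
      then show "(\<integral>x. norm (gd_grad (Ds n) (w n) x) powr p \<partial>lebesgue_on \<Omega>) \<le> 2 powr p * (L powr p + g)"
        using wg[of n] by linarith
    qed (use p in \<open>auto simp: integral_nonneg\<close>)
    have "(\<lambda>n. (l n)\<^sup>2 * (measure lborel \<Omega> + 1)) \<longlonglongrightarrow> 0\<^sup>2 * (measure lborel \<Omega> + 1)"
      by (intro tendsto_intros llim)
    then have lim: "(\<lambda>n. (l n)\<^sup>2 * (measure lborel \<Omega> + 1)) \<longlonglongrightarrow> 0" by simp
    show "(\<lambda>n. LBINT x. indicator \<Omega> x * (PiB (Ds n) (w n) x - a x)\<^sup>2) \<longlonglongrightarrow> 0"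
      by (rule tendsto_sandwich[OF _ _ tendsto_const lim]) (use wa in auto)
  qed
qed

text \<open>The slice integral against \<open>a\<close> is compared with \<open>f n\<close>, the one
  against \<open>W n\<close>, where \<open>W n\<close> reconstructs an interpolant of the cut-off
  \<open>a'\<close>. The error a - W n is eventually of squared L^2 size at most 4 \<eta> and costs
  a factor C; the variation of \<open>f n\<close> is bounded uniformly in n because the gradients of
  the interpolants are bounded. The comparison has to involve \<open>W n\<close> itself, as the dual
  semi-norm tests discrete functions only.\<close>

lemma L2_Cauchy_pairing_smooth:
  fixes Ds :: "nat \<Rightarrow> 'a::euclidean_space gdisc"
  assumes D: "\<And>n. stgd \<Omega> p T (Ds n)" and cons: "consistent \<Omega> p Ds"
    and V: "\<And>n. (\<integral>t. dualnorm \<Omega> p (Ds n) (deltaD (Ds n) (\<beta> n) t) \<partial>lebesgue_on {0..T}) \<le> V"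
    and C: "\<And>n. (LBINT w. (PiBT (Ds n) T (\<beta> n) w)\<^sup>2) \<le> C"
    and weak: "\<And>g M. g \<in> borel_measurable borel \<Longrightarrow> (\<And>w. w \<in> \<Omega> \<times> {0..T} \<Longrightarrow> \<bar>g w\<bar> \<le> M) \<Longrightarrow>
        convergent (\<lambda>n. LBINT w. PiBT (Ds n) T (\<beta> n) w * g w)"
    and a: "smooth_expr a" and e: "e > 0"
  shows "\<exists>n0. \<forall>n\<ge>n0. \<forall>n'\<ge>n0. (LBINT t. ((LBINT x. PiBT (Ds n) T (\<beta> n) (x, t) * a x)
            - (LBINT x. PiBT (Ds n') T (\<beta> n') (x, t) * a x))\<^sup>2) \<le> e"
proof -
  interpret D0: stgd \<Omega> p T "Ds 0" by (rule D)
  note \<Omega> = D0.open_\<Omega> D0.bounded_\<Omega>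
  define b where "b n = PiBT (Ds n) T (\<beta> n)" for n
  have bm [measurable]: "b n \<in> borel_measurable borel" for n
    unfolding b_def by (rule stgd.PiBT_measurable[OF D])
  have bs: "b n w = 0" if "w \<notin> \<Omega> \<times> {0..T}" for n w
    unfolding b_def by (rule stgd.PiBT_support[OF D that])
  have bB: "\<exists>B. \<forall>w. \<bar>b n w\<bar> \<le> B" for n unfolding b_def by (rule stgd.PiBT_bounded[OF D])
  have "0 \<le> (LBINT w. (PiBT (Ds 0) T (\<beta> 0) w)\<^sup>2)" by simp
  then have C0: "0 \<le> C" using C[of 0] by linarith
  define sl where "sl n q t = (LBINT x. b n (x, t) * q x)" for n t and q :: "'a \<Rightarrow> real"
  define ok where "ok q \<longleftrightarrow> q \<in> borel_measurable borel \<and> (\<exists>M. \<forall>x\<in>\<Omega>. \<bar>q x\<bar> \<le> M)" for q :: "'a \<Rightarrow> real"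
  have sl: "integrable lborel (\<lambda>x. b n (x, t) * q x)" "integrable lborel (\<lambda>w. b n w * q (fst w))"
      "sl n q \<in> borel_measurable borel" "t \<notin> {0..T} \<Longrightarrow> sl n q t = 0" "integrable lborel (\<lambda>t. (sl n q t)\<^sup>2)"
      "(LBINT t. (sl n q t)\<^sup>2) \<le> C * (LBINT x. indicator \<Omega> x * (q x)\<^sup>2)"
      "\<exists>B. \<forall>t. \<bar>sl n q t\<bar> \<le> B"
    if okq: "ok q" for n q t
  proof -
    obtain M where qm: "q \<in> borel_measurable borel" and M: "\<And>x. x \<in> \<Omega> \<Longrightarrow> \<bar>q x\<bar> \<le> M"
      using okq unfolding ok_def by blast
    obtain B where B: "\<And>w. \<bar>b n w\<bar> \<le> B" using bB by blast
    note * = D0.bounded_\<Omega> D0.\<Omega>_borel bm qm bs B M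
    show "integrable lborel (\<lambda>x. b n (x, t) * q x)" by (rule slice_integrable[OF *])
    show "integrable lborel (\<lambda>w. b n w * q (fst w))" by (rule slice_product_integrable[OF *])
    show "sl n q \<in> borel_measurable borel" unfolding sl_def by (rule slice_measurable[OF *])
    show "t \<notin> {0..T} \<Longrightarrow> sl n q t = 0" unfolding sl_def by (rule slice_eq_0[OF *])
    show "integrable lborel (\<lambda>t. (sl n q t)\<^sup>2)" unfolding sl_def by (rule slice_square_integrable[OF *])
    have "(LBINT t. (sl n q t)\<^sup>2) \<le> (LBINT w. (b n w)\<^sup>2) * (LBINT x. indicator \<Omega> x * (q x)\<^sup>2)"
      unfolding sl_def by (rule slice_L2[OF *])
    also have "\<dots> \<le> C * (LBINT x. indicator \<Omega> x * (q x)\<^sup>2)"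
      using C[of n] unfolding b_def by (intro mult_right_mono) auto
    finally show "(LBINT t. (sl n q t)\<^sup>2) \<le> C * (LBINT x. indicator \<Omega> x * (q x)\<^sup>2)" .
    have "\<bar>sl n q t\<bar> \<le> measure lborel \<Omega> * (B * M)" for t
      unfolding sl_def by (rule slice_le[OF *])
    then show "\<exists>B. \<forall>t. \<bar>sl n q t\<bar> \<le> B" by blast
  qed
  have sl_diff: "sl n (\<lambda>x. q x - r x) t = sl n q t - sl n r t" if "ok q" "ok r" for n q r t
    unfolding sl_def right_diff_distrib
    by (rule Bochner_Integration.integral_diff[OF sl(1)[OF that(1)] sl(1)[OF that(2)]])
  have ok_diff: "ok (\<lambda>x. q x - r x)" if q: "ok q" and r: "ok r" for q r
  proof -
    obtain M N where "\<And>x. x \<in> \<Omega> \<Longrightarrow> \<bar>q x\<bar> \<le> M" "\<And>x. x \<in> \<Omega> \<Longrightarrow> \<bar>r x\<bar> \<le> N"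
      using q r unfolding ok_def by blast
    then have "\<forall>x\<in>\<Omega>. \<bar>q x - r x\<bar> \<le> M + N" by (force simp: abs_diff_le_iff)
    then show ?thesis using q r unfolding ok_def by (auto intro!: borel_measurable_diff)
  qed
  have ok_smooth: "ok q" if "smooth_expr q" for q
  proof -
    have c: "continuous_on UNIV q" using that by (rule smooth_expr_continuous_on)
    have "bounded (q ` closure \<Omega>)"
      using \<Omega> by (intro compact_imp_bounded compact_continuous_image continuous_on_subset[OF c])
        (auto simp: compact_closure)
    then show ?thesis using closure_subset[of \<Omega>] borel_measurable_continuous_onI[OF c]
      unfolding bounded_iff ok_def by auto
  qed
  have sq_int: "integrable lborel (\<lambda>x. indicator \<Omega> x * (q x)\<^sup>2)" if okq: "ok q" for q
  proof -
    obtain M where [measurable]: "q \<in> borel_measurable borel" and M: "\<And>x. x \<in> \<Omega> \<Longrightarrow> \<bar>q x\<bar> \<le> M"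
      using okq unfolding ok_def by blast
    have "(q x)\<^sup>2 \<le> M\<^sup>2" if "x \<in> \<Omega>" for x using power_mono[OF M[OF that] abs_ge_zero, of 2] by simp
    then show ?thesis by (intro integrable_bounded_support[OF _ \<Omega>(2), of _ "M\<^sup>2"]) auto
  qed
  \<comment> \<open>The factor 4 comes from applying (x+y)^2 <= 2x^2 + 2y^2 to two errors of size
    \<eta>; three terms of size e / 9, with the factor 3 of \<open>square_sum3_le\<close>, add up to
    e. The summand 1 covers C = 0.\<close>
  define \<eta> where "\<eta> = e / (36 * (C + 1))"
  have \<eta>: "\<eta> > 0" using e C0 by (simp add: \<eta>_def)
  have C\<eta>: "C * (4 * \<eta>) \<le> e / 9"
  proof -
    have "C * (4 * \<eta>) \<le> (C + 1) * (4 * \<eta>)" using \<eta> by (intro mult_right_mono) auto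
    also have "\<dots> = e / 9" using C0 by (simp add: \<eta>_def field_simps)
    finally show ?thesis .
  qed
  obtain a' where a': "smooth_expr a'" "compact (closure {x. a' x \<noteq> 0})" "closure {x. a' x \<noteq> 0} \<subseteq> \<Omega>"
    and aa': "(LBINT x. indicator \<Omega> x * (a x - a' x)\<^sup>2) \<le> \<eta>"
    by (rule smooth_cutoff_L2[OF a \<Omega> \<eta>]) (rule that)
  obtain w M where w: "\<And>n. w n \<in> XD (Ds n)" and wM: "\<And>n. lpnorm (lebesgue_on \<Omega>) p (gd_grad (Ds n) (w n)) \<le> M"
    and wlim: "(\<lambda>n. LBINT x. indicator \<Omega> x * (PiB (Ds n) (w n) x - a' x)\<^sup>2) \<longlonglongrightarrow> 0"
    by (rule consistent_interpolants[OF D cons a']) (rule that)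
  define W where "W n = PiB (Ds n) (w n)" for n
  define E where "E n = (LBINT x. indicator \<Omega> x * (W n x - a' x)\<^sup>2)" for n
  have Elim: "E \<longlonglongrightarrow> 0" using wlim unfolding E_def W_def .
  have okW: "ok (W n)" for n
    unfolding ok_def W_def using stgd.PiB_measurable[OF D] stgd.PiB_bound[OF D] by blast
  note oka = ok_smooth[OF a] and oka' = ok_smooth[OF a'(1)]
  define f where "f n = sl n (W n)" for n
  have fm [measurable]: "f n \<in> borel_measurable borel" for n unfolding f_def by (rule sl(3)[OF okW])
  have V0: "M \<ge> 0" using wM[of 0] by (auto intro: order_trans[rotated] simp: lpnorm_def)
  define F where "F n j = dualnorm \<Omega> p (Ds n) (\<lambda>i. (\<beta> n j i - \<beta> n (j - 1) i) / (gd_t (Ds n) j - gd_t (Ds n) (j - 1)))" for n j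
  define \<mu> where "\<mu> n t = (\<Sum>k<kid (Ds n) t. (gd_t (Ds n) (Suc k) - gd_t (Ds n) k) * F n (Suc k)
      * lpnorm (lebesgue_on \<Omega>) p (gd_grad (Ds n) (w n)))" for n t
  have f_eq: "f n t = (LBINT x. PiB (Ds n) (\<beta> n (kid (Ds n) t)) x * PiB (Ds n) (w n) x)"
    if "0 \<le> t" "t \<le> T" for n t
    using that by (simp add: f_def sl_def b_def PiBT_def W_def)
  have var: "\<bar>f n t - f n s\<bar> \<le> \<mu> n t - \<mu> n s" if "0 \<le> s" "s \<le> t" "t \<le> T" for n s t
    using stgd.pairing_variation[OF D[of n] w[of n] that(2), where v = "\<beta> n"] that
    unfolding \<mu>_def F_def stgd.gnorm_def[OF D] by (simp add: f_eq)
  have \<mu>V: "\<mu> n T - \<mu> n 0 \<le> \<bar>V\<bar> * M" for n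
  proof -
    interpret stgd \<Omega> p T "Ds n" by (rule D)
    \<comment> \<open>At t = T every level below the last one is counted, so \<open>\<mu> n\<close>
      has picked up all time steps.\<close>
    have kT: "kid (Ds n) T = gd_N (Ds n)"
    proof -
      have "\<not> kid (Ds n) T < gd_N (Ds n)"
      proof
        assume *: "kid (Ds n) T < gd_N (Ds n)"
        then have "\<not> gd_t (Ds n) (kid (Ds n) T) < T"
          using t_less_iff[of T "kid (Ds n) T"] T_pos by simp
        then show False
          using t_less[OF *] t_mono[of "Suc (kid (Ds n) T)" "gd_N (Ds n)"] * t_N by simp
      qed
      then show ?thesis using kid_le[of "Ds n" T] by simp
    qed
    have k0: "kid (Ds n) 0 = 0" using t_less_iff[of 0 0] T_pos t_0 by simp
    define g where "g = lpnorm (lebesgue_on \<Omega>) p (gd_grad (Ds n) (w n))"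
    have g0: "g \<ge> 0" by (simp add: g_def lpnorm_def)
    have "\<mu> n T - \<mu> n 0 = (\<Sum>k<gd_N (Ds n). (gd_t (Ds n) (Suc k) - gd_t (Ds n) k) * F n (Suc k)) * g"
      unfolding \<mu>_def kT k0 g_def[symmetric] by (simp add: sum_distrib_right)
    also have "(\<Sum>k<gd_N (Ds n). (gd_t (Ds n) (Suc k) - gd_t (Ds n) k) * F n (Suc k))
        = (\<integral>t. F n (kidx (Ds n) t) \<partial>lebesgue_on {0..T})"
      by (rule step_integral[symmetric])
    also have "\<dots> = (\<integral>t. dualnorm \<Omega> p (Ds n) (deltaD (Ds n) (\<beta> n) t) \<partial>lebesgue_on {0..T})"
      unfolding F_def deltaD_def ..
    also have "\<dots> * g \<le> \<bar>V\<bar> * M"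
      using V[of n] wM[of n] g0 unfolding g_def[symmetric] by (intro mult_mono) auto
    finally show ?thesis .
  qed
  \<comment> \<open>The functions \<open>W n\<close> vary with n, so weak convergence does not apply
    to them directly. The part with the fixed function \<open>a'\<close> converges by testing
    against I(t) a'(x); the remainder tends to 0 by the strong convergence of W n - a' and the
    common L^2 bound on b n.\<close>
  have conv: "convergent (\<lambda>n. LBINT t. indicator {s..r} t * f n t)" if sr: "0 \<le> s" "s \<le> r" "r \<le> T" for s r
  proof -
    define I where "I = (indicator {s..r} :: real \<Rightarrow> real)"
    have Im [measurable]: "I \<in> borel_measurable borel" unfolding I_def by simp
    have I2: "integrable lborel (\<lambda>t. (I t)\<^sup>2)"
      by (rule integrable_bounded_support[of _ "{s..r}" 1]) (auto simp: I_def indicator_def)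
    have I2v: "(LBINT t. (I t)\<^sup>2) = r - s"
    proof -
      have "(\<lambda>t. (I t)\<^sup>2) = indicator {s..r}" by (auto simp: I_def indicator_def)
      then show ?thesis using sr by simp
    qed
    have Isl: "integrable lborel (\<lambda>t. I t * sl n q t)" if "ok q" for n q
      by (rule integrable_mult_L2[OF _ _ I2 sl(5)[OF that]]) (use sl(3)[OF that] in simp_all)
    have split: "(LBINT t. indicator {s..r} t * f n t)
        = (LBINT t. I t * sl n a' t) + (LBINT t. I t * sl n (\<lambda>x. W n x - a' x) t)" for n
    proof -
      have "I t * f n t = I t * sl n a' t + I t * sl n (\<lambda>x. W n x - a' x) t" for t
        unfolding f_def sl_diff[OF okW oka'] by (simp add: algebra_simps)
      then show ?thesis
        unfolding I_def[symmetric] using Isl[OF oka'] Isl[OF ok_diff[OF okW oka']] by simp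
    qed
    have c1: "convergent (\<lambda>n. LBINT t. I t * sl n a' t)"
    proof -
      obtain A where [measurable]: "a' \<in> borel_measurable borel" and A: "\<And>x. x \<in> \<Omega> \<Longrightarrow> \<bar>a' x\<bar> \<le> A"
        using oka' unfolding ok_def by blast
      have "(LBINT t. I t * sl n a' t) = (LBINT w. b n w * (I (snd w) * a' (fst w)))" for n
      proof -
        have i: "integrable lborel (\<lambda>w. b n w * (I (snd w) * a' (fst w)))"
        proof (rule Bochner_Integration.integrable_bound[OF sl(2)[OF oka', of n]])
          show "AE w in lborel. norm (b n w * (I (snd w) * a' (fst w))) \<le> norm (b n w * a' (fst w))"
            by (rule AE_I2) (auto simp: I_def indicator_def)
        qed measurable
        have "(LBINT w. b n w * (I (snd w) * a' (fst w))) = (LBINT t. (LBINT x. b n (x, t) * (I t * a' x)))"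
          using lborel_integral_snd[OF i] by simp
        also have "\<dots> = (LBINT t. I t * sl n a' t)"
        proof (rule Bochner_Integration.integral_cong[OF refl])
          fix t
          have "(\<lambda>x. b n (x, t) * (I t * a' x)) = (\<lambda>x. I t * (b n (x, t) * a' x))" by (simp add: ac_simps)
          then show "(LBINT x. b n (x, t) * (I t * a' x)) = I t * sl n a' t" by (simp add: sl_def)
        qed
        finally show ?thesis ..
      qed
      moreover have "convergent (\<lambda>n. LBINT w. b n w * (I (snd w) * a' (fst w)))"
        unfolding b_def
      proof (rule weak[of _ A])
        show "(\<lambda>w. I (snd w) * a' (fst w)) \<in> borel_measurable borel" by measurable
        show "\<bar>I (snd w) * a' (fst w)\<bar> \<le> A" if "w \<in> \<Omega> \<times> {0..T}" for w
          using A[of "fst w"] that by (auto simp: I_def indicator_def)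
      qed
      ultimately show ?thesis by simp
    qed
    have c2: "(\<lambda>n. LBINT t. I t * sl n (\<lambda>x. W n x - a' x) t) \<longlonglongrightarrow> 0"
    proof (rule Lim_null_comparison)
      have "(\<lambda>n. sqrt (r - s) * sqrt (C * E n)) \<longlonglongrightarrow> sqrt (r - s) * sqrt (C * 0)"
        by (intro tendsto_intros Elim)
      then show "(\<lambda>n. sqrt (r - s) * sqrt (C * E n)) \<longlonglongrightarrow> 0" by simp
      have "\<bar>LBINT t. I t * sl n (\<lambda>x. W n x - a' x) t\<bar> \<le> sqrt (r - s) * sqrt (C * E n)" for n
      proof -
        note k = ok_diff[OF okW oka', of n]
        have "\<bar>LBINT t. I t * sl n (\<lambda>x. W n x - a' x) t\<bar>
            \<le> sqrt (LBINT t. (I t)\<^sup>2) * sqrt (LBINT t. (sl n (\<lambda>x. W n x - a' x) t)\<^sup>2)"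
          using Cauchy_Schwarz_integral_sqrt[OF _ _ I2 sl(5)[OF k]] sl(3)[OF k] by simp
        also have "\<dots> \<le> sqrt (r - s) * sqrt (C * E n)"
          unfolding I2v E_def using sl(6)[OF k, of n] sr by (intro mult_left_mono real_sqrt_le_mono) auto
        finally show ?thesis .
      qed
      then show "\<forall>\<^sub>F n in sequentially. norm (LBINT t. I t * sl n (\<lambda>x. W n x - a' x) t) \<le> sqrt (r - s) * sqrt (C * E n)"
        by simp
    qed
    show ?thesis unfolding split by (intro convergent_add c1 convergentI[OF c2])
  qed
  have "\<exists>n0. \<forall>n\<ge>n0. \<forall>n'\<ge>n0. (LBINT t. indicator {0..T} t * (f n t - f n' t)\<^sup>2) \<le> e / 9"
  proof (rule bounded_variation_L2_Cauchy[of f T \<mu> "\<bar>V\<bar> * M"])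
    show "0 < e / 9" using e by simp
  qed (fact fm D0.T_pos var \<mu>V conv)+
  then obtain n1 where n1: "\<And>n n'. n \<ge> n1 \<Longrightarrow> n' \<ge> n1 \<Longrightarrow>
      (LBINT t. indicator {0..T} t * (f n t - f n' t)\<^sup>2) \<le> e / 9" by blast
  obtain n2 where n2: "\<And>n. n \<ge> n2 \<Longrightarrow> E n \<le> \<eta>"
    using order_tendstoD(2)[OF Elim \<eta>] unfolding eventually_sequentially by (meson less_imp_le)
  have near: "(LBINT t. (sl n (\<lambda>x. a x - W n x) t)\<^sup>2) \<le> e / 9" if "n \<ge> n2" for n
  proof -
    have "(LBINT x. indicator \<Omega> x * (a x - W n x)\<^sup>2)
        \<le> (LBINT x. 2 * (indicator \<Omega> x * (a x - a' x)\<^sup>2) + 2 * (indicator \<Omega> x * (W n x - a' x)\<^sup>2))"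
    proof (rule integral_mono)
      show "integrable lborel (\<lambda>x. indicator \<Omega> x * (a x - W n x)\<^sup>2)" by (intro sq_int ok_diff oka okW)
      show "integrable lborel (\<lambda>x. 2 * (indicator \<Omega> x * (a x - a' x)\<^sup>2) + 2 * (indicator \<Omega> x * (W n x - a' x)\<^sup>2))"
        using sq_int[OF ok_diff[OF oka oka']] sq_int[OF ok_diff[OF okW oka']] by simp
      fix x
      have "0 \<le> (a x - a' x + (W n x - a' x))\<^sup>2" by simp
      then have "(a x - W n x)\<^sup>2 \<le> 2 * (a x - a' x)\<^sup>2 + 2 * (W n x - a' x)\<^sup>2"
        by (simp add: power2_eq_square algebra_simps)
      then show "indicator \<Omega> x * (a x - W n x)\<^sup>2
          \<le> 2 * (indicator \<Omega> x * (a x - a' x)\<^sup>2) + 2 * (indicator \<Omega> x * (W n x - a' x)\<^sup>2)"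
        by (simp add: indicator_def)
    qed
    also have "\<dots> = 2 * (LBINT x. indicator \<Omega> x * (a x - a' x)\<^sup>2) + 2 * E n"
      unfolding E_def using sq_int[OF ok_diff[OF oka oka']] sq_int[OF ok_diff[OF okW oka']] by simp
    also have "\<dots> \<le> 4 * \<eta>" using aa' n2[OF that] by simp
    finally have "C * (LBINT x. indicator \<Omega> x * (a x - W n x)\<^sup>2) \<le> C * (4 * \<eta>)"
      using C0 by (intro mult_left_mono)
    then show ?thesis using sl(6)[OF ok_diff[OF oka okW], of n n] C\<eta> by linarith
  qed
  have "(LBINT t. (sl n a t - sl n' a t)\<^sup>2) \<le> e" if n: "n \<ge> max n1 n2" "n' \<ge> max n1 n2" for n n'
  proof -
    define X where "X n t = sl n (\<lambda>x. a x - W n x) t" for n t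
    have Xeq: "X n t = sl n a t - f n t" for n t unfolding X_def f_def by (rule sl_diff[OF oka okW])
    have Xi: "integrable lborel (\<lambda>t. (X n t)\<^sup>2)" for n unfolding X_def by (rule sl(5)[OF ok_diff[OF oka okW]])
    have f0: "f n t = 0" if "t \<notin> {0..T}" for n t unfolding f_def by (rule sl(4)[OF okW that])
    have fd: "indicator {0..T} t * (f n t - f n' t)\<^sup>2 = (f n t - f n' t)\<^sup>2" for t
      using f0[of t n] f0[of t n'] by (cases "t \<in> {0..T}") auto
    obtain B B' where B: "\<And>t. \<bar>f n t\<bar> \<le> B" "\<And>t. \<bar>f n' t\<bar> \<le> B'"
      using sl(7)[OF okW] unfolding f_def by meson
    have fi: "integrable lborel (\<lambda>t. (f n t - f n' t)\<^sup>2)"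
    proof (rule integrable_bounded_support[of _ "{0..T}" "(B + B')\<^sup>2"])
      have "\<bar>f n t - f n' t\<bar> \<le> B + B'" for t using B[of t] by linarith
      then show "\<bar>(f n t - f n' t)\<^sup>2\<bar> \<le> (B + B')\<^sup>2" for t
        using power_mono[of "\<bar>f n t - f n' t\<bar>" "B + B'" 2] by simp
    qed (auto simp: f0)
    have pt: "(sl n a t - sl n' a t)\<^sup>2 \<le> 3 * ((X n t)\<^sup>2 + (f n t - f n' t)\<^sup>2 + (X n' t)\<^sup>2)" for t
      using square_sum3_le[of "X n t" "f n t - f n' t" "- X n' t"]
      by (simp add: Xeq power2_commute[of "f n' t"])
    have "(LBINT t. (sl n a t - sl n' a t)\<^sup>2)
        \<le> (LBINT t. 3 * ((X n t)\<^sup>2 + (f n t - f n' t)\<^sup>2 + (X n' t)\<^sup>2))"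
      by (rule integral_mono'[OF _ pt]) (use Xi fi in auto)
    also have "\<dots> = 3 * ((LBINT t. (X n t)\<^sup>2) + (LBINT t. (f n t - f n' t)\<^sup>2) + (LBINT t. (X n' t)\<^sup>2))"
      using Xi fi by simp
    also have "\<dots> \<le> 3 * (e / 9 + e / 9 + e / 9)"
      using near[of n] near[of n'] n1[of n n'] n unfolding fd X_def by (intro mult_left_mono add_mono) auto
    finally show ?thesis by simp
  qed
  then show ?thesis unfolding sl_def b_def by blast
qed

text \<open>\<open>compact_gd\<close> is a limit at 0 uniform in m; combined with the bound on the
  gradients it becomes a common modulus of translation in L^2.\<close>

lemma uniform_translation_estimate:
  fixes Ds :: "nat \<Rightarrow> 'a::euclidean_space gdisc"
  assumes D: "\<And>m. stgd \<Omega> p T (Ds m)" and comp: "compact_gd \<Omega> p Ds"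
    and \<zeta>: "\<And>m k. k \<le> gd_N (Ds m) \<Longrightarrow> \<zeta> m k \<in> XD (Ds m)"
    and N: "\<And>m. (\<integral>t. (lpnorm (lebesgue_on \<Omega>) p (gradST (Ds m) (\<zeta> m) t))\<^sup>2 \<partial>lebesgue_on {0..T}) \<le> N"
    and \<epsilon>: "\<epsilon> > 0"
  shows "\<exists>\<delta>>0. \<forall>\<xi> m. norm \<xi> < \<delta> \<longrightarrow>
    (LBINT w. (PiBT (Ds m) T (\<zeta> m) (fst w + \<xi>, snd w) - PiBT (Ds m) T (\<zeta> m) w)\<^sup>2) \<le> \<epsilon>\<^sup>2"
proof -
  interpret D0: stgd \<Omega> p T "Ds 0" by (rule D)
  obtain R where R: "\<And>x. x \<in> \<Omega> \<Longrightarrow> norm x \<le> R" using D0.bounded_\<Omega> unfolding bounded_iff by blast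
  \<comment> \<open>The radius R + 1 accommodates \<Omega> and all its translates by vectors of norm
    below 1, which is why the final radius is capped at 1.\<close>
  define S where "S = cball (0::'a) (R + 1)"
  define A where "A = (measure lborel S + 1) * (\<bar>N\<bar> + 1)"
  have A: "A > 0" unfolding A_def by (intro mult_pos_pos) (auto intro: add_nonneg_pos)
  \<comment> \<open>Rescaled so that \<epsilon>'^2 A = \<epsilon>^2.\<close>
  define \<epsilon>' where "\<epsilon>' = \<epsilon> / sqrt A"
  have \<epsilon>': "\<epsilon>' > 0" using \<epsilon> A by (simp add: \<epsilon>'_def)
  have "eventually (\<lambda>\<xi>. (SUP m. ereal (T_comp \<Omega> p (Ds m) \<xi>)) < ereal \<epsilon>') (at 0)"
    using order_tendstoD(2)[OF comp[unfolded compact_gd_def], of "ereal \<epsilon>'"] \<epsilon>' by simp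
  then obtain \<delta> where \<delta>: "\<delta> > 0"
      "\<And>\<xi>. \<xi> \<noteq> 0 \<Longrightarrow> norm \<xi> < \<delta> \<Longrightarrow> (SUP m. ereal (T_comp \<Omega> p (Ds m) \<xi>)) < ereal \<epsilon>'"
    unfolding eventually_at by auto
  show ?thesis
  proof (intro exI[of _ "min \<delta> 1"] conjI allI impI)
    show "min \<delta> 1 > 0" using \<delta>(1) by simp
    fix \<xi> :: 'a and m assume \<xi>: "norm \<xi> < min \<delta> 1"
    show "(LBINT w. (PiBT (Ds m) T (\<zeta> m) (fst w + \<xi>, snd w) - PiBT (Ds m) T (\<zeta> m) w)\<^sup>2) \<le> \<epsilon>\<^sup>2"
    \<comment> \<open>The filter \<open>at 0\<close> says nothing at \<xi> = 0, where the difference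
      vanishes identically.\<close>
    proof (cases "\<xi> = 0")
      case False
      have "ereal (T_comp \<Omega> p (Ds m) \<xi>) \<le> (SUP m. ereal (T_comp \<Omega> p (Ds m) \<xi>))" by (rule SUP_upper) simp
      also have "\<dots> < ereal \<epsilon>'" using \<delta>(2)[OF False] \<xi> by simp
      finally have Tc: "T_comp \<Omega> p (Ds m) \<xi> \<le> \<epsilon>'" by simp
      interpret stgd \<Omega> p T "Ds m" by (rule D)
      have "(LBINT w. (PiBT (Ds m) T (\<zeta> m) (fst w + \<xi>, snd w) - PiBT (Ds m) T (\<zeta> m) w)\<^sup>2)
        \<le> \<epsilon>'\<^sup>2 * (measure lborel S + 1) * (\<integral>t. (lpnorm (lebesgue_on \<Omega>) p (gradST (Ds m) (\<zeta> m) t))\<^sup>2 \<partial>lebesgue_on {0..T})"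
      proof (rule PiBT_translate_L2[OF \<zeta> Tc \<epsilon>'])
        show "bounded S" "S \<in> sets borel" by (simp_all add: S_def)
        show "\<Omega> \<subseteq> S" using R by (force simp: S_def)
        show "x \<in> S" if "x + \<xi> \<in> \<Omega>" for x
          using R[OF that] norm_triangle_ineq4[of "x + \<xi>" \<xi>] \<xi> by (simp add: S_def)
      qed
      also have "\<dots> \<le> \<epsilon>'\<^sup>2 * (measure lborel S + 1) * (\<bar>N\<bar> + 1)"
        using N[of m] by (intro mult_left_mono) auto
      also have "\<dots> = \<epsilon>\<^sup>2"
        using A unfolding \<epsilon>'_def by (simp add: power_divide A_def[symmetric] mult.assoc)
      finally show ?thesis .
    qed simp
  qed
qed

section \<open>Interchange of limits and conclusion\<close>

lemma memLp_2_iff: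
  fixes f :: "'b \<Rightarrow> real"
  shows "memLp M 2 f \<longleftrightarrow> f \<in> borel_measurable M \<and> integrable M (\<lambda>x. (f x)\<^sup>2)"
  unfolding memLp_def by (simp add: powr_numeral)

text \<open>Letting one of the two indices in the Cauchy estimate tend to infinity, with m held
  fixed, bounds |B m m - L m|. The threshold does not depend on m, so the diagonal is eventually
  covered.\<close>

lemma ucauchy_diagonal:
  assumes B: "ucauchy B" and L: "\<And>m. (\<lambda>n. B n m) \<longlonglongrightarrow> L m" and l: "L \<longlonglongrightarrow> l"
  shows "(\<lambda>m. B m m) \<longlonglongrightarrow> l"
proof -
  have "(\<lambda>m. B m m - L m) \<longlonglongrightarrow> 0"
    unfolding LIMSEQ_iff
  proof (intro allI impI)
    fix e :: real assume "e > 0"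
    then have e: "e / 2 > 0" by simp
    obtain n0 where n0: "\<And>n n' m. n \<ge> n0 \<Longrightarrow> n' \<ge> n0 \<Longrightarrow> \<bar>B n m - B n' m\<bar> \<le> e / 2"
      using B e unfolding ucauchy_def by meson
    have "\<bar>B m m - L m\<bar> \<le> e / 2" if "m \<ge> n0" for m
    proof (rule LIMSEQ_le_const2)
      show "(\<lambda>n. \<bar>B m m - B n m\<bar>) \<longlonglongrightarrow> \<bar>B m m - L m\<bar>" by (intro tendsto_intros L)
      show "\<exists>N. \<forall>n\<ge>N. \<bar>B m m - B n m\<bar> \<le> e / 2" using n0[OF that] by blast
    qed
    then have "norm (B m m - L m - 0) < e" if "m \<ge> n0" for m
      using that \<open>e > 0\<close> by (force intro: le_less_trans)
    then show "\<exists>n0. \<forall>m\<ge>n0. norm (B m m - L m - 0) < e" by blast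
  qed
  from tendsto_add[OF this l] show ?thesis by simp
qed

theorem theorem5p3:
  fixes \<Omega> :: "'a::euclidean_space set"
    and T p :: real
    and Ds :: "nat \<Rightarrow> 'a gdisc"
    and \<beta> \<zeta> :: "nat \<Rightarrow> nat \<Rightarrow> nat \<Rightarrow> real"
    and \<beta>bar \<zeta>bar :: "'a \<times> real \<Rightarrow> real"
  assumes "open \<Omega>" and "bounded \<Omega>"
    and "T > 0" and "p \<ge> 2"
    and "\<And>m. is_stgd \<Omega> p T (Ds m)"
    and "consistent \<Omega> p Ds"
    and "compact_gd \<Omega> p Ds"
    and "\<And>m n. n \<le> gd_N (Ds m) \<Longrightarrow> \<beta> m n \<in> XD (Ds m)"
    and "\<And>m n. n \<le> gd_N (Ds m) \<Longrightarrow> \<zeta> m n \<in> XD (Ds m)"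
    and "bounded (range (\<lambda>m. \<integral>t. dualnorm \<Omega> p (Ds m) (deltaD (Ds m) (\<beta> m) t)
                                  \<partial>lebesgue_on {0..T}))"
    and "bounded (range (\<lambda>m. sqrt (\<integral>t. (lpnorm (lebesgue_on \<Omega>) p (gradST (Ds m) (\<zeta> m) t))\<^sup>2
                                  \<partial>lebesgue_on {0..T})))"
    and "memLp (lebesgue_on (\<Omega> \<times> {0..T})) 2 \<beta>bar"
    and "memLp (lebesgue_on (\<Omega> \<times> {0..T})) 2 \<zeta>bar"
    and "\<And>g. memLp (lebesgue_on (\<Omega> \<times> {0..T})) 2 g \<Longrightarrow>
           (\<lambda>m. \<integral>z. PiST (Ds m) (\<beta> m) z * g z \<partial>lebesgue_on (\<Omega> \<times> {0..T}))
             \<longlonglongrightarrow> (\<integral>z. \<beta>bar z * g z \<partial>lebesgue_on (\<Omega> \<times> {0..T}))"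
    and "\<And>g. memLp (lebesgue_on (\<Omega> \<times> {0..T})) 2 g \<Longrightarrow>
           (\<lambda>m. \<integral>z. PiST (Ds m) (\<zeta> m) z * g z \<partial>lebesgue_on (\<Omega> \<times> {0..T}))
             \<longlonglongrightarrow> (\<integral>z. \<zeta>bar z * g z \<partial>lebesgue_on (\<Omega> \<times> {0..T}))"
  shows "\<forall>\<phi>. continuous_on (closure \<Omega> \<times> {0..T}) \<phi> \<longrightarrow>
           (\<lambda>m. \<integral>z. PiST (Ds m) (\<beta> m) z * PiST (Ds m) (\<zeta> m) z * \<phi> z \<partial>lebesgue_on (\<Omega> \<times> {0..T}))
             \<longlonglongrightarrow> (\<integral>z. \<beta>bar z * \<zeta>bar z * \<phi> z \<partial>lebesgue_on (\<Omega> \<times> {0..T}))"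
proof (intro allI impI)
  fix \<phi> :: "'a \<times> real \<Rightarrow> real" assume \<phi>: "continuous_on (closure \<Omega> \<times> {0..T}) \<phi>"
  note weak_\<beta> = assms(14) and weak_\<zeta> = assms(15)
  have D: "stgd \<Omega> p T (Ds m)" for m
    by unfold_locales (use assms in auto)
  interpret D0: stgd \<Omega> p T "Ds 0" by (rule D)
  define Q where "Q = \<Omega> \<times> {0..T}"
  have Qm [measurable]: "Q \<in> sets borel" unfolding Q_def by (rule D0.strip_borel)
  have bQ: "bounded Q" unfolding Q_def by (rule D0.bounded_strip)
  define b where "b m = PiBT (Ds m) T (\<beta> m)" for m
  define z where "z m = PiBT (Ds m) T (\<zeta> m)" for m
  \<comment> \<open>\<open>Lb\<close> and \<open>Lz\<close> are the reconstructions as given, used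
    where weak convergence is invoked; \<open>b\<close> and \<open>z\<close> are their Borel
    versions, used where Fubini is needed.\<close>
  define Lb where "Lb m = PiST (Ds m) (\<beta> m)" for m
  define Lz where "Lz m = PiST (Ds m) (\<zeta> m)" for m
  have bm [measurable]: "b m \<in> borel_measurable borel" and zm [measurable]: "z m \<in> borel_measurable borel" for m
    unfolding b_def z_def by (rule stgd.PiBT_measurable[OF D])+
  have bs: "b m w = 0" and zs: "z m w = 0" if "w \<notin> Q" for m w
    unfolding b_def z_def using that unfolding Q_def by (auto intro: stgd.PiBT_support[OF D])
  have bB: "\<exists>B. \<forall>w. \<bar>b m w\<bar> \<le> B" and zB: "\<exists>B. \<forall>w. \<bar>z m w\<bar> \<le> B" for m
    unfolding b_def z_def by (rule stgd.PiBT_bounded[OF D])+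
  have "\<forall>m. \<exists>Z. Z \<in> null_sets lborel \<and> (\<forall>w. w \<in> Q \<longrightarrow> w \<notin> Z \<longrightarrow> (\<forall>v. PiST (Ds m) v w = PiBT (Ds m) T v w))"
    using stgd.PiST_eq_PiBT[OF D] unfolding Q_def by blast
  from choice[OF this] obtain Z where Z: "\<And>m. Z m \<in> null_sets lborel"
    "\<And>m w v. w \<in> Q \<Longrightarrow> w \<notin> Z m \<Longrightarrow> PiST (Ds m) v w = PiBT (Ds m) T v w" by blast
  have Lbb: "Lb m w = b m w" and Lzz: "Lz m w = z m w" if "w \<in> Q" "w \<notin> Z m" for m w
    unfolding Lb_def b_def Lz_def z_def by (rule Z(2)[OF that])+
  have Qsub: "Q \<subseteq> closure \<Omega> \<times> {0..T}" unfolding Q_def using closure_subset by blast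
  have "compact (closure \<Omega> \<times> {0..T})"
    using assms(2) by (intro compact_Times) (auto simp: compact_closure)
  then have "bounded (\<phi> ` (closure \<Omega> \<times> {0..T}))"
    by (intro compact_imp_bounded compact_continuous_image \<phi>)
  then obtain M0 where "\<And>w. w \<in> closure \<Omega> \<times> {0..T} \<Longrightarrow> \<bar>\<phi> w\<bar> \<le> M0"
    unfolding bounded_iff by auto
  then have M0: "\<And>w. w \<in> Q \<Longrightarrow> \<bar>\<phi> w\<bar> \<le> M0" using Qsub by blast
  define \<psi> where "\<psi> w = (if w \<in> Q then \<phi> w else 0)" for w
  have "(\<lambda>w. indicator Q w *\<^sub>R \<phi> w) \<in> borel_measurable borel"
    by (rule borel_measurable_continuous_on_indicator[OF Qm continuous_on_subset[OF \<phi> Qsub]])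
  then have \<psi>m [measurable]: "\<psi> \<in> borel_measurable borel"
    unfolding \<psi>_def indicator_scaleR_eq_if .
  define M where "M = max M0 0"
  have M: "\<bar>\<psi> w\<bar> \<le> M" for w
    using M0[of w] by (auto simp: \<psi>_def M_def max_def)
  have square_le: "\<bar>(g w)\<^sup>2\<bar> \<le> B\<^sup>2" if "\<bar>g w\<bar> \<le> B" for g :: "'a \<times> real \<Rightarrow> real" and w B
    using power_mono[OF that abs_ge_zero, of 2] by simp
  \<comment> \<open>A bounded Borel version vanishing off the strip settles both membership in L^2
    and the value of the norm.\<close>
  have memLp_strip: "memLp (lebesgue_on Q) 2 f" and L2_strip: "(\<integral>w. (f w)\<^sup>2 \<partial>lebesgue_on Q) = (LBINT w. (f' w)\<^sup>2)"
    if f': "f' \<in> borel_measurable borel" and N: "N \<in> null_sets lborel" and eq: "\<And>w. w \<in> Q \<Longrightarrow> w \<notin> N \<Longrightarrow> f w = f' w"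
      and B: "\<exists>B. \<forall>w. \<bar>f' w\<bar> \<le> B" and s: "\<And>w. w \<notin> Q \<Longrightarrow> f' w = 0"
    for f f' :: "'a \<times> real \<Rightarrow> real" and N
  proof -
    obtain B where B: "\<And>w. \<bar>f' w\<bar> \<le> B" using B by blast
    have m2: "(\<lambda>w. (f' w)\<^sup>2) \<in> borel_measurable borel" using f' by measurable
    have eq2: "(f w)\<^sup>2 = (f' w)\<^sup>2" if "w \<in> Q" "w \<notin> N" for w using eq[OF that] by simp
    have ind: "(\<lambda>w. indicator Q w * (f' w)\<^sup>2) = (\<lambda>w. (f' w)\<^sup>2)"
      by (rule ext) (auto simp: indicator_def s)
    have "integrable lborel (\<lambda>w. (f' w)\<^sup>2)"
      by (rule integrable_bounded_support[OF m2 bQ, of "B\<^sup>2"]) (use square_le[OF B] s in auto)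
    then show "memLp (lebesgue_on Q) 2 f"
      unfolding memLp_2_iff
      using lebesgue_on_measurable[OF Qm f' N eq] lebesgue_on_integrable_eq[OF Qm m2 N eq2] ind by simp
    show "(\<integral>w. (f w)\<^sup>2 \<partial>lebesgue_on Q) = (LBINT w. (f' w)\<^sup>2)"
      using lebesgue_on_integral_eq[OF Qm m2 N eq2] ind by simp
  qed
  have Lb_L2: "memLp (lebesgue_on Q) 2 (Lb n)" "(\<integral>w. (Lb n w)\<^sup>2 \<partial>lebesgue_on Q) = (LBINT w. (b n w)\<^sup>2)" for n
    using memLp_strip[OF bm Z(1) _ bB] L2_strip[OF bm Z(1) _ bB] Lbb bs by blast+
  have Lz_L2: "memLp (lebesgue_on Q) 2 (Lz n)" "(\<integral>w. (Lz n w)\<^sup>2 \<partial>lebesgue_on Q) = (LBINT w. (z n w)\<^sup>2)" for n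
    using memLp_strip[OF zm Z(1) _ zB] L2_strip[OF zm Z(1) _ zB] Lzz zs by blast+
  obtain C1 where C1: "\<And>n. (\<integral>w. (Lb n w)\<^sup>2 \<partial>lebesgue_on Q) \<le> C1"
  proof (rule L2_bounded_if_weakly_bounded[of Lb "lebesgue_on Q"])
    show "bounded (range (\<lambda>n. \<integral>w. Lb n w * g w \<partial>lebesgue_on Q))"
      if "g \<in> borel_measurable (lebesgue_on Q)" "integrable (lebesgue_on Q) (\<lambda>w. (g w)\<^sup>2)" for g
      using weak_\<beta>[of g] that unfolding Lb_def Q_def memLp_2_iff by (blast intro: convergent_imp_bounded)
  qed (use Lb_L2(1) in \<open>auto simp: memLp_2_iff\<close>)
  obtain C2 where C2: "\<And>n. (\<integral>w. (Lz n w)\<^sup>2 \<partial>lebesgue_on Q) \<le> C2"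
  proof (rule L2_bounded_if_weakly_bounded[of Lz "lebesgue_on Q"])
    show "bounded (range (\<lambda>n. \<integral>w. Lz n w * g w \<partial>lebesgue_on Q))"
      if "g \<in> borel_measurable (lebesgue_on Q)" "integrable (lebesgue_on Q) (\<lambda>w. (g w)\<^sup>2)" for g
      using weak_\<zeta>[of g] that unfolding Lz_def Q_def memLp_2_iff by (blast intro: convergent_imp_bounded)
  qed (use Lz_L2(1) in \<open>auto simp: memLp_2_iff\<close>)
  define C where "C = max C1 C2"
  have bC: "(LBINT w. (b n w)\<^sup>2) \<le> C" and zC: "(LBINT w. (z n w)\<^sup>2) \<le> C" for n
    using C1[of n] C2[of n] unfolding Lb_L2(2) Lz_L2(2) C_def by linarith+
  interpret strip_sequences \<Omega> T b z C
    by unfold_locales (use assms(1-3) bB zB bC zC bs zs in \<open>auto simp: Q_def\<close>)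
  obtain V where V: "\<And>n. (\<integral>t. dualnorm \<Omega> p (Ds n) (deltaD (Ds n) (\<beta> n) t) \<partial>lebesgue_on {0..T}) \<le> V"
    using assms(10) unfolding bounded_iff by (auto simp: abs_le_iff)
  obtain N where N: "\<And>m. sqrt (\<integral>t. (lpnorm (lebesgue_on \<Omega>) p (gradST (Ds m) (\<zeta> m) t))\<^sup>2 \<partial>lebesgue_on {0..T}) \<le> N"
    using assms(11) unfolding bounded_iff by (auto simp: abs_le_iff)
  have N2: "(\<integral>t. (lpnorm (lebesgue_on \<Omega>) p (gradST (Ds m) (\<zeta> m) t))\<^sup>2 \<partial>lebesgue_on {0..T}) \<le> N\<^sup>2" for m
    using N[of m] by (rule sqrt_le_D)
  have weak_b: "convergent (\<lambda>n. LBINT w. PiBT (Ds n) T (\<beta> n) w * g w)"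
    if gm [measurable]: "g \<in> borel_measurable borel" and gB: "\<And>w. w \<in> \<Omega> \<times> {0..T} \<Longrightarrow> \<bar>g w\<bar> \<le> B" for g B
  proof -
    have g': "(\<lambda>w. indicator Q w * g w) \<in> borel_measurable borel" by measurable
    have "memLp (lebesgue_on Q) 2 g"
    proof (rule memLp_strip[OF g', of "{}"])
      have "\<bar>indicator Q w * g w\<bar> \<le> max B 0" for w
        using gB[of w] unfolding Q_def[symmetric] by (cases "w \<in> Q") auto
      then show "\<exists>B. \<forall>w. \<bar>indicator Q w * g w\<bar> \<le> B" by blast
    qed auto
    then have "convergent (\<lambda>n. \<integral>w. Lb n w * g w \<partial>lebesgue_on Q)"
      unfolding Lb_def Q_def using weak_\<beta> by (blast intro: convergentI)
    moreover have "(\<integral>w. Lb n w * g w \<partial>lebesgue_on Q) = (LBINT w. PiBT (Ds n) T (\<beta> n) w * g w)" for n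
    proof -
      have "(\<integral>w. Lb n w * g w \<partial>lebesgue_on Q) = (LBINT w. indicator Q w * (b n w * g w))"
        by (rule lebesgue_on_integral_eq[OF Qm _ Z(1)[of n]]) (use Lbb in auto)
      also have "(\<lambda>w. indicator Q w * (b n w * g w)) = (\<lambda>w. PiBT (Ds n) T (\<beta> n) w * g w)"
        unfolding b_def[symmetric] by (rule ext) (auto simp: indicator_def bs)
      finally show ?thesis .
    qed
    ultimately show ?thesis by simp
  qed
  have "ucauchy (\<lambda>n m. LBINT w. b n w * z m w * \<phi> w)"
  proof (rule ucauchy_product[OF _ _ \<phi>])
    show "\<exists>n0. \<forall>n\<ge>n0. \<forall>n'\<ge>n0. (LBINT t. ((LBINT x. b n (x, t) * a x) - (LBINT x. b n' (x, t) * a x))\<^sup>2) \<le> e"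
      if "smooth_expr a" "e > 0" for a e
      unfolding b_def by (rule L2_Cauchy_pairing_smooth[OF D assms(6) V bC[unfolded b_def] weak_b that])
    show "\<exists>\<delta>>0. \<forall>\<xi> m. norm \<xi> < \<delta> \<longrightarrow> (LBINT w. (z m (fst w + \<xi>, snd w) - z m w)\<^sup>2) \<le> \<epsilon>\<^sup>2"
      if "\<epsilon> > 0" for \<epsilon>
      unfolding z_def by (rule uniform_translation_estimate[OF D assms(7) assms(9) N2 that])
  qed
  moreover have "(LBINT w. b n w * z m w * \<phi> w) = (\<integral>w. Lb n w * (Lz m w * \<phi> w) \<partial>lebesgue_on Q)" for n m
  proof -
    have "(\<integral>w. Lb n w * (Lz m w * \<phi> w) \<partial>lebesgue_on Q) = (LBINT w. indicator Q w * (b n w * (z m w * \<psi> w)))"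
    \<comment> \<open>As n and m are independent, the null sets of two discretisations are removed
      at once.\<close>
    proof (rule lebesgue_on_integral_eq[OF Qm _ null_sets.Un[OF Z(1)[of n] Z(1)[of m]]])
      show "(\<lambda>w. b n w * (z m w * \<psi> w)) \<in> borel_measurable borel" by measurable
      show "Lb n w * (Lz m w * \<phi> w) = b n w * (z m w * \<psi> w)" if "w \<in> Q" "w \<notin> Z n \<union> Z m" for w
        using that by (simp add: Lbb Lzz \<psi>_def)
    qed
    also have "(\<lambda>w. indicator Q w * (b n w * (z m w * \<psi> w))) = (\<lambda>w. b n w * z m w * \<phi> w)"
      by (rule ext) (auto simp: indicator_def bs \<psi>_def)
    finally show ?thesis ..
  qed
  ultimately have uc: "ucauchy (\<lambda>n m. \<integral>w. Lb n w * (Lz m w * \<phi> w) \<partial>lebesgue_on Q)" by simp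
  \<comment> \<open>The inner limit in n tests \<open>Lb n\<close> against the fixed L^2 function Lz
    m \<phi>, the outer limit in m tests \<open>Lz m\<close> against \<beta>bar \<phi>. The order of
    the factors in the limit follows the second use and is restored at the end.\<close>
  have "(\<lambda>m. \<integral>w. Lb m w * (Lz m w * \<phi> w) \<partial>lebesgue_on Q) \<longlonglongrightarrow> (\<integral>w. \<zeta>bar w * (\<beta>bar w * \<phi> w) \<partial>lebesgue_on Q)"
  proof (rule ucauchy_diagonal[OF uc])
    fix m
    have "memLp (lebesgue_on Q) 2 (\<lambda>w. Lz m w * \<phi> w)"
    proof (rule memLp_strip[OF _ Z(1)[of m]])
      show "(\<lambda>w. z m w * \<psi> w) \<in> borel_measurable borel" by measurable
      obtain B where B: "\<And>w. \<bar>z m w\<bar> \<le> B" using zB by blast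
      have "\<bar>z m w * \<psi> w\<bar> \<le> B * M" for w
        unfolding abs_mult using B[of w] M[of w] by (intro mult_mono) auto
      then show "\<exists>B. \<forall>w. \<bar>z m w * \<psi> w\<bar> \<le> B" by blast
    qed (use Lzz zs in \<open>auto simp: \<psi>_def\<close>)
    then show "(\<lambda>n. \<integral>w. Lb n w * (Lz m w * \<phi> w) \<partial>lebesgue_on Q) \<longlonglongrightarrow> (\<integral>w. \<beta>bar w * (Lz m w * \<phi> w) \<partial>lebesgue_on Q)"
      unfolding Lb_def Q_def by (rule weak_\<beta>)
  next
    have [measurable]: "\<phi> \<in> borel_measurable (lebesgue_on Q)"
      by (rule lebesgue_on_measurable[OF Qm \<psi>m, of "{}"]) (auto simp: \<psi>_def)
    have [measurable]: "\<beta>bar \<in> borel_measurable (lebesgue_on Q)"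
      and \<beta>2: "integrable (lebesgue_on Q) (\<lambda>w. (\<beta>bar w)\<^sup>2)"
      using assms(12) unfolding memLp_2_iff Q_def by auto
    \<comment> \<open>Boundedness of \<phi> on the strip keeps \<beta>bar \<phi> in L^2 and makes it
      a legitimate test function.\<close>
    have "integrable (lebesgue_on Q) (\<lambda>w. (\<beta>bar w * \<phi> w)\<^sup>2)"
    proof (rule Bochner_Integration.integrable_bound[of _ "\<lambda>w. M\<^sup>2 * (\<beta>bar w)\<^sup>2"])
      show "AE w in lebesgue_on Q. norm ((\<beta>bar w * \<phi> w)\<^sup>2) \<le> norm (M\<^sup>2 * (\<beta>bar w)\<^sup>2)"
      proof (rule AE_I2)
        fix w assume "w \<in> space (lebesgue_on Q)"
        then have "\<phi> w = \<psi> w" by (simp add: \<psi>_def)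
        then have "(\<phi> w)\<^sup>2 \<le> M\<^sup>2" using power_mono[OF M[of w] abs_ge_zero, of 2] by simp
        then have "(\<beta>bar w)\<^sup>2 * (\<phi> w)\<^sup>2 \<le> (\<beta>bar w)\<^sup>2 * M\<^sup>2" by (intro mult_left_mono) auto
        then show "norm ((\<beta>bar w * \<phi> w)\<^sup>2) \<le> norm (M\<^sup>2 * (\<beta>bar w)\<^sup>2)"
          by (simp add: power_mult_distrib mult.commute)
      qed
    qed (use \<beta>2 in auto)
    then have "memLp (lebesgue_on Q) 2 (\<lambda>w. \<beta>bar w * \<phi> w)" unfolding memLp_2_iff by simp
    then have "(\<lambda>m. \<integral>w. Lz m w * (\<beta>bar w * \<phi> w) \<partial>lebesgue_on Q) \<longlonglongrightarrow> (\<integral>w. \<zeta>bar w * (\<beta>bar w * \<phi> w) \<partial>lebesgue_on Q)"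
      unfolding Lz_def Q_def by (rule weak_\<zeta>)
    then show "(\<lambda>m. \<integral>w. \<beta>bar w * (Lz m w * \<phi> w) \<partial>lebesgue_on Q) \<longlonglongrightarrow> (\<integral>w. \<zeta>bar w * (\<beta>bar w * \<phi> w) \<partial>lebesgue_on Q)"
      by (simp only: mult.left_commute)
  qed
  then show "(\<lambda>m. \<integral>z. PiST (Ds m) (\<beta> m) z * PiST (Ds m) (\<zeta> m) z * \<phi> z \<partial>lebesgue_on (\<Omega> \<times> {0..T}))
             \<longlonglongrightarrow> (\<integral>z. \<beta>bar z * \<zeta>bar z * \<phi> z \<partial>lebesgue_on (\<Omega> \<times> {0..T}))"
    unfolding Lb_def Lz_def Q_def by (simp add: ac_simps)
qed

end
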